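(* Let $N\ge 2$, $1\le p<+\infty$ and $0\le\alpha\le 1$, and let $G\subset\mathbb{R}^N$ be a bounded domain with boundary $\partial G$ of class $C^{0,\alpha}$. Let $A\subseteq\partial G$ be a relatively open subset of $\partial G$ with positive $(N-1)$-dimensional measure and such that the (exterior) unit normal vector $\nu(x)$ is continuous on $A$. Let $\Gamma_0\subseteq\partial G\setminus\overline{A}$. Then there exists a positive constant $\eta_{p,\alpha}(A,\Gamma_0,G)$ such that $$\|\mathbf{v}\|_{L^p(G)}\le \eta_{p,\alpha}(A,\Gamma_0,G)^{-1}\,\|\delta_{\Gamma_0}^{\alpha}\,D\mathbf{v}\|_{L^p(G)}$$ for any vector function $\mathbf{v}:G\to \mathrm{span}_{x\in A}\,\nu(x)\subseteq\mathbb{R}^N$ belonging to $W^{1,p}_{\Gamma_0,\alpha}(G)$ such that $\langle\mathbf{v},\nu\rangle=0$ a.e. on $A$.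
   Context: When $\alpha=0$, "boundary of class $C^{0,\alpha}$" means that $\partial G$ is locally the graph of a continuous function. $\delta_{\Gamma_0}(x)$ denotes the distance of $x\in G$ to $\Gamma_0$. $\mathrm{span}_{x\in A}\,\nu(x)$ is the linear subspace of $\mathbb{R}^N$ spanned by the vectors $\nu(x)$, $x\in A$. $D\mathbf{v}$ is the (weak) Jacobian matrix of $\mathbf{v}=(v_1,\dots,v_N)$; weighted norms are computed entrywise: $\|\delta_{\Gamma_0}^{\alpha}D\mathbf{v}\|_{L^p(G)}=\big(\sum_{i,j=1}^N\|\delta_{\Gamma_0}^{\alpha}\,\partial_j v_i\|_{L^p(G)}^p\big)^{1/p}$, and similarly $\|\mathbf{v}\|_{L^p(G)}=\big(\sum_i\|v_i\|_{L^p(G)}^p\big)^{1/p}$. $W^{1,p}_{\Gamma_0,\alpha}(G)$ is the weighted Sobolev space with norm $\|\mathbf{v}\|_{L^p(G)}+\|\delta_{\Gamma_0}^{\alpha}D\mathbf{v}\|_{L^p(G)}$. Values of $\mathbf{v}$ on $A$ are understood in the sense of traces; a.e. on $A$ is with respect to $(N-1)$-dimensional measure. *)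

theory Defs
  imports "HOL-Analysis.Analysis"
begin

section \<open>Hausdorff measure of integer dimension\<close>

text \<open>
  The covers below use arbitrary sets, and the usual factor is included, so that on
  \<open>m\<close>-dimensional \<open>C\<^sup>1\<close> surfaces the measure is the surface measure.  The case distinction only
  matters for \<open>m = 0\<close>, where \<open>0 ^ 0 = 1\<close>.
\<close>

definition hausdorff_pre :: "nat \<Rightarrow> real \<Rightarrow> 'a::metric_space set \<Rightarrow> ennreal" where
  "hausdorff_pre m d A =
     (INF C \<in> {C :: nat \<Rightarrow> 'a set. A \<subseteq> (\<Union>i. C i) \<and> (\<forall>i. bounded (C i) \<and> diameter (C i) \<le> d)}.
        \<Sum>i. if C i = {} then 0 else ennreal (unit_ball_vol (real m) * (diameter (C i) / 2) ^ m))"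

definition hausdorff_outer :: "nat \<Rightarrow> 'a::metric_space set \<Rightarrow> ennreal" where
  "hausdorff_outer m A = (SUP d \<in> {0<..}. hausdorff_pre m d A)"

text \<open>
  The constant \<^const>\<open>measure_of\<close> yields the zero measure for a set function that is not a measure.
  This does not happen here: Hausdorff outer measure is a metric outer measure, hence countably
  additive on the Borel sets.
\<close>

definition hausdorff_measure :: "nat \<Rightarrow> 'a::metric_space measure" where
  "hausdorff_measure m = measure_of UNIV (sets borel) (hausdorff_outer m)"


section \<open>Domains with boundary of class \<open>C\<^sup>0\<^sup>,\<^sup>\<alpha>\<close>, and their normals\<close>

definition bounded_domain :: "'a::euclidean_space set \<Rightarrow> bool" where
  "bounded_domain G \<longleftrightarrow> G \<noteq> {} \<and> open G \<and> connected G \<and> bounded G"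

text \<open>
  Rotated coordinates are given by a unit vector \<open>e\<close>: the height of a point \<open>y\<close> is \<open>y \<bullet> e\<close> and its
  horizontal part is its orthogonal projection to the hyperplane orthogonal to \<open>e\<close>.
\<close>

definition horizontal :: "'a::real_inner \<Rightarrow> 'a \<Rightarrow> 'a" where
  "horizontal e y = y - (y \<bullet> e) *\<^sub>R e"

definition hoelder_on :: "real \<Rightarrow> 'a::metric_space set \<Rightarrow> ('a \<Rightarrow> real) \<Rightarrow> bool" where
  "hoelder_on \<alpha> S f \<longleftrightarrow>
     (if \<alpha> = 0 then continuous_on S f
      else \<exists>C. \<forall>x\<in>S. \<forall>y\<in>S. \<bar>f x - f y\<bar> \<le> C * dist x y powr \<alpha>)"

text \<open>
  Inside the open set \<open>U\<close>, the boundary of \<open>G\<close> is the graph of \<open>\<phi>\<close> in direction \<open>e\<close>, and \<open>G\<close> is the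
  part below the graph, so that \<open>e\<close> points out of \<open>G\<close>.
\<close>

definition graph_chart ::
    "'a::euclidean_space set \<Rightarrow> 'a set \<Rightarrow> 'a \<Rightarrow> ('a \<Rightarrow> real) \<Rightarrow> bool" where
  "graph_chart G U e \<phi> \<longleftrightarrow>
     open U \<and> norm e = 1 \<and> continuous_on (horizontal e ` U) \<phi> \<and>
     frontier G \<inter> U = {y \<in> U. y \<bullet> e = \<phi> (horizontal e y)} \<and>
     G \<inter> U = {y \<in> U. y \<bullet> e < \<phi> (horizontal e y)}"

definition boundary_C0 :: "real \<Rightarrow> 'a::euclidean_space set \<Rightarrow> bool" where
  "boundary_C0 \<alpha> G \<longleftrightarrow>
     (\<forall>x\<in>frontier G. \<exists>U e \<phi>. x \<in> U \<and> graph_chart G U e \<phi> \<and> hoelder_on \<alpha> (horizontal e ` U) \<phi>)"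

text \<open>
  The vector \<open>g\<close> is the gradient of the local graph function \<open>\<phi>\<close> at the horizontal part of \<open>x\<close>,
  taken in the hyperplane orthogonal to \<open>e\<close>.
\<close>

definition exterior_unit_normal :: "'a::euclidean_space set \<Rightarrow> 'a \<Rightarrow> 'a \<Rightarrow> bool" where
  "exterior_unit_normal G x n \<longleftrightarrow>
     x \<in> frontier G \<and>
     (\<exists>U e \<phi> g. x \<in> U \<and> graph_chart G U e \<phi> \<and> g \<bullet> e = 0 \<and>
        (\<phi> has_derivative (\<lambda>h. g \<bullet> h)) (at (horizontal e x) within {z. z \<bullet> e = 0}) \<and>
        n = (e - g) /\<^sub>R norm (e - g))"


section \<open>Lebesgue spaces\<close>

definition Lp :: "real \<Rightarrow> 'a measure \<Rightarrow> ('a \<Rightarrow> real) \<Rightarrow> bool" where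
  "Lp p M f \<longleftrightarrow> f \<in> borel_measurable M \<and> integrable M (\<lambda>x. \<bar>f x\<bar> powr p)"

definition Lp_norm :: "real \<Rightarrow> 'a measure \<Rightarrow> ('a \<Rightarrow> real) \<Rightarrow> real" where
  "Lp_norm p M f = (\<integral>x. \<bar>f x\<bar> powr p \<partial>M) powr (1 / p)"

definition Lp_tendsto :: "real \<Rightarrow> 'a measure \<Rightarrow> (nat \<Rightarrow> 'a \<Rightarrow> real) \<Rightarrow> ('a \<Rightarrow> real) \<Rightarrow> bool" where
  "Lp_tendsto p M f g \<longleftrightarrow>
     (\<forall>k. Lp p M (\<lambda>x. f k x - g x)) \<and> (\<lambda>k. Lp_norm p M (\<lambda>x. f k x - g x)) \<longlonglongrightarrow> 0"

definition Lp_norm_vec :: "real \<Rightarrow> 'a measure \<Rightarrow> ('a \<Rightarrow> real^'n) \<Rightarrow> real" where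
  "Lp_norm_vec p M v = (\<Sum>i\<in>UNIV. Lp_norm p M (\<lambda>x. v x $ i) powr p) powr (1 / p)"

definition Lp_norm_mat :: "real \<Rightarrow> 'a measure \<Rightarrow> ('a \<Rightarrow> real^'n^'m) \<Rightarrow> real" where
  "Lp_norm_mat p M B = (\<Sum>i\<in>UNIV. \<Sum>j\<in>UNIV. Lp_norm p M (\<lambda>x. B x $ i $ j) powr p) powr (1 / p)"


section \<open>Weak derivatives and the weighted Sobolev space\<close>

definition partial_deriv :: "'n \<Rightarrow> (real^'n \<Rightarrow> real) \<Rightarrow> real^'n \<Rightarrow> real" where
  "partial_deriv j f x = frechet_derivative f (at x) (axis j 1)"

definition smooth :: "(real^'n \<Rightarrow> real) \<Rightarrow> bool" where
  "smooth f \<longleftrightarrow> (\<forall>js x. foldr partial_deriv js f differentiable (at x))"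

definition test_function :: "(real^'n) set \<Rightarrow> (real^'n \<Rightarrow> real) \<Rightarrow> bool" where
  "test_function G \<phi> \<longleftrightarrow>
     smooth \<phi> \<and> compact (closure {x. \<phi> x \<noteq> 0}) \<and> closure {x. \<phi> x \<noteq> 0} \<subseteq> G"

definition locally_integrable :: "'a::euclidean_space set \<Rightarrow> ('a \<Rightarrow> real) \<Rightarrow> bool" where
  "locally_integrable G f \<longleftrightarrow> (\<forall>K. compact K \<and> K \<subseteq> G \<longrightarrow> f absolutely_integrable_on K)"

definition weak_partial ::
    "(real^'n) set \<Rightarrow> 'n \<Rightarrow> (real^'n \<Rightarrow> real) \<Rightarrow> (real^'n \<Rightarrow> real) \<Rightarrow> bool" where
  "weak_partial G j f g \<longleftrightarrow>
     locally_integrable G f \<and> locally_integrable G g \<and>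
     (\<forall>\<phi>. test_function G \<phi> \<longrightarrow>
        (\<integral>x. f x * partial_deriv j \<phi> x \<partial>lebesgue_on G) = - (\<integral>x. g x * \<phi> x \<partial>lebesgue_on G))"

definition weak_jacobian ::
    "(real^'n) set \<Rightarrow> (real^'n \<Rightarrow> real^'n) \<Rightarrow> (real^'n \<Rightarrow> real^'n^'n) \<Rightarrow> bool" where
  "weak_jacobian G v D \<longleftrightarrow> (\<forall>i j. weak_partial G j (\<lambda>x. v x $ i) (\<lambda>x. D x $ i $ j))"

text \<open>
  The weight \<open>\<delta>\<^sup>\<alpha>\<close>, where \<open>\<delta>\<close> is the distance to \<open>\<Gamma>\<close>.  In HOL-Analysis the distance to the empty set
  is \<open>0\<close>, which would make the weight vanish; with no set to degenerate on, the weight is \<open>1\<close>.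
\<close>

definition dist_weight :: "real \<Rightarrow> 'a::metric_space set \<Rightarrow> 'a \<Rightarrow> real" where
  "dist_weight \<alpha> \<Gamma> x = (if \<Gamma> = {} then 1 else infdist x \<Gamma> powr \<alpha>)"

definition weighted_sobolev ::
    "real \<Rightarrow> real \<Rightarrow> (real^'n) set \<Rightarrow> (real^'n) set \<Rightarrow> (real^'n \<Rightarrow> real^'n) set" where
  "weighted_sobolev p \<alpha> \<Gamma> G =
     {v. (\<forall>i. Lp p (lebesgue_on G) (\<lambda>x. v x $ i)) \<and>
         (\<exists>D. weak_jacobian G v D \<and>
            (\<forall>i j. Lp p (lebesgue_on G) (\<lambda>x. dist_weight \<alpha> \<Gamma> x * D x $ i $ j)))}"


section \<open>Traces\<close>

text \<open>
  The function \<open>w\<close> is the trace of \<open>v\<close> on the part \<open>A\<close> of the boundary of \<open>G\<close> if, near each point of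
  \<open>A\<close>, \<open>v\<close> is a \<open>W\<^sup>1\<^sup>,\<^sup>p\<close>-limit in \<open>G\<close> of functions that are continuously differentiable on the whole
  space and whose restrictions to \<open>A\<close> converge to \<open>w\<close> in \<open>L\<^sup>p\<close>.  The definition is local because
  neither regularity of the boundary nor a bound on the weight is available away from \<open>A\<close>, nor
  uniformly up to the relative boundary of \<open>A\<close>.
\<close>

definition C1_function :: "(real^'n \<Rightarrow> real^'n) \<Rightarrow> bool" where
  "C1_function f \<longleftrightarrow>
     (\<forall>x. f differentiable (at x)) \<and> continuous_on UNIV (\<lambda>x. jacobian f (at x))"

definition has_trace ::
    "real \<Rightarrow> (real^'n) set \<Rightarrow> (real^'n) set \<Rightarrow> (real^'n \<Rightarrow> real^'n) \<Rightarrow> (real^'n \<Rightarrow> real^'n) \<Rightarrow> bool" where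
  "has_trace p G A v w \<longleftrightarrow>
     (\<forall>x\<in>A. \<exists>U D f. open U \<and> x \<in> U \<and> weak_jacobian (G \<inter> U) v D \<and> (\<forall>k::nat. C1_function (f k)) \<and>
        (\<forall>i. Lp_tendsto p (lebesgue_on (G \<inter> U)) (\<lambda>k y. f k y $ i) (\<lambda>y. v y $ i)) \<and>
        (\<forall>i j. Lp_tendsto p (lebesgue_on (G \<inter> U))
                 (\<lambda>k y. jacobian (f k) (at y) $ i $ j) (\<lambda>y. D y $ i $ j)) \<and>
        (\<forall>i. Lp_tendsto p (restrict_space (hausdorff_measure (CARD('n) - 1)) (A \<inter> U))
                 (\<lambda>k y. f k y $ i) (\<lambda>y. w y $ i)))"

end

theory Submission
  imports Defs
begin

text \<open>
  Write \<open>v = c + (v - c)\<close>, where \<open>c = v y\<close> for a well-chosen interior point \<open>y\<close>, so that \<open>c\<close> lies in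
  the span of the normals.  No compactness is used: with the weight \<open>\<delta>\<^sup>\<alpha>\<close> the embedding into
  \<open>L\<^sup>p\<close> need not be compact.

  The norm of \<open>v - c\<close> is bounded by comparing \<open>v\<close> with its translates, which only needs the
  fundamental theorem of calculus on almost every segment.  Chains of translated balls reach every
  compact part of \<open>G\<close>.  Near the boundary the depth \<open>\<tau>\<close> below the graph satisfies
  \<open>\<tau> \<le> C \<delta>\<^sup>\<alpha>\<close> by Hoelder continuity, and a Hardy inequality with weight \<open>\<tau>\<close> follows by
  moving the layer \<open>a \<le> \<tau> < 2a\<close> down by \<open>a\<close> and by \<open>2a\<close>: the two images tile the next layer, so
  each layer carries at most \<open>3/4\<close> of the mass of the next one, up to the gradient term.

  The norm of \<open>c\<close> is bounded through the trace.  Near finitely many points of \<open>A\<close> whose normals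
  span, \<open>\<langle>c, \<nu>\<rangle> = \<langle>c - v, \<nu>\<rangle> + \<langle>v - w, \<nu>\<rangle>\<close>, and \<open>v - w\<close> is controlled by the gradient along
  vertical segments.  Integrals over the graph are transported to Lebesgue measure by the fact that
  the vertical projection does not increase Hausdorff measure; no area formula is needed.
\<close>

section \<open>Smooth bump functions\<close>

text \<open>In a boundary layer one shift alone would not help: it maps the layer into half of the
  next one and gives a factor \<open>3/2\<close>, hence no decay. The images of both shifts tile the
  next layer, so twice the mass of a layer is at most \<open>3/2\<close> of the mass of the next;
  any number between 1 and 2 would serve. The gradient term is scale invariant: at depth about
  \<open>a\<close> the shifts have length about \<open>a\<close>, and there the weight is at least a
  multiple of \<open>a\<close>. Finite \<open>L^p\<close> mass enters when the decay is summed over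
  the layers and part of the sum is cancelled.

  No constant may depend on \<open>v\<close>. Geometric compactness is harmless, since finite covers
  are chosen before \<open>v\<close>. The trace argument replaces \<open>\<nu>\<close> near a point
  by its value there, at the price of an error \<open>\<epsilon> * norm c\<close>. Its coefficient
  is independent of \<open>\<epsilon>\<close>, so a small \<open>\<epsilon>\<close>, fixed before
  the collars and their constants, lets half of \<open>norm c powr p\<close> be absorbed.\<close>

definition smooth_seq :: "(nat \<Rightarrow> real \<Rightarrow> real) \<Rightarrow> bool" where
  "smooth_seq F \<longleftrightarrow> (\<forall>k s. (F k has_real_derivative F (Suc k) s) (at s))"

lemma smooth_seq_continuous: "smooth_seq F \<Longrightarrow> continuous_on UNIV (F k)"
  unfolding smooth_seq_def by (meson DERIV_isCont continuous_at_imp_continuous_on)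

lemma smooth_seq_affine:
  assumes "smooth_seq F"
  shows "smooth_seq (\<lambda>k s. c ^ k * F k (c * s + d))"
  unfolding smooth_seq_def
proof (intro allI)
  fix k s
  have "(F k has_real_derivative F (Suc k) (c * s + d)) (at (c * s + d))"
    using assms by (simp add: smooth_seq_def)
  then have "((\<lambda>s. F k (c * s + d)) has_real_derivative F (Suc k) (c * s + d) * c) (at s)"
    by (rule DERIV_chain2) (auto intro!: derivative_eq_intros)
  then show "((\<lambda>s. c ^ k * F k (c * s + d)) has_real_derivative c ^ Suc k * F (Suc k) (c * s + d)) (at s)"
    by (auto intro!: derivative_eq_intros simp: algebra_simps)
qed

text \<open>The entry of index \<open>k\<close> is Leibniz's formula. Differentiating it gives two
  sums; an index shift in the first puts both over the same products, and Pascal's rule adds the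
  coefficients.\<close>

lemma smooth_seq_mult:
  assumes F: "smooth_seq F" and H: "smooth_seq H"
  shows "smooth_seq (\<lambda>k s. \<Sum>i\<le>k. of_nat (k choose i) * F i s * H (k - i) s)"
  unfolding smooth_seq_def
proof (intro allI)
  fix k s
  define T where "T = (\<lambda>i j. F i s * H j s)"
  have dF: "(F i has_real_derivative F (Suc i) s) (at s)" for i
    using F by (simp add: smooth_seq_def)
  have dH: "(H i has_real_derivative H (Suc i) s) (at s)" for i
    using H by (simp add: smooth_seq_def)
  have 1: "((\<lambda>s. \<Sum>i\<le>k. of_nat (k choose i) * F i s * H (k - i) s) has_real_derivative
     (\<Sum>i\<le>k. of_nat (k choose i) * (T (Suc i) (k - i) + T i (Suc (k - i))))) (at s)"
    unfolding T_def
    by (rule DERIV_sum) (rule derivative_eq_intros dF dH refl | simp add: algebra_simps)+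
  have 2: "(\<Sum>i\<le>k. of_nat (k choose i) * T (Suc i) (k - i))
      = (\<Sum>i\<le>Suc k. (if i = 0 then 0 else of_nat (k choose (i - 1)) * T i (Suc k - i)))"
    by (simp add: sum.atMost_Suc_shift del: sum.atMost_Suc)
  have 3: "(\<Sum>i\<le>k. of_nat (k choose i) * T i (Suc (k - i)))
      = (\<Sum>i\<le>Suc k. of_nat (k choose i) * T i (Suc k - i))"
    by (auto intro!: sum.cong simp: Suc_diff_le)
  have "(\<Sum>i\<le>k. of_nat (k choose i) * (T (Suc i) (k - i) + T i (Suc (k - i))))
     = (\<Sum>i\<le>Suc k. of_nat (Suc k choose i) * T i (Suc k - i))"
    unfolding distrib_left sum.distrib 2 3
  proof (subst sum.distrib[symmetric], rule sum.cong[OF refl])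
    fix i assume "i \<in> {..Suc k}"
    show "(if i = 0 then 0 else of_nat (k choose (i - 1)) * T i (Suc k - i)) + of_nat (k choose i) * T i (Suc k - i) =
         of_nat (Suc k choose i) * T i (Suc k - i)"
      by (cases i) (auto simp: algebra_simps)
  qed
  with 1 show "((\<lambda>s. \<Sum>i\<le>k. of_nat (k choose i) * F i s * H (k - i) s) has_real_derivative
      (\<Sum>i\<le>Suc k. of_nat (Suc k choose i) * F i s * H (Suc k - i) s)) (at s)"
    by (simp add: T_def mult.assoc)
qed

text \<open>Differentiating \<open>q(1/s) exp(-1/s)\<close> replaces the polynomial \<open>q\<close>
  by \<open>X^2 (q - q')\<close>. So \<open>cutoff k\<close> is the \<open>k\<close>-th derivative
  of the function equal to \<open>exp(-1/s)\<close> for positive \<open>s\<close> and to 0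
  elsewhere.\<close>

fun cutoff_poly :: "nat \<Rightarrow> real poly" where
  "cutoff_poly 0 = 1"
| "cutoff_poly (Suc k) = monom 1 2 * (cutoff_poly k - pderiv (cutoff_poly k))"

definition cutoff :: "nat \<Rightarrow> real \<Rightarrow> real" where
  "cutoff k s = (if s > 0 then poly (cutoff_poly k) (1 / s) * exp (- (1 / s)) else 0)"

lemma poly_times_exp_tendsto_0: "((\<lambda>x. poly q x * exp (- x)) \<longlongrightarrow> (0::real)) at_top"
proof -
  have "((\<lambda>x. \<Sum>i\<le>degree q. coeff q i * (x ^ i / exp x)) \<longlongrightarrow> (\<Sum>i\<le>degree q. coeff q i * 0)) at_top"
    by (intro tendsto_intros tendsto_power_div_exp_0)
  then show ?thesis
    by (simp add: poly_altdef sum_distrib_right exp_minus field_simps sum_divide_distrib)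
qed

lemma smooth_seq_cutoff: "smooth_seq cutoff"
  unfolding smooth_seq_def
proof (intro allI)
  fix k :: nat and s :: real
  consider "s > 0" | "s < 0" | "s = 0" by linarith
  then show "(cutoff k has_real_derivative cutoff (Suc k) s) (at s)"
  proof cases
    case 1
    have "((\<lambda>s. poly (cutoff_poly k) (1 / s) * exp (- (1 / s))) has_real_derivative cutoff (Suc k) s) (at s)"
      using 1
      apply (auto intro!: derivative_eq_intros DERIV_chain2[OF poly_DERIV] simp: cutoff_def)
      apply (simp add: poly_monom field_simps power2_eq_square)
      done
    moreover have "\<forall>\<^sub>F t in nhds s. cutoff k t = poly (cutoff_poly k) (1 / t) * exp (- (1 / t))"
      using eventually_nhds_in_open[of "{0<..}" s] 1 by (auto elim!: eventually_mono simp: cutoff_def)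
    ultimately show ?thesis
      by (subst DERIV_cong_ev[OF refl _ refl]) auto
  next
    case 2
    have "\<forall>\<^sub>F t in nhds s. cutoff k t = 0"
      using eventually_nhds_in_open[of "{..<0}" s] 2 by (auto elim!: eventually_mono simp: cutoff_def)
    moreover have "((\<lambda>t::real. 0::real) has_real_derivative cutoff (Suc k) s) (at s)"
      using 2 by (simp add: cutoff_def)
    ultimately show ?thesis
      by (subst DERIV_cong_ev[OF refl _ refl]) auto
  next
    case 3
    \<comment> \<open>At 0 the right difference quotient is a polynomial in \<open>1/h\<close> times
      \<open>exp(-1/h)\<close>; the extra factor \<open>monom 1 1\<close> is the division by
      \<open>h\<close>.\<close>
    have "((\<lambda>h. poly (monom 1 1 * cutoff_poly k) (inverse h) * exp (- inverse h)) \<longlongrightarrow> 0) (at_right (0::real))"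
      by (rule filterlim_compose[OF poly_times_exp_tendsto_0 filterlim_inverse_at_top_right])
    then have R: "((\<lambda>h. cutoff k h / h) \<longlongrightarrow> 0) (at_right 0)"
      by (rule Lim_transform_eventually)
        (auto intro!: eventually_at_rightI[of 0 1] simp: cutoff_def poly_monom field_simps)
    have L: "((\<lambda>h. cutoff k h / h) \<longlongrightarrow> 0) (at_left 0)"
      by (rule Lim_transform_eventually[of "\<lambda>_. 0"])
        (auto intro!: eventually_at_leftI[of "-1"] simp: cutoff_def)
    have "((\<lambda>h. cutoff k h / h) \<longlongrightarrow> 0) (at 0)"
      using L R by (simp add: filterlim_split_at)
    then show ?thesis
      by (simp add: DERIV_def 3) (simp add: cutoff_def)
  qed
qed

lemma cutoff_0_props:
  "0 \<le> cutoff 0 s" "cutoff 0 s \<le> 1" "cutoff 0 s = 0 \<longleftrightarrow> s \<le> 0"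
  by (auto simp: cutoff_def)

text \<open>The derivatives of \<open>cutoff 0 (n (s - a)) * cutoff 0 (n (b - s))\<close>, spelled
  out in the form in which \<open>smooth_seq_mult\<close> and \<open>smooth_seq_affine\<close>
  produce them. Growing \<open>n\<close> steepens both edges: \<open>exp (- 1 / (n t))\<close> tends
  to 1 for \<open>t > 0\<close>, so the products tend to the indicator of the open interval.\<close>

definition bump1 :: "nat \<Rightarrow> real \<Rightarrow> real \<Rightarrow> nat \<Rightarrow> real \<Rightarrow> real" where
  "bump1 n a b k s = (\<Sum>i\<le>k. of_nat (k choose i) * (real n ^ i * cutoff i (real n * s + - (real n * a))) *
     ((- real n) ^ (k - i) * cutoff (k - i) (- real n * s + real n * b)))"

lemma smooth_seq_bump1: "smooth_seq (bump1 n a b)"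
  unfolding bump1_def
  by (rule smooth_seq_mult[OF smooth_seq_affine[OF smooth_seq_cutoff] smooth_seq_affine[OF smooth_seq_cutoff]])

lemma bump1_eq_0:
  assumes "s \<le> a \<or> b \<le> s" shows "bump1 n a b k s = 0"
proof -
  have "cutoff i (real n * s + - (real n * a)) = 0 \<or> cutoff j (- real n * s + real n * b) = 0" for i j
  proof -
    have "real n * s + - (real n * a) \<le> 0 \<or> - real n * s + real n * b \<le> 0"
      using assms mult_left_mono[of s a "real n"] mult_left_mono[of b s "real n"] by auto
    then show ?thesis by (auto simp only: cutoff_def split: if_splits)
  qed
  then show ?thesis unfolding bump1_def by (intro sum.neutral ballI) (metis mult_eq_0_iff)
qed

lemma bump1_shift: "bump1 n (a + c) (b + c) k s = bump1 n a b k (s - c)"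
  by (simp add: bump1_def algebra_simps)

lemma bump1_0: "bump1 n a b 0 s = cutoff 0 (real n * (s - a)) * cutoff 0 (real n * (b - s))"
  by (simp add: bump1_def algebra_simps)

lemma cutoff_tendsto: "(\<lambda>n. cutoff 0 (real n * t)) \<longlonglongrightarrow> (if t > 0 then 1 else 0)"
proof (cases "t > 0")
  case True
  have "(\<lambda>n. exp (- ((1/t) * inverse (real n)))) \<longlonglongrightarrow> exp (- ((1/t) * 0))"
    by (intro tendsto_intros lim_inverse_n)
  then have "(\<lambda>n. exp (- ((1/t) * inverse (real n)))) \<longlonglongrightarrow> 1" by simp
  then have "(\<lambda>n. cutoff 0 (real n * t)) \<longlonglongrightarrow> 1"
    by (rule Lim_transform_eventually)
       (auto intro!: eventually_sequentiallyI[of 1] simp: cutoff_def field_simps True)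
  then show ?thesis using True by simp
next
  case False
  then show ?thesis by (simp add: cutoff_def zero_less_mult_iff)
qed

definition bump :: "nat \<Rightarrow> real^'n \<Rightarrow> real^'n \<Rightarrow> real^'n \<Rightarrow> real" where
  "bump n a b x = (\<Prod>i\<in>UNIV. bump1 n (a $ i) (b $ i) 0 (x $ i))"

definition dbump :: "nat \<Rightarrow> real^'n \<Rightarrow> real^'n \<Rightarrow> 'n \<Rightarrow> real^'n \<Rightarrow> real" where
  "dbump n a b j x = (\<Prod>i\<in>UNIV. bump1 n (a $ i) (b $ i) (if i = j then Suc 0 else 0) (x $ i))"

text \<open>The multi-index \<open>m\<close> is arbitrary because a partial derivative in direction
  \<open>j\<close> only raises \<open>m j\<close>. Such products are therefore closed under
  \<open>partial_deriv\<close>, which is what an induction over the list \<open>js\<close> in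
  \<open>smooth\<close> needs.\<close>

lemma smooth_prod_derivative:
  fixes F :: "'n::finite \<Rightarrow> nat \<Rightarrow> real \<Rightarrow> real" and m :: "'n \<Rightarrow> nat"
  assumes "\<And>i. smooth_seq (F i)"
  shows "((\<lambda>x::real^'n. \<Prod>i\<in>UNIV. F i (m i) (x $ i)) has_derivative
     (\<lambda>h. \<Sum>j\<in>UNIV. h $ j * (\<Prod>i\<in>UNIV. F i (if i = j then Suc (m i) else m i) (x $ i)))) (at x)"
proof -
  have 1: "((\<lambda>x::real^'n. F i (m i) (x $ i)) has_derivative (\<lambda>h. F i (Suc (m i)) (x $ i) * h $ i)) (at x)" for i
  proof -
    have "(F i (m i) has_derivative (\<lambda>h. F i (Suc (m i)) (x $ i) * h)) (at (x $ i))"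
      using assms by (simp add: smooth_seq_def has_field_derivative_def)
    moreover have "((\<lambda>x::real^'n. x $ i) has_derivative (\<lambda>h. h $ i)) (at x)"
      by (rule bounded_linear_imp_has_derivative) (rule bounded_linear_vec_nth)
    ultimately show ?thesis
      using has_derivative_compose by blast
  qed
  have "((\<lambda>x::real^'n. \<Prod>i\<in>UNIV. F i (m i) (x $ i)) has_derivative
     (\<lambda>h. \<Sum>j\<in>UNIV. (F j (Suc (m j)) (x $ j) * h $ j) * (\<Prod>i\<in>UNIV - {j}. F i (m i) (x $ i)))) (at x)"
    by (rule has_derivative_prod) (rule 1)
  moreover have "(\<Prod>i\<in>UNIV. F i (if i = j then Suc (m i) else m i) (x $ i))
      = F j (Suc (m j)) (x $ j) * (\<Prod>i\<in>UNIV - {j}. F i (m i) (x $ i))" for j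
    by (subst prod.remove[of _ j]) (auto intro!: prod.cong)
  ultimately show ?thesis by (simp add: mult_ac)
qed

lemma partial_deriv_smooth_prod:
  fixes F :: "'n::finite \<Rightarrow> nat \<Rightarrow> real \<Rightarrow> real" and m :: "'n \<Rightarrow> nat"
  assumes "\<And>i. smooth_seq (F i)"
  shows "partial_deriv j (\<lambda>x::real^'n. \<Prod>i\<in>UNIV. F i (m i) (x $ i)) =
     (\<lambda>x. \<Prod>i\<in>UNIV. F i (if i = j then Suc (m i) else m i) (x $ i))"
proof
  fix x :: "real^'n"
  have "(\<Sum>k\<in>UNIV. axis j 1 $ k * (\<Prod>i\<in>UNIV. F i (if i = k then Suc (m i) else m i) (x $ i)))
     = (\<Sum>k\<in>UNIV. if k = j then (\<Prod>i\<in>UNIV. F i (if i = k then Suc (m i) else m i) (x $ i)) else 0)"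
    by (rule sum.cong) (auto simp: axis_def)
  then show "partial_deriv j (\<lambda>x::real^'n. \<Prod>i\<in>UNIV. F i (m i) (x $ i)) x =
     (\<Prod>i\<in>UNIV. F i (if i = j then Suc (m i) else m i) (x $ i))"
    unfolding partial_deriv_def
    using frechet_derivative_at[OF smooth_prod_derivative[of F m x, OF assms], symmetric]
    by simp
qed

lemma smooth_smooth_prod:
  fixes F :: "'n::finite \<Rightarrow> nat \<Rightarrow> real \<Rightarrow> real"
  assumes F: "\<And>i. smooth_seq (F i)"
  shows "smooth (\<lambda>x::real^'n. \<Prod>i\<in>UNIV. F i 0 (x $ i))"
proof -
  have "\<exists>m. foldr partial_deriv js (\<lambda>x::real^'n. \<Prod>i\<in>UNIV. F i 0 (x $ i)) = (\<lambda>x. \<Prod>i\<in>UNIV. F i (m i) (x $ i))" for js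
  proof (induction js)
    case Nil show ?case by (rule exI[of _ "\<lambda>_. 0"]) simp
  next
    case (Cons j js)
    then obtain m where m: "foldr partial_deriv js (\<lambda>x::real^'n. \<Prod>i\<in>UNIV. F i 0 (x $ i)) = (\<lambda>x. \<Prod>i\<in>UNIV. F i (m i) (x $ i))"
      by blast
    show ?case
      by (rule exI[of _ "\<lambda>i. if i = j then Suc (m i) else m i"]) (simp add: m partial_deriv_smooth_prod[OF F])
  qed
  note * = this
  show ?thesis unfolding smooth_def
  proof (intro allI)
    fix js x
    obtain m where "foldr partial_deriv js (\<lambda>x::real^'n. \<Prod>i\<in>UNIV. F i 0 (x $ i)) = (\<lambda>x. \<Prod>i\<in>UNIV. F i (m i) (x $ i))"
      using * by blast
    then show "foldr partial_deriv js (\<lambda>x::real^'n. \<Prod>i\<in>UNIV. F i 0 (x $ i)) differentiable at x"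
      using smooth_prod_derivative[of F m x, OF F] unfolding differentiable_def by auto
  qed
qed

lemma partial_deriv_bump: "partial_deriv j (bump n a b) = dbump n a b j"
proof -
  have "bump n a b = (\<lambda>x. \<Prod>i\<in>UNIV. bump1 n (a $ i) (b $ i) ((\<lambda>_. 0) i) (x $ i))"
    by (auto simp: bump_def)
  then show ?thesis
    using partial_deriv_smooth_prod[of "\<lambda>i. bump1 n (a $ i) (b $ i)" j "\<lambda>_. 0"] smooth_seq_bump1
    by (simp add: dbump_def[abs_def] bump_def[abs_def])
qed

lemma has_derivative_bump:
  "(bump n a b has_derivative (\<lambda>h. \<Sum>j\<in>UNIV. h $ j * dbump n a b j x)) (at x)"
proof -
  have "bump n a b = (\<lambda>x. \<Prod>i\<in>UNIV. bump1 n (a $ i) (b $ i) ((\<lambda>_. 0) i) (x $ i))"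
    by (auto simp: bump_def)
  then show ?thesis
    using smooth_prod_derivative[of "\<lambda>i. bump1 n (a $ i) (b $ i)" "\<lambda>_. 0" x] smooth_seq_bump1
    by (simp add: dbump_def)
qed

lemma bump_shift: "bump n (a + z) (b + z) x = bump n a b (x - z)"
  by (simp add: bump_def bump1_shift)

lemma dbump_shift: "dbump n (a + z) (b + z) j x = dbump n a b j (x - z)"
  by (simp add: dbump_def bump1_shift)

lemma notin_box_cart: "x \<notin> box a b \<longleftrightarrow> (\<exists>i. x $ i \<le> a $ i \<or> b $ i \<le> x $ i)" for x :: "real^'n"
  by (auto simp: mem_box_cart not_less)

lemma bump_eq_0: "x \<notin> box a b \<Longrightarrow> bump n a b x = 0"
  unfolding notin_box_cart bump_def
  by (elim exE, rule prod_zero, simp, rule bexI[rotated], rule UNIV_I, rule bump1_eq_0)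

lemma dbump_eq_0: "x \<notin> box a b \<Longrightarrow> dbump n a b j x = 0"
  unfolding notin_box_cart dbump_def
  by (elim exE, rule prod_zero, simp, rule bexI[rotated], rule UNIV_I, rule bump1_eq_0)

lemma continuous_on_bump: "continuous_on S (bump n a b)"
  unfolding bump_def
  by (intro continuous_intros continuous_on_compose2[OF smooth_seq_continuous[OF smooth_seq_bump1]]) auto

lemma continuous_on_dbump: "continuous_on S (dbump n a b j)"
  unfolding dbump_def
  by (intro continuous_intros continuous_on_compose2[OF smooth_seq_continuous[OF smooth_seq_bump1]]) auto

lemma bump_bounds: "0 \<le> bump n a b x" "bump n a b x \<le> 1"
  unfolding bump_def bump1_0
  by (intro prod_nonneg mult_nonneg_nonneg cutoff_0_props)
     (intro prod_le_1 conjI mult_le_one mult_nonneg_nonneg cutoff_0_props)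

lemma bump_tendsto: "(\<lambda>n. bump n a b x) \<longlonglongrightarrow> indicator (box a b) x"
proof -
  have "(\<lambda>n. bump n a b x) \<longlonglongrightarrow> (\<Prod>i\<in>UNIV. (if x $ i - a $ i > 0 then 1 else 0) * (if b $ i - x $ i > 0 then 1 else 0))"
    unfolding bump_def bump1_0 by (intro tendsto_intros cutoff_tendsto)
  also have "(\<Prod>i\<in>UNIV. (if x $ i - a $ i > 0 then 1 else 0) * (if b $ i - x $ i > 0 then 1 else 0::real)) = indicator (box a b) x"
  proof (cases "x \<in> box a b")
    case True then show ?thesis by (auto simp: mem_box_cart)
  next
    case False
    then obtain i where "x $ i \<le> a $ i \<or> b $ i \<le> x $ i" unfolding notin_box_cart by blast
    then have "(\<Prod>i\<in>UNIV. (if x $ i - a $ i > 0 then 1 else 0) * (if b $ i - x $ i > 0 then 1 else 0::real)) = 0"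
      by (intro prod_zero) (auto intro!: exI[of _ i])
    then show ?thesis using False by simp
  qed
  finally show ?thesis .
qed

lemma test_function_bump:
  assumes "cbox a b \<subseteq> G" shows "test_function G (bump n a b)"
proof -
  have "closure {x. bump n a b x \<noteq> 0} \<subseteq> cbox a b"
    by (rule closure_minimal) (use bump_eq_0 box_subset_cbox in \<open>blast+\<close>)
  moreover have "compact (closure {x. bump n a b x \<noteq> 0})"
    by (rule compact_closure[THEN iffD2], rule bounded_subset[OF bounded_cbox[of a b]])
      (use bump_eq_0 box_subset_cbox in blast)
  moreover have "smooth (bump n a b)"
    using smooth_smooth_prod[of "\<lambda>i. bump1 n (a $ i) (b $ i)"] smooth_seq_bump1
    by (simp add: bump_def[abs_def])
  ultimately show ?thesis using assms by (auto simp: test_function_def)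
qed

lemma dbump_bounded: "\<exists>C. \<forall>x. \<bar>dbump n a b j x\<bar> \<le> C"
proof -
  have "bounded (dbump n a b j ` cbox a b)"
    by (intro compact_imp_bounded compact_continuous_image continuous_on_dbump compact_cbox)
  then obtain C where C: "\<And>x. x \<in> cbox a b \<Longrightarrow> \<bar>dbump n a b j x\<bar> \<le> C" "C > 0"
    by (force simp: bounded_pos)
  have "\<bar>dbump n a b j x\<bar> \<le> C" for x
    using C dbump_eq_0[of x a b] box_subset_cbox[of a b] by (cases "x \<in> box a b") auto
  then show ?thesis by blast
qed

section \<open>Integration along segments\<close>

lemma nn_integral_lborel_shift:
  fixes f :: "'a::euclidean_space \<Rightarrow> ennreal"
  assumes [measurable]: "f \<in> borel_measurable borel"
  shows "(\<integral>\<^sup>+x. f (x + c) \<partial>lborel) = (\<integral>\<^sup>+x. f x \<partial>lborel)"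
proof -
  have "(\<integral>\<^sup>+x. f x \<partial>lborel) = (\<integral>\<^sup>+x. f x \<partial>distr lborel borel ((+) c))"
    by (simp add: lborel_distr_plus)
  also have "\<dots> = (\<integral>\<^sup>+x. f (c + x) \<partial>lborel)"
    by (subst nn_integral_distr) auto
  finally show ?thesis by (simp add: add.commute)
qed

lemma integrable_lborel_shift:
  fixes f :: "'a::euclidean_space \<Rightarrow> 'b::{banach, second_countable_topology}"
  assumes "integrable lborel f"
  shows "integrable lborel (\<lambda>x. f (x + c))"
proof -
  have "integrable (distr lborel borel ((+) c)) f"
    using assms by (simp add: lborel_distr_plus)
  then have "integrable lborel (\<lambda>x. f (c + x))"
    using assms by (subst (asm) integrable_distr_eq) auto
  then show ?thesis by (simp add: add.commute)
qed

lemma integral_lborel_shift: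
  fixes f :: "'a::euclidean_space \<Rightarrow> 'b::{banach, second_countable_topology}"
  assumes [measurable]: "f \<in> borel_measurable borel"
  shows "(\<integral>x. f (x + c) \<partial>lborel) = (\<integral>x. f x \<partial>lborel)"
proof -
  have "(\<integral>x. f x \<partial>lborel) = (\<integral>x. f x \<partial>distr lborel borel ((+) c))"
    by (simp add: lborel_distr_plus)
  also have "\<dots> = (\<integral>x. f (c + x) \<partial>lborel)"
    by (subst integral_distr) auto
  finally show ?thesis by (simp add: add.commute)
qed

lemma AE_lborel_shift:
  fixes P :: "'a::euclidean_space \<Rightarrow> bool"
  assumes "AE x in lborel. P x"
  shows "AE x in lborel. P (x + c)"
proof -
  have "AE x in distr lborel borel ((+) c). P x"
    using assms unfolding lborel_distr_plus .
  then have "AE x in lborel. P (c + x)"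
    by (rule AE_distrD[rotated]) simp
  then show ?thesis by (simp add: add.commute)
qed

text \<open>The sets over which \<open>k\<close> integrates to 0 contain the boxes, an
  intersection-stable generator of the Borel sets; they are closed under complements, by
  \<open>k0\<close>, and under disjoint countable unions.\<close>

lemma AE_zero_of_box_integrals:
  fixes k :: "'a::euclidean_space \<Rightarrow> real"
  assumes k: "integrable lborel k" and box: "\<And>a b. (LINT x:box a b|lborel. k x) = 0"
    and k0: "(\<integral>x. k x \<partial>lborel) = 0"
  shows "AE x in lborel. k x = 0"
proof -
  have "(LINT x:A|lborel. k x) = (LINT x:A|lborel. 0)" if "A \<in> sets lborel" for A
  proof -
    have Int: "set_integrable lborel B k" if "B \<in> sets borel" for B
      using integrable_mult_indicator[OF _ k, of B] that by (simp add: set_integrable_def)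
    let ?G = "range (\<lambda>(a, b). box a b :: 'a set)"
    have ss: "sigma_sets UNIV ?G = sets borel"
      by (subst borel_eq_box) (simp add: sets_measure_of)
    have "Int_stable ?G" unfolding Int_stable_def
      by (auto simp: box_Int_box)
    moreover have "?G \<subseteq> Pow UNIV" by simp
    moreover have "A \<in> sigma_sets UNIV ?G" using that by (simp add: ss)
    ultimately have "(LINT x:A|lborel. k x) = 0"
    proof (induction rule: sigma_sets_induct_disjoint)
      case empty show ?case by (simp add: set_lebesgue_integral_def)
    next
      case (basic A) then show ?case using box by auto
    next
      case (compl A)
      have A: "A \<in> sets borel" using compl by (simp add: ss)
      have "(LINT x:UNIV|lborel. k x) = (LINT x:A|lborel. k x) + (LINT x:UNIV - A|lborel. k x)"
        using set_integral_Un[of A "UNIV - A" lborel k] Int[OF A] Int[of "UNIV - A"] A by simp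
      then show ?case using compl k0 by (simp add: set_lebesgue_integral_def)
    next
      case (union A)
      have A: "A i \<in> sets borel" for i using union(2) ss by auto
      have "(LINT x:(\<Union>i. A i)|lborel. k x) = (\<Sum>i. (LINT x:(A i)|lborel. k x))"
        using union A by (intro lebesgue_integral_countable_add Int) (auto simp: disjoint_family_on_def)
      then show ?case using union by simp
    qed
    then show ?thesis by (simp add: set_lebesgue_integral_def)
  qed
  then show ?thesis
    by (intro density_unique_real[of lborel k "\<lambda>_. 0"]) (use k in auto)
qed

lemma box_Int_box_cart:
  fixes a b c d :: "real^'n"
  shows "box a b \<inter> box c d = box (\<chi> i. max (a$i) (c$i)) (\<chi> i. min (b$i) (d$i))"
  by (auto simp: mem_box_cart)

lemma cbox_Int_cbox_cart:
  fixes a b c d :: "real^'n"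
  shows "cbox a b \<inter> cbox c d = cbox (\<chi> i. max (a$i) (c$i)) (\<chi> i. min (b$i) (d$i))"
  by (auto simp: mem_box_cart)

text \<open>Dominated convergence in \<open>n\<close> turns bumps into indicators of boxes. For a
  fixed closed box inside \<open>V\<close>, the function cut off to the open box integrates to 0
  over every further box, because the intersection of two boxes is again a box with closure in
  \<open>V\<close>. Countably many such boxes exhaust \<open>V\<close>.\<close>

lemma AE_zero_of_bump_integrals:
  fixes k :: "real^'n \<Rightarrow> real"
  assumes V: "open V"
    and int: "\<And>a b. cbox a b \<subseteq> V \<Longrightarrow> set_integrable lborel (cbox a b) k"
    and zero: "\<And>n a b. cbox a b \<subseteq> V \<Longrightarrow> (\<integral>x. k x * bump n a b x \<partial>lborel) = 0"
  shows "AE x in lborel. x \<in> V \<longrightarrow> k x = 0"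
proof -
  have Z: "(LINT x:box a b|lborel. k x) = 0" if "cbox a b \<subseteq> V" for a b
  proof -
    let ?k = "\<lambda>x. indicator (cbox a b) x * k x"
    have intk: "integrable lborel ?k" using int[OF that] by (simp add: set_integrable_def)
    have eq: "k x * bump n a b x = ?k x * bump n a b x" for n x
      using bump_eq_0[of x a b] box_subset_cbox[of a b] by (cases "x \<in> box a b") auto
    have [measurable]: "bump n a b \<in> borel_measurable borel" for n
      by (intro borel_measurable_continuous_onI continuous_on_bump)
    have [measurable]: "?k \<in> borel_measurable lborel" using intk by auto
    have "(\<lambda>n. \<integral>x. ?k x * bump n a b x \<partial>lborel) \<longlonglongrightarrow> (\<integral>x. ?k x * indicator (box a b) x \<partial>lborel)"
    proof (rule integral_dominated_convergence[where w="\<lambda>x. \<bar>?k x\<bar>"])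
      show "AE x in lborel. (\<lambda>n. ?k x * bump n a b x) \<longlonglongrightarrow> ?k x * indicator (box a b) x"
        by (intro AE_I2 tendsto_intros bump_tendsto)
      show "AE x in lborel. norm (?k x * bump n a b x) \<le> \<bar>?k x\<bar>" for n
        using bump_bounds[of n a b] by (intro AE_I2) (auto simp: abs_mult intro!: mult_left_le)
    qed (use intk in auto)
    moreover have "(\<integral>x. ?k x * bump n a b x \<partial>lborel) = 0" for n
      using zero[OF that, of n] by (simp add: eq)
    ultimately have "(\<integral>x. ?k x * indicator (box a b) x \<partial>lborel) = 0"
      using LIMSEQ_unique tendsto_const by (metis (lifting) ext)
    moreover have "?k x * indicator (box a b) x = indicator (box a b) x *\<^sub>R k x" for x
      using box_subset_cbox[of a b] by (auto simp: indicator_def)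
    ultimately show ?thesis by (simp add: set_lebesgue_integral_def)
  qed
  have AEbox: "AE x in lborel. x \<in> box a b \<longrightarrow> k x = 0" if ab: "cbox a b \<subseteq> V" for a b
  proof -
    let ?k = "\<lambda>x. indicator (box a b) x *\<^sub>R k x"
    have i: "integrable lborel ?k"
      using set_integrable_subset[OF int[OF ab], of "box a b"] box_subset_cbox[of a b]
      by (simp add: set_integrable_def)
    have "AE x in lborel. ?k x = 0"
    proof (rule AE_zero_of_box_integrals[OF i])
      fix c d
      have "cbox (\<chi> i. max (a$i) (c$i)) (\<chi> i. min (b$i) (d$i)) \<subseteq> V"
        unfolding cbox_Int_cbox_cart[symmetric] using ab by auto
      from Z[OF this] have "(LINT x:box a b \<inter> box c d|lborel. k x) = 0"
        by (simp add: box_Int_box_cart)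
      then show "(LINT x:box c d|lborel. ?k x) = 0"
        by (simp add: set_lebesgue_integral_def indicator_inter_arith mult_ac)
    next
      show "integral\<^sup>L lborel ?k = 0" using Z[OF ab] by (simp add: set_lebesgue_integral_def)
    qed
    then show ?thesis by eventually_elim (auto simp: indicator_def)
  qed
  obtain \<D> where D: "countable \<D>" "\<And>X. X \<in> \<D> \<Longrightarrow> X \<subseteq> V \<and> (\<exists>a b. X = box a b \<and> box a b \<noteq> {} \<and> cbox a b \<subseteq> V)" "\<Union>\<D> = V"
  proof -
    have "\<forall>x\<in>V. \<exists>X. x \<in> X \<and> open X \<and> (X \<subseteq> V \<and> (\<exists>a b. X = box a b \<and> box a b \<noteq> {} \<and> cbox a b \<subseteq> V))"
      using open_contains_cbox V by (metis (no_types, opaque_lifting) box_subset_cbox empty_iff open_box subset_trans)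
    then obtain F where F: "\<And>x. x \<in> V \<Longrightarrow> x \<in> F x \<and> open (F x) \<and> (F x \<subseteq> V \<and> (\<exists>a b. F x = box a b \<and> box a b \<noteq> {} \<and> cbox a b \<subseteq> V))"
      by metis
    obtain \<F> where "\<F> \<subseteq> F ` V" "countable \<F>" "\<Union>\<F> = \<Union>(F ` V)"
      using Lindelof[of "F ` V"] F by (metis imageE)
    moreover have "\<Union>(F ` V) = V" using F by blast
    ultimately show thesis using F by (intro that[of \<F>]) (auto, blast+)
  qed
  have "AE x in lborel. \<forall>X\<in>\<D>. x \<in> X \<longrightarrow> k x = 0"
    using D AEbox by (subst AE_ball_countable) (blast, metis)
  then show ?thesis by eventually_elim (use D(3) in auto)
qed

text \<open>
  Testing against product bumps suffices: they converge to indicators of boxes as \<open>n\<close> tends to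
  infinity, and they are stable under translation.
\<close>

definition weak_gradient :: "(real^'n) set \<Rightarrow> (real^'n \<Rightarrow> real) \<Rightarrow> (real^'n \<Rightarrow> real^'n) \<Rightarrow> bool" where
  "weak_gradient G u g \<longleftrightarrow>
     u \<in> borel_measurable borel \<and> g \<in> borel_measurable borel \<and>
     (\<forall>K. compact K \<and> K \<subseteq> G \<longrightarrow> set_integrable lborel K u \<and> set_integrable lborel K g) \<and>
     (\<forall>n a b j. cbox a b \<subseteq> G \<longrightarrow>
        (\<integral>x. u x * dbump n a b j x \<partial>lborel) = - (\<integral>x. g x $ j * bump n a b x \<partial>lborel))"

lemma integrable_pair_shift_bound:
  fixes F :: "'a::euclidean_space \<times> real \<Rightarrow> real" and f :: "'a \<Rightarrow> real"
  assumes [measurable]: "F \<in> borel_measurable borel"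
    and f: "integrable lborel f"
    and le: "\<And>x t. \<bar>F (x, t)\<bar> \<le> indicator {0..1} t * f (x + t *\<^sub>R \<zeta>)"
  shows "integrable (lborel \<Otimes>\<^sub>M lborel) F"
proof (rule integrableI_bounded)
  have [measurable]: "f \<in> borel_measurable borel" using f by auto
  show "F \<in> borel_measurable (lborel \<Otimes>\<^sub>M lborel)" by (simp add: lborel_prod)
  then have [measurable]: "F \<in> borel_measurable (borel \<Otimes>\<^sub>M borel)" by (simp add: borel_prod)
  have "(\<integral>\<^sup>+ p. norm (F p) \<partial>(lborel \<Otimes>\<^sub>M lborel)) = (\<integral>\<^sup>+t. \<integral>\<^sup>+x. norm (F (x, t)) \<partial>lborel \<partial>lborel)"
    by (subst lborel_pair.nn_integral_snd[symmetric]) (auto simp: lborel_prod)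
  also have "\<dots> \<le> (\<integral>\<^sup>+t. \<integral>\<^sup>+x. indicator {0..1} t * ennreal \<bar>f (x + t *\<^sub>R \<zeta>)\<bar> \<partial>lborel \<partial>lborel)"
  proof (intro nn_integral_mono)
    fix t x
    have "norm (F (x,t)) \<le> indicator {0..1} t * \<bar>f (x + t *\<^sub>R \<zeta>)\<bar>"
      using le[of x t] by (smt (verit, best) indicator_pos_le mult_left_mono real_norm_def)
    then have "ennreal (norm (F (x,t))) \<le> ennreal (indicator {0..1} t * \<bar>f (x + t *\<^sub>R \<zeta>)\<bar>)"
      by (rule ennreal_leI)
    then show "ennreal (norm (F (x, t))) \<le> indicator {0..1} t * ennreal \<bar>f (x + t *\<^sub>R \<zeta>)\<bar>"
      by (simp add: ennreal_mult ennreal_indicator)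
  qed
  also have "\<dots> = (\<integral>\<^sup>+t. indicator {0..1} t * (\<integral>\<^sup>+x. ennreal \<bar>f (x + t *\<^sub>R \<zeta>)\<bar> \<partial>lborel) \<partial>lborel)"
    by (intro nn_integral_cong nn_integral_cmult) measurable
  also have "\<dots> = (\<integral>\<^sup>+t. indicator {0..1::real} t * (\<integral>\<^sup>+x. ennreal \<bar>f x\<bar> \<partial>lborel) \<partial>lborel)"
    by (subst nn_integral_lborel_shift[of "\<lambda>x. ennreal \<bar>f x\<bar>"]) auto
  also have "\<dots> = (\<integral>\<^sup>+x. ennreal \<bar>f x\<bar> \<partial>lborel)"
    by (simp add: nn_integral_multc)
  also have "\<dots> < \<infinity>" using f by (simp add: integrable_iff_bounded)
  finally show "(\<integral>\<^sup>+ p. norm (F p) \<partial>(lborel \<Otimes>\<^sub>M lborel)) < \<infinity>" .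
qed

text \<open>The complement consists of the differences of a closed set and a compact
  segment.\<close>

lemma open_segment_shift_set:
  fixes G :: "'a::euclidean_space set"
  assumes "open G" shows "open {x. \<forall>t\<in>{0..1}. x + t *\<^sub>R \<xi> \<in> G}"
proof -
  have "- {x. \<forall>t\<in>{0..1}. x + t *\<^sub>R \<xi> \<in> G} = (\<Union>x\<in>-G. \<Union>y\<in>(\<lambda>t. t *\<^sub>R \<xi>) ` {0..1}. {x - y})" (is "?L = ?R")
  proof (intro equalityI subsetI)
    fix x assume "x \<in> ?L"
    then obtain t where "t \<in> {0..1}" "x + t *\<^sub>R \<xi> \<in> - G" by auto
    then show "x \<in> ?R" by (auto intro!: bexI[of _ "x + t *\<^sub>R \<xi>"] bexI[of _ t])
  next
    fix x assume "x \<in> ?R"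
    then obtain y t where "y \<notin> G" "t \<in> {0..1}" "x = y - t *\<^sub>R \<xi>" by auto
    then show "x \<in> ?L" by (auto intro!: bexI[of _ t])
  qed
  moreover have "closed ?R"
    by (rule closed_compact_differences) (use assms in \<open>auto intro!: compact_continuous_image continuous_intros\<close>)
  ultimately show ?thesis by (simp add: open_closed)
qed

lemma measurable_vec_nth[measurable (raw)]:
  fixes f :: "'a \<Rightarrow> real^'n"
  shows "f \<in> borel_measurable M \<Longrightarrow> (\<lambda>x. f x $ i) \<in> borel_measurable M"
  by (erule measurable_compose) (intro borel_measurable_continuous_onI continuous_intros)

text \<open>Both sides are tested against a bump \<open>q\<close>. Moving the translation from
  \<open>u\<close> to \<open>q\<close> leaves \<open>q (x - \<xi>) - q x\<close>, which is the
  integral of the derivative of \<open>q\<close> along the segment. For each \<open>t\<close> the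
  weak derivative is then moved from the translated bump to \<open>u\<close>, and the translation is
  undone.\<close>

lemma weak_gradient_line_integral:
  fixes u :: "real^'n \<Rightarrow> real" and g :: "real^'n \<Rightarrow> real^'n"
  assumes wg: "weak_gradient G u g" and G: "open G"
  shows "AE x in lborel. (\<forall>t\<in>{0..1}. x + t *\<^sub>R \<xi> \<in> G) \<longrightarrow>
           u (x + \<xi>) - u x = (\<integral>t. indicator {0..1} t * (g (x + t *\<^sub>R \<xi>) \<bullet> \<xi>) \<partial>lborel)"
proof -
  define V where "V = {x. \<forall>t\<in>{0..1}. x + t *\<^sub>R \<xi> \<in> G}"
  define W where "W = (\<lambda>x. \<integral>t. indicator {0..1} t * (g (x + t *\<^sub>R \<xi>) \<bullet> \<xi>) \<partial>lborel)"
  have [measurable]: "u \<in> borel_measurable borel" "g \<in> borel_measurable borel"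
    using wg by (auto simp: weak_gradient_def)
  have [measurable]: "W \<in> borel_measurable borel"
    unfolding W_def by measurable
  have [measurable]: "bump n a b \<in> borel_measurable borel" for n and a b :: "real^'n"
    by (intro borel_measurable_continuous_onI continuous_on_bump)
  have [measurable]: "dbump n a b j \<in> borel_measurable borel" for n and a b :: "real^'n" and j
    by (intro borel_measurable_continuous_onI continuous_on_dbump)
  \<comment> \<open>For a box inside \<open>V\<close> its translates along the segment fill a
    compact subset of \<open>G\<close>, on which \<open>u\<close> and \<open>g\<close> are
    integrable; every integrand below is dominated over this set.\<close>
  define K where "K = (\<lambda>a b. (\<lambda>(x, t). x + t *\<^sub>R \<xi>) ` (cbox a b \<times> {0..1::real}))"
  have cK: "compact (K a b)" for a b unfolding K_def
    by (intro compact_continuous_image compact_Times compact_cbox compact_Icc)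
       (auto intro!: continuous_intros simp: split_def)
  then have [measurable]: "K a b \<in> sets borel" for a b
    by (simp add: borel_closed compact_imp_closed)
  have KI: "x + t *\<^sub>R \<xi> \<in> K a b" if "x \<in> cbox a b" "0 \<le> t" "t \<le> 1" for x t a b
    using that by (force simp: K_def)
  have KI': "x \<in> K a b" if "x - t *\<^sub>R \<xi> \<in> cbox a b" "0 \<le> t" "t \<le> 1" for x t a b
    using KI[OF that] by simp
  have K1: "x + \<xi> \<in> K a b" "x \<in> K a b" if "x \<in> cbox a b" for x a b
    using KI[OF that, of 1] KI[OF that, of 0] by auto
  have KG: "K a b \<subseteq> G" if "cbox a b \<subseteq> V" for a b
    using that by (auto simp: K_def V_def)
  have intKu: "integrable lborel (\<lambda>x. indicator (K a b) x * u x)"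
    and intKg: "integrable lborel (\<lambda>x. indicator (K a b) x *\<^sub>R g x)" if "cbox a b \<subseteq> V" for a b
    using wg cK KG[OF that] by (auto simp: weak_gradient_def set_integrable_def)
  have intT: "integrable (lborel \<Otimes>\<^sub>M lborel) (\<lambda>(x, t). indicator {0..1} t * (g (x + t *\<^sub>R \<xi>) \<bullet> \<xi>) * q x)"
    if ab: "cbox a b \<subseteq> V" and [measurable]: "q \<in> borel_measurable borel"
      and q: "\<And>x. \<bar>q x\<bar> \<le> indicator (cbox a b) x" for a b q
  proof (rule integrable_pair_shift_bound[where f="\<lambda>x. norm (indicator (K a b) x *\<^sub>R g x) * norm \<xi>" and \<zeta>=\<xi>])
    show "(\<lambda>(x, t). indicator {0..1} t * (g (x + t *\<^sub>R \<xi>) \<bullet> \<xi>) * q x) \<in> borel_measurable borel"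
      unfolding borel_prod[symmetric] by measurable
    show "integrable lborel (\<lambda>x. norm (indicator (K a b) x *\<^sub>R g x) * norm \<xi>)"
      by (rule integrable_mult_left) (rule integrable_norm[OF intKg[OF ab]])
    fix x t
    show "\<bar>case (x, t) of (x, t) \<Rightarrow> indicator {0..1} t * (g (x + t *\<^sub>R \<xi>) \<bullet> \<xi>) * q x\<bar>
      \<le> indicator {0..1} t * (norm (indicator (K a b) (x + t *\<^sub>R \<xi>) *\<^sub>R g (x + t *\<^sub>R \<xi>)) * norm \<xi>)"
    proof (cases "x \<in> cbox a b \<and> t \<in> {0..1}")
      case True
      have "\<bar>g (x + t *\<^sub>R \<xi>) \<bullet> \<xi>\<bar> * \<bar>q x\<bar> \<le> norm (g (x + t *\<^sub>R \<xi>)) * norm \<xi> * 1"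
        using q[of x] True by (intro mult_mono Cauchy_Schwarz_ineq2) auto
      then show ?thesis using True KI[of x a b t] by (auto simp: abs_mult)
    next
      case False
      then show ?thesis using q[of x] by (cases "x \<in> cbox a b") auto
    qed
  qed
  have bq: "\<bar>bump n a b x\<bar> \<le> indicator (cbox a b) x" for n and a b x :: "real^'n"
    using bump_bounds[of n a b x] bump_eq_0[of x a b n] box_subset_cbox[of a b]
    by (cases "x \<in> box a b") (auto simp: indicator_def)
  have UB: "integrable lborel (\<lambda>x. u x * r x)"
    if ab: "cbox a b \<subseteq> V" and [measurable]: "r \<in> borel_measurable borel"
      and r: "\<And>x. \<bar>r x\<bar> \<le> C * indicator (K a b) x" for a b r C
  proof (rule Bochner_Integration.integrable_bound[where f="\<lambda>x. C * (indicator (K a b) x * u x)"])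
    show "integrable lborel (\<lambda>x. C * (indicator (K a b) x * u x))" using intKu[OF ab] by auto
    show "AE x in lborel. norm (u x * r x) \<le> norm (C * (indicator (K a b) x * u x))"
    proof (rule AE_I2)
      fix x
      have "\<bar>r x\<bar> \<le> \<bar>C\<bar> * indicator (K a b) x"
        using r[of x] by (auto simp: indicator_def split: if_splits)
      then show "norm (u x * r x) \<le> norm (C * (indicator (K a b) x * u x))"
        using mult_right_mono[of "\<bar>r x\<bar>" "\<bar>C\<bar> * indicator (K a b) x" "\<bar>u x\<bar>"]
        by (simp add: abs_mult mult_ac)
    qed
  qed measurable
  have "AE x in lborel. x \<in> V \<longrightarrow> u (x + \<xi>) - u x - W x = 0"
  proof (rule AE_zero_of_bump_integrals)
    show "open V" unfolding V_def by (rule open_segment_shift_set[OF G])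
  next
    fix a b assume ab: "cbox a b \<subseteq> V"
    have 1: "integrable lborel (\<lambda>x. indicator (cbox a b) x *\<^sub>R (indicator (K a b) (x + \<xi>) * u (x + \<xi>)))"
      by (intro integrable_mult_indicator integrable_lborel_shift[OF intKu[OF ab]]) simp
    have 2: "integrable lborel (\<lambda>x. indicator (cbox a b) x *\<^sub>R (indicator (K a b) x * u x))"
      by (intro integrable_mult_indicator intKu[OF ab]) simp
    have 3: "integrable lborel (\<lambda>x. \<integral>t. indicator {0..1} t * (g (x + t *\<^sub>R \<xi>) \<bullet> \<xi>) * indicator (cbox a b) x \<partial>lborel)"
      using lborel_pair.integrable_fst'[OF intT[OF ab, of "indicator (cbox a b)"]] by simp
    have "integrable lborel (\<lambda>x. indicator (cbox a b) x * u (x + \<xi>) - indicator (cbox a b) x * u x - indicator (cbox a b) x * W x)"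
    proof (intro Bochner_Integration.integrable_diff)
      show "integrable lborel (\<lambda>x. indicator (cbox a b) x * u (x + \<xi>))"
        by (rule Bochner_Integration.integrable_cong[THEN iffD1, OF refl _ 1]) (use K1 in \<open>auto simp: indicator_def\<close>)
      show "integrable lborel (\<lambda>x. indicator (cbox a b) x * u x)"
        by (rule Bochner_Integration.integrable_cong[THEN iffD1, OF refl _ 2]) (use K1 in \<open>auto simp: indicator_def\<close>)
      show "integrable lborel (\<lambda>x. indicator (cbox a b) x * W x)"
        using 3 by (simp add: W_def mult.commute)
    qed
    then show "set_integrable lborel (cbox a b) (\<lambda>x. u (x + \<xi>) - u x - W x)"
      by (simp add: set_integrable_def algebra_simps)
  next
    fix n a b assume ab: "cbox a b \<subseteq> V"
    define q where "q = bump n a b"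
    define dq where "dq = dbump n a b"
    have [measurable]: "q \<in> borel_measurable borel" "dq j \<in> borel_measurable borel" for j
      by (simp_all add: q_def dq_def)
    have q: "\<bar>q x\<bar> \<le> indicator (cbox a b) x" for x unfolding q_def by (rule bq)
    have "\<forall>j. \<exists>C. \<forall>x. \<bar>dq j x\<bar> \<le> C" unfolding dq_def using dbump_bounded by blast
    then obtain Cj where Cj: "\<And>j x. \<bar>dq j x\<bar> \<le> Cj j" by metis
    define C where "C = (\<Sum>j\<in>UNIV. \<bar>\<xi> $ j\<bar> * Cj j)"
    have dq0: "dq j x = 0" if "x \<notin> cbox a b" for x j
      using dbump_eq_0[of x a b n j] that box_subset_cbox[of a b] unfolding dq_def by blast
    have dqb: "\<bar>\<Sum>j\<in>UNIV. \<xi> $ j * dq j x\<bar> \<le> C" for x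
      unfolding C_def by (rule order_trans[OF sum_abs]) (auto intro!: sum_mono mult_left_mono Cj simp: abs_mult)
    have iq: "integrable lborel (\<lambda>x. u x * q x)"
    proof (rule UB[OF ab, where C=1])
      fix x show "\<bar>q x\<bar> \<le> 1 * indicator (K a b) x"
        using q[of x] K1(2)[of x a b] by (cases "x \<in> cbox a b"; cases "x \<in> K a b") auto
    qed measurable
    have iqs: "integrable lborel (\<lambda>x. u x * q (x - \<xi>))"
    proof (rule UB[OF ab, where C=1])
      fix x show "\<bar>q (x - \<xi>)\<bar> \<le> 1 * indicator (K a b) x"
        using q[of "x - \<xi>"] KI'[of x 1 a b] by (cases "x - \<xi> \<in> cbox a b"; cases "x \<in> K a b") auto
    qed measurable
    have iqp: "integrable lborel (\<lambda>x. u (x + \<xi>) * q x)"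
      using integrable_lborel_shift[OF iqs, of \<xi>] by simp
    have iWq: "integrable lborel (\<lambda>x. W x * q x)"
      using lborel_pair.integrable_fst'[OF intT[OF ab _ q]] by (simp add: W_def)
    have seg: "cbox (a + t *\<^sub>R \<xi>) (b + t *\<^sub>R \<xi>) \<subseteq> G" if "t \<in> {0..1}" for t
    proof
      fix x assume "x \<in> cbox (a + t *\<^sub>R \<xi>) (b + t *\<^sub>R \<xi>)"
      then have "x - t *\<^sub>R \<xi> \<in> cbox a b" by (auto simp: mem_box_cart algebra_simps)
      then have "x \<in> K a b" using KI'[of x t a b] that by auto
      then show "x \<in> G" using KG[OF ab] by auto
    qed
    have ftc: "q (x - \<xi>) - q x = (\<integral>t. indicator {0..1} t * - (\<Sum>j\<in>UNIV. \<xi> $ j * dq j (x - t *\<^sub>R \<xi>)) \<partial>lborel)" for x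
    proof -
      have "(\<integral>t. - (\<Sum>j\<in>UNIV. \<xi> $ j * dq j (x - t *\<^sub>R \<xi>)) * indicator {0..1} t \<partial>lborel)
          = q (x - 1 *\<^sub>R \<xi>) - q (x - 0 *\<^sub>R \<xi>)"
      proof (rule integral_FTC_Icc_real)
        fix t :: real
        have "((\<lambda>t. q (x - t *\<^sub>R \<xi>)) has_derivative (\<lambda>h. \<Sum>j\<in>UNIV. (- (h *\<^sub>R \<xi>)) $ j * dq j (x - t *\<^sub>R \<xi>))) (at t)"
          unfolding q_def dq_def
          by (rule has_derivative_compose[OF _ has_derivative_bump]) (auto intro!: derivative_eq_intros)
        then show "((\<lambda>t. q (x - t *\<^sub>R \<xi>)) has_real_derivative - (\<Sum>j\<in>UNIV. \<xi> $ j * dq j (x - t *\<^sub>R \<xi>))) (at t)"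
          unfolding has_field_derivative_def
          by (rule has_derivative_eq_rhs) (auto simp: fun_eq_iff sum_distrib_left sum_negf mult_ac)
      next
        fix t :: real
        have "continuous_on UNIV (\<lambda>t. - (\<Sum>j\<in>UNIV. \<xi> $ j * dq j (x - t *\<^sub>R \<xi>)))"
          unfolding dq_def
          by (intro continuous_intros continuous_on_compose2[OF continuous_on_dbump[of UNIV]]) auto
        then show "isCont (\<lambda>t. - (\<Sum>j\<in>UNIV. \<xi> $ j * dq j (x - t *\<^sub>R \<xi>))) t"
          by (simp add: continuous_on_eq_continuous_at)
      qed simp
      then show ?thesis by (simp add: mult.commute)
    qed
    have intP: "integrable (lborel \<Otimes>\<^sub>M lborel) (\<lambda>(x, t). indicator {0..1} t * (u x * - (\<Sum>j\<in>UNIV. \<xi> $ j * dq j (x - t *\<^sub>R \<xi>))))"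
    proof (rule integrable_pair_shift_bound[where f="\<lambda>x. C * \<bar>indicator (K a b) x * u x\<bar>" and \<zeta>=0])
      show "(\<lambda>(x, t). indicator {0..1} t * (u x * - (\<Sum>j\<in>UNIV. \<xi> $ j * dq j (x - t *\<^sub>R \<xi>)))) \<in> borel_measurable borel"
        unfolding borel_prod[symmetric] by measurable
      show "integrable lborel (\<lambda>x. C * \<bar>indicator (K a b) x * u x\<bar>)" using intKu[OF ab] by auto
      fix x t
      show "\<bar>case (x, t) of (x, t) \<Rightarrow> indicator {0..1} t * (u x * - (\<Sum>j\<in>UNIV. \<xi> $ j * dq j (x - t *\<^sub>R \<xi>)))\<bar>
         \<le> indicator {0..1} t * (C * \<bar>indicator (K a b) (x + t *\<^sub>R 0) * u (x + t *\<^sub>R 0)\<bar>)"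
      proof (cases "t \<in> {0..1} \<and> x - t *\<^sub>R \<xi> \<in> cbox a b")
        case True
        then have "x \<in> K a b" using KI'[of x t a b] by auto
        then show ?thesis using True mult_left_mono[OF dqb[of "x - t *\<^sub>R \<xi>"], of "\<bar>u x\<bar>"]
          by (auto simp: abs_mult mult_ac)
      next
        case False
        have "C \<ge> 0" using dqb[of 0] by linarith
        then show ?thesis using False dq0[of "x - t *\<^sub>R \<xi>"] by (cases "t \<in> {0..1}") auto
      qed
    qed
    have "(\<integral>x. u (x + \<xi>) * q x - u x * q x \<partial>lborel) = (\<integral>x. u x * q (x - \<xi>) \<partial>lborel) - (\<integral>x. u x * q x \<partial>lborel)"
      using integral_lborel_shift[of "\<lambda>x. u x * q (x - \<xi>)" \<xi>] iqp iq by simp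
    also have "\<dots> = (\<integral>x. u x * (q (x - \<xi>) - q x) \<partial>lborel)"
      using iqs iq by (simp add: right_diff_distrib)
    also have "\<dots> = (\<integral>x. (\<integral>t. indicator {0..1} t * (u x * - (\<Sum>j\<in>UNIV. \<xi> $ j * dq j (x - t *\<^sub>R \<xi>))) \<partial>lborel) \<partial>lborel)"
      unfolding ftc by (subst integral_mult_right_zero[symmetric]) (simp add: mult_ac)
    also have "\<dots> = (\<integral>t. (\<integral>x. indicator {0..1} t * (u x * - (\<Sum>j\<in>UNIV. \<xi> $ j * dq j (x - t *\<^sub>R \<xi>))) \<partial>lborel) \<partial>lborel)"
      by (rule lborel_pair.Fubini_integral[OF intP, symmetric])
    \<comment> \<open>For fixed \<open>t\<close> the shifted bump is itself a bump, with corners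
      \<open>a + t \<xi>\<close> and \<open>b + t \<xi>\<close>, and its closed box lies in
      \<open>G\<close> by \<open>seg\<close>; hence it is admissible in
      \<open>weak_gradient\<close>.\<close>
    also have "\<dots> = (\<integral>t. (\<integral>x. indicator {0..1} t * (g (x + t *\<^sub>R \<xi>) \<bullet> \<xi>) * q x \<partial>lborel) \<partial>lborel)"
    proof (rule Bochner_Integration.integral_cong[OF refl])
      fix t :: real
      show "(\<integral>x. indicator {0..1} t * (u x * - (\<Sum>j\<in>UNIV. \<xi> $ j * dq j (x - t *\<^sub>R \<xi>))) \<partial>lborel)
         = (\<integral>x. indicator {0..1} t * (g (x + t *\<^sub>R \<xi>) \<bullet> \<xi>) * q x \<partial>lborel)"
      proof (cases "t \<in> {0..1}")
        case t: True
        have iu: "integrable lborel (\<lambda>x. u x * dq j (x - t *\<^sub>R \<xi>))" for j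
        proof (rule UB[OF ab, where C="Cj j"])
          fix x show "\<bar>dq j (x - t *\<^sub>R \<xi>)\<bar> \<le> Cj j * indicator (K a b) x"
            using Cj[of j "x - t *\<^sub>R \<xi>"] KI'[of x t a b] t dq0[of "x - t *\<^sub>R \<xi>" j]
            by (cases "x - t *\<^sub>R \<xi> \<in> cbox a b") (auto simp: indicator_def)
        qed measurable
        have ig: "integrable lborel (\<lambda>x. g x $ j * q (x - t *\<^sub>R \<xi>))" for j
        proof (rule Bochner_Integration.integrable_bound[OF intKg[OF ab]])
          show "AE x in lborel. norm (g x $ j * q (x - t *\<^sub>R \<xi>)) \<le> norm (indicator (K a b) x *\<^sub>R g x)"
          proof (rule AE_I2)
            fix x
            show "norm (g x $ j * q (x - t *\<^sub>R \<xi>)) \<le> norm (indicator (K a b) x *\<^sub>R g x)"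
            proof (cases "x - t *\<^sub>R \<xi> \<in> cbox a b")
              case True
              have "\<bar>g x $ j\<bar> * \<bar>q (x - t *\<^sub>R \<xi>)\<bar> \<le> norm (g x) * 1"
                using q[of "x - t *\<^sub>R \<xi>"] True by (intro mult_mono component_le_norm_cart) auto
              then show ?thesis using KI'[OF True, of ] t by (simp add: abs_mult)
            next
              case False then show ?thesis using q[of "x - t *\<^sub>R \<xi>"] by simp
            qed
          qed
        qed measurable
        have "(\<integral>x. u x * (\<Sum>j\<in>UNIV. \<xi> $ j * dq j (x - t *\<^sub>R \<xi>)) \<partial>lborel)
           = (\<integral>x. (\<Sum>j\<in>UNIV. \<xi> $ j * (u x * dq j (x - t *\<^sub>R \<xi>))) \<partial>lborel)"
          by (simp add: sum_distrib_left mult_ac)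
        also have "\<dots> = (\<Sum>j\<in>UNIV. \<xi> $ j * (\<integral>x. u x * dq j (x - t *\<^sub>R \<xi>) \<partial>lborel))"
          using iu by (subst Bochner_Integration.integral_sum) auto
        also have "\<dots> = (\<Sum>j\<in>UNIV. \<xi> $ j * - (\<integral>x. g x $ j * q (x - t *\<^sub>R \<xi>) \<partial>lborel))"
          using wg seg[OF t] unfolding weak_gradient_def dq_def q_def bump_shift[symmetric] dbump_shift[symmetric]
          by auto
        also have "\<dots> = - (\<Sum>j\<in>UNIV. \<xi> $ j * (\<integral>x. g x $ j * q (x - t *\<^sub>R \<xi>) \<partial>lborel))"
          by (simp add: sum_negf)
        also have "(\<Sum>j\<in>UNIV. \<xi> $ j * (\<integral>x. g x $ j * q (x - t *\<^sub>R \<xi>) \<partial>lborel))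
            = (\<integral>x. (\<Sum>j\<in>UNIV. \<xi> $ j * (g x $ j * q (x - t *\<^sub>R \<xi>))) \<partial>lborel)"
          using ig by (subst Bochner_Integration.integral_sum) auto
        also have "\<dots> = (\<integral>x. (g x \<bullet> \<xi>) * q (x - t *\<^sub>R \<xi>) \<partial>lborel)"
          by (simp add: inner_vec_def sum_distrib_left sum_distrib_right mult_ac)
        also have "\<dots> = (\<integral>x. (g (x + t *\<^sub>R \<xi>) \<bullet> \<xi>) * q x \<partial>lborel)"
          using integral_lborel_shift[of "\<lambda>x. (g x \<bullet> \<xi>) * q (x - t *\<^sub>R \<xi>)" "t *\<^sub>R \<xi>"] by simp
        finally show ?thesis using t by simp
      qed simp
    qed
    also have "\<dots> = (\<integral>x. (\<integral>t. indicator {0..1} t * (g (x + t *\<^sub>R \<xi>) \<bullet> \<xi>) * q x \<partial>lborel) \<partial>lborel)"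
      by (rule lborel_pair.Fubini_integral[OF intT[OF ab _ q]]) measurable
    also have "\<dots> = (\<integral>x. W x * q x \<partial>lborel)"
      by (simp add: W_def)
    finally have "(\<integral>x. u (x + \<xi>) * q x - u x * q x \<partial>lborel) = (\<integral>x. W x * q x \<partial>lborel)" .
    moreover have "(\<integral>x. (u (x + \<xi>) - u x - W x) * q x \<partial>lborel) = (\<integral>x. (u (x + \<xi>) * q x - u x * q x) - W x * q x \<partial>lborel)"
      by (simp add: algebra_simps)
    moreover have "\<dots> = (\<integral>x. u (x + \<xi>) * q x - u x * q x \<partial>lborel) - (\<integral>x. W x * q x \<partial>lborel)"
      using iqp iq iWq by (intro Bochner_Integration.integral_diff) auto
    ultimately show "(\<integral>x. (u (x + \<xi>) - u x - W x) * bump n a b x \<partial>lborel) = 0"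
      by (simp add: q_def)
  qed
  then show ?thesis
    by eventually_elim (simp add: V_def W_def)
qed

text \<open>Membership in the Sobolev space and every neighbourhood in \<open>has_trace\<close> come
  with a Jacobian of their own. This identifies them almost everywhere, also when their domains only
  overlap.\<close>

lemma weak_gradient_unique:
  fixes g g' :: "real^'n \<Rightarrow> real^'n"
  assumes wg: "weak_gradient G u g" "weak_gradient G' u' g'" and G: "open G" "open G'"
    and eq: "AE x in lborel. x \<in> G \<inter> G' \<longrightarrow> u x = u' x"
  shows "AE x in lborel. x \<in> G \<inter> G' \<longrightarrow> g x = g' x"
proof -
  have [measurable]: "u \<in> borel_measurable borel" "g \<in> borel_measurable borel" "u' \<in> borel_measurable borel" "g' \<in> borel_measurable borel"
    using wg by (auto simp: weak_gradient_def)
  have [measurable]: "bump n a b \<in> borel_measurable borel" "dbump n a b j \<in> borel_measurable borel" for n j and a b :: "real^'n"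
    by (auto intro!: borel_measurable_continuous_onI continuous_on_bump continuous_on_dbump)
  have int: "set_integrable lborel (cbox a b) (\<lambda>x. g x $ j)" "set_integrable lborel (cbox a b) (\<lambda>x. g' x $ j)"
    if "cbox a b \<subseteq> G \<inter> G'" for a b j
  proof -
    have "integrable lborel (\<lambda>x. indicator (cbox a b) x *\<^sub>R g x)" "integrable lborel (\<lambda>x. indicator (cbox a b) x *\<^sub>R g' x)"
      using wg that by (auto simp: weak_gradient_def set_integrable_def)
    then show "set_integrable lborel (cbox a b) (\<lambda>x. g x $ j)" "set_integrable lborel (cbox a b) (\<lambda>x. g' x $ j)"
      unfolding set_integrable_def by (force dest: integrable_bounded_linear[OF bounded_linear_vec_nth[of j]])+
  qed
  have "AE x in lborel. x \<in> G \<inter> G' \<longrightarrow> g x $ j - g' x $ j = 0" for j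
  proof (rule AE_zero_of_bump_integrals)
    show "open (G \<inter> G')" using G by auto
    show "set_integrable lborel (cbox a b) (\<lambda>x. g x $ j - g' x $ j)" if "cbox a b \<subseteq> G \<inter> G'" for a b
      using int[OF that] by auto
    fix n a b assume ab: "cbox a b \<subseteq> G \<inter> G'"
    have ib: "integrable lborel (\<lambda>x. f x * bump n a b x)"
      if f: "set_integrable lborel (cbox a b) f" and [measurable]: "f \<in> borel_measurable borel" for f :: "real^'n \<Rightarrow> real"
    proof (rule Bochner_Integration.integrable_bound[OF f[unfolded set_integrable_def]])
      show "AE x in lborel. norm (f x * bump n a b x) \<le> norm (indicator (cbox a b) x *\<^sub>R f x)"
      proof (rule AE_I2)
        fix x show "norm (f x * bump n a b x) \<le> norm (indicator (cbox a b) x *\<^sub>R f x)"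
          using bump_bounds[of n a b x] bump_eq_0[of x a b n] box_subset_cbox[of a b]
          by (cases "x \<in> box a b") (auto simp: abs_mult mult_left_le)
      qed
    qed measurable
    have "(\<integral>x. u x * dbump n a b j x \<partial>lborel) = (\<integral>x. u' x * dbump n a b j x \<partial>lborel)"
    proof (rule integral_cong_AE)
      show "AE x in lborel. u x * dbump n a b j x = u' x * dbump n a b j x"
        using eq
      proof eventually_elim
        case (elim x)
        then show ?case using dbump_eq_0[of x a b n j] box_subset_cbox[of a b] ab
          by (cases "x \<in> box a b") auto
      qed
    qed measurable
    moreover have "(\<integral>x. u x * dbump n a b j x \<partial>lborel) = - (\<integral>x. g x $ j * bump n a b x \<partial>lborel)"
      "(\<integral>x. u' x * dbump n a b j x \<partial>lborel) = - (\<integral>x. g' x $ j * bump n a b x \<partial>lborel)"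
      using wg ab by (auto simp: weak_gradient_def)
    ultimately have "(\<integral>x. g x $ j * bump n a b x \<partial>lborel) = (\<integral>x. g' x $ j * bump n a b x \<partial>lborel)" by simp
    moreover have "integrable lborel (\<lambda>x. g x $ j * bump n a b x)" "integrable lborel (\<lambda>x. g' x $ j * bump n a b x)"
      by (rule ib[OF int(1)[OF ab]], simp) (rule ib[OF int(2)[OF ab]], simp)
    ultimately show "(\<integral>x. (g x $ j - g' x $ j) * bump n a b x \<partial>lborel) = 0"
      unfolding left_diff_distrib by (subst Bochner_Integration.integral_diff) simp_all
  qed
  then have "AE x in lborel. \<forall>j\<in>UNIV. x \<in> G \<inter> G' \<longrightarrow> g x $ j - g' x $ j = 0"
    by (subst AE_ball_countable) auto
  then show ?thesis by eventually_elim (auto simp: vec_eq_iff)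
qed

text \<open>Straight segments take the place of general curves, and the exceptional null set may
  depend on \<open>\<xi>\<close>. This is what the line integral formula yields, and it is enough
  for comparing \<open>u\<close> with one translate at a time. The integral on the right may be
  infinite along some segments.\<close>

definition upper_gradient ::
    "'a::euclidean_space set \<Rightarrow> ('a \<Rightarrow> 'b::{real_normed_vector, second_countable_topology}) \<Rightarrow> ('a \<Rightarrow> real) \<Rightarrow> bool" where
  "upper_gradient G u h \<longleftrightarrow>
     u \<in> borel_measurable borel \<and> h \<in> borel_measurable borel \<and> (\<forall>x. 0 \<le> h x) \<and>
     (\<forall>\<xi>. AE x in lborel. (\<forall>t\<in>{0..1}. x + t *\<^sub>R \<xi> \<in> G) \<longrightarrow>
        ennreal (norm (u (x + \<xi>) - u x))
          \<le> ennreal (norm \<xi>) * (\<integral>\<^sup>+t. ennreal (h (x + t *\<^sub>R \<xi>)) * indicator {0..1} t \<partial>lborel))"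

text \<open>On an exhaustion of \<open>G\<close> by compact sets the truncations of \<open>f\<close>
  are Lebesgue measurable; so is their pointwise limit, which therefore agrees almost everywhere
  with a Borel function.\<close>

lemma locally_integrable_ex_borel:
  fixes f :: "'a::euclidean_space \<Rightarrow> real"
  assumes f: "locally_integrable G f" and G: "open G"
  obtains f0 where "f0 \<in> borel_measurable borel" "AE x in lborel. x \<in> G \<longrightarrow> f x = f0 x"
    "\<And>K. compact K \<Longrightarrow> K \<subseteq> G \<Longrightarrow> set_integrable lborel K f0"
proof -
  have int: "integrable lebesgue (\<lambda>x. indicator K x *\<^sub>R f x)" if "compact K" "K \<subseteq> G" for K
    using f that by (simp add: locally_integrable_def set_integrable_def)
  obtain C where C: "\<And>n. compact (C n)" "\<And>n. C n \<subseteq> G" "\<And>n. C n \<subseteq> interior (C (Suc n))" "\<Union>(range C) = G"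
    using open_Union_compact_subsets[OF G] by metis
  have "(\<lambda>n. indicator (C n) x *\<^sub>R f x) \<longlonglongrightarrow> indicator G x * f x" for x
  proof (cases "x \<in> G")
    case True
    then obtain n where n: "x \<in> C n" using C(4) by auto
    have "C m \<subseteq> C (Suc m)" for m using C(3)[of m] interior_subset by blast
    then have "C n \<subseteq> C m" if "n \<le> m" for m using lift_Suc_mono_le[of C] that by blast
    then have "\<forall>\<^sub>F m in sequentially. indicator (C m) x *\<^sub>R f x = indicator G x * f x"
    proof (intro eventually_sequentiallyI[of n])
      fix m assume "n \<le> m"
      with \<open>\<And>m. n \<le> m \<Longrightarrow> C n \<subseteq> C m\<close> n have "x \<in> C m" by blast
      then show "indicator (C m) x *\<^sub>R f x = indicator G x * f x" using True by simp
    qed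
    then show ?thesis by (rule tendsto_eventually)
  next
    case False
    then have "x \<notin> C n" for n using C(2) by auto
    then show ?thesis using False by simp
  qed
  moreover have "(\<lambda>x. indicator (C n) x *\<^sub>R f x) \<in> borel_measurable lebesgue" for n
    using int[OF C(1,2)] by (rule borel_measurable_integrable)
  ultimately have "(\<lambda>x. indicator G x * f x) \<in> borel_measurable (completion lborel)"
    using borel_measurable_LIMSEQ_real[of lebesgue "\<lambda>n x. indicator (C n) x *\<^sub>R f x" "\<lambda>x. indicator G x * f x"] by blast
  then obtain f0 where f0: "f0 \<in> borel_measurable lborel" "AE x in lborel. indicator G x * f x = f0 x"
    using completion_ex_borel_measurable_real by blast
  show thesis
  proof (rule that)
    show "f0 \<in> borel_measurable borel" using f0(1) by simp
    show eq: "AE x in lborel. x \<in> G \<longrightarrow> f x = f0 x"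
      using f0(2) by eventually_elim auto
    fix K assume K: "compact K" "K \<subseteq> G"
    have [measurable]: "K \<in> sets borel" using K(1) by (intro borel_closed compact_imp_closed)
    have m: "(\<lambda>x. indicator K x *\<^sub>R f0 x) \<in> borel_measurable lborel" using f0(1) by measurable
    have "AE x in lebesgue. indicator K x *\<^sub>R f x = indicator K x *\<^sub>R f0 x"
      unfolding AE_completion_iff using eq by eventually_elim (use K in \<open>auto simp: indicator_def\<close>)
    then have "integrable lebesgue (\<lambda>x. indicator K x *\<^sub>R f0 x)"
      using integrable_cong_AE[of "\<lambda>x. indicator K x *\<^sub>R f x" lebesgue "\<lambda>x. indicator K x *\<^sub>R f0 x"] int[OF K]
        measurable_completion[OF m] borel_measurable_integrable[OF int[OF K]] by simp
    then show "set_integrable lborel K f0"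
      using integrable_completion[OF m] by (simp add: set_integrable_def)
  qed
qed

lemma measurable_vec_lambda[measurable (raw)]:
  fixes f :: "'n::finite \<Rightarrow> 'a \<Rightarrow> real"
  assumes [measurable]: "\<And>i. f i \<in> borel_measurable M"
  shows "(\<lambda>x. \<chi> i. f i x) \<in> borel_measurable M"
proof -
  have "(\<lambda>x. \<chi> i. f i x) = (\<lambda>x. \<Sum>i\<in>UNIV. f i x *\<^sub>R axis i 1)"
    by (auto simp: fun_eq_iff vec_eq_iff axis_def if_distrib cong: if_cong)
  then show ?thesis by simp
qed

text \<open>The theorem speaks of Lebesgue measurable functions, whereas translations and Fubini for
  \<open>lborel\<close> want Borel functions. Here \<open>D0 i\<close> represents the
  \<open>i\<close>-th row of the Jacobian.\<close>

lemma weak_jacobian_ex_borel: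
  fixes v :: "real^'n \<Rightarrow> real^'n" and D :: "real^'n \<Rightarrow> real^'n^'n"
  assumes G: "open G" and D: "weak_jacobian G v D"
  obtains v0 D0 where "v0 \<in> borel_measurable borel" "\<And>i. D0 i \<in> borel_measurable borel"
    "AE x in lborel. x \<in> G \<longrightarrow> v x = v0 x \<and> (\<forall>i. D x $ i = D0 i x)"
    "\<And>i. weak_gradient G (\<lambda>x. v0 x $ i) (D0 i)"
proof -
  have wp: "weak_partial G j (\<lambda>x. v x $ i) (\<lambda>x. D x $ i $ j)" for i j
    using D by (auto simp: weak_jacobian_def)
  have [measurable]: "G \<in> sets borel" using G by simp
  have "\<forall>i. \<exists>f0. f0 \<in> borel_measurable borel \<and> (AE x in lborel. x \<in> G \<longrightarrow> v x $ i = f0 x) \<and>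
    (\<forall>K. compact K \<longrightarrow> K \<subseteq> G \<longrightarrow> set_integrable lborel K f0)"
  proof
    fix i
    have "locally_integrable G (\<lambda>x. v x $ i)" using wp by (auto simp: weak_partial_def)
    then show "\<exists>f0. f0 \<in> borel_measurable borel \<and> (AE x in lborel. x \<in> G \<longrightarrow> v x $ i = f0 x) \<and>
    (\<forall>K. compact K \<longrightarrow> K \<subseteq> G \<longrightarrow> set_integrable lborel K f0)"
      by (rule locally_integrable_ex_borel[OF _ G]) blast
  qed
  from this[unfolded choice_iff] obtain vv where vv: "\<And>i. vv i \<in> borel_measurable borel" "\<And>i. AE x in lborel. x \<in> G \<longrightarrow> v x $ i = vv i x"
    "\<And>i K. compact K \<Longrightarrow> K \<subseteq> G \<Longrightarrow> set_integrable lborel K (vv i)" by blast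
  have "\<forall>i j. \<exists>f0. f0 \<in> borel_measurable borel \<and> (AE x in lborel. x \<in> G \<longrightarrow> D x $ i $ j = f0 x) \<and>
    (\<forall>K. compact K \<longrightarrow> K \<subseteq> G \<longrightarrow> set_integrable lborel K f0)"
  proof (intro allI)
    fix i j
    have "locally_integrable G (\<lambda>x. D x $ i $ j)" using wp by (auto simp: weak_partial_def)
    then show "\<exists>f0. f0 \<in> borel_measurable borel \<and> (AE x in lborel. x \<in> G \<longrightarrow> D x $ i $ j = f0 x) \<and>
    (\<forall>K. compact K \<longrightarrow> K \<subseteq> G \<longrightarrow> set_integrable lborel K f0)"
      by (rule locally_integrable_ex_borel[OF _ G]) blast
  qed
  from this[unfolded choice_iff] obtain DD where DD: "\<And>i j. DD i j \<in> borel_measurable borel" "\<And>i j. AE x in lborel. x \<in> G \<longrightarrow> D x $ i $ j = DD i j x"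
    "\<And>i j K. compact K \<Longrightarrow> K \<subseteq> G \<Longrightarrow> set_integrable lborel K (DD i j)" by blast
  note [measurable] = vv(1) DD(1)
  \<comment> \<open>The test factor \<open>q\<close> vanishes off \<open>G\<close>, so the integral
    over \<open>G\<close> becomes one over the whole space, where \<open>f\<close> may be exchanged
    for its Borel representative.\<close>
  have tr: "(\<integral>x. f x * q x \<partial>lebesgue_on G) = (\<integral>x. f0 x * q x \<partial>lborel)"
    if [measurable]: "f0 \<in> borel_measurable borel" "q \<in> borel_measurable borel"
      and eq: "AE x in lborel. x \<in> G \<longrightarrow> f x = f0 x" and q: "\<And>x. x \<notin> G \<Longrightarrow> q x = 0" for f f0 q :: "real^'n \<Rightarrow> real"
  proof -
    have "(\<integral>x. f x * q x \<partial>lebesgue_on G) = (\<integral>x. indicator G x *\<^sub>R (f x * q x) \<partial>lebesgue)"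
      by (rule integral_restrict_space) simp
    also have "\<dots> = (\<integral>x. f0 x * q x \<partial>lebesgue)"
    proof (rule integral_cong_AE)
      have 1: "AE x in lebesgue. f0 x * q x = indicator G x *\<^sub>R (f x * q x)"
        unfolding AE_completion_iff using eq by eventually_elim (use q in \<open>auto simp: indicator_def\<close>)
      show 2: "(\<lambda>x. f0 x * q x) \<in> borel_measurable lebesgue"
        by (rule measurable_completion) measurable
      show "(\<lambda>x. indicator G x *\<^sub>R (f x * q x)) \<in> borel_measurable lebesgue"
        using borel_measurable_AE[OF 2 1] .
      show "AE x in lebesgue. indicator G x *\<^sub>R (f x * q x) = f0 x * q x"
        using 1 by eventually_elim (rule sym)
    qed
    also have "\<dots> = (\<integral>x. f0 x * q x \<partial>lborel)"
      by (rule integral_completion) measurable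
    finally show ?thesis .
  qed
  show thesis
  proof (rule that[of "\<lambda>x. \<chi> i. vv i x" "\<lambda>i x. \<chi> j. DD i j x"])
    show "(\<lambda>x. \<chi> i. vv i x) \<in> borel_measurable borel" by measurable
    show "(\<lambda>x. \<chi> j. DD i j x) \<in> borel_measurable borel" for i by measurable
    have "AE x in lborel. \<forall>i\<in>UNIV. x \<in> G \<longrightarrow> v x $ i = vv i x"
      using vv(2) by (subst AE_ball_countable) auto
    moreover have "AE x in lborel. \<forall>p\<in>UNIV. x \<in> G \<longrightarrow> D x $ fst p $ snd p = DD (fst p) (snd p) x"
      using DD(2) by (subst AE_ball_countable) auto
    ultimately show "AE x in lborel. x \<in> G \<longrightarrow> v x = (\<chi> i. vv i x) \<and> (\<forall>i. D x $ i = (\<chi> j. DD i j x))"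
      by eventually_elim (auto simp: vec_eq_iff)
    show "weak_gradient G (\<lambda>x. (\<chi> i. vv i x) $ i) (\<lambda>x. \<chi> j. DD i j x)" for i
      unfolding weak_gradient_def
    proof (intro conjI allI impI)
      show "set_integrable lborel K (\<lambda>x. (\<chi> i. vv i x) $ i)" if "compact K \<and> K \<subseteq> G" for K
        using that vv(3) by simp
      show "set_integrable lborel K (\<lambda>x. \<chi> j. DD i j x)" if "compact K \<and> K \<subseteq> G" for K
      proof -
        have "integrable lborel (\<lambda>x. \<Sum>j\<in>UNIV. (indicator K x *\<^sub>R DD i j x) *\<^sub>R (axis j 1 :: real^'n))"
          using that DD(3) by (intro Bochner_Integration.integrable_sum integrable_scaleR_left) (auto simp: set_integrable_def)
        moreover have "(\<Sum>j\<in>UNIV. (indicator K x *\<^sub>R DD i j x) *\<^sub>R (axis j 1 :: real^'n)) = indicator K x *\<^sub>R (\<chi> j. DD i j x)" for x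
          by (auto simp: vec_eq_iff axis_def if_distrib cong: if_cong)
        ultimately show ?thesis by (simp add: set_integrable_def)
      qed
      fix n a b j assume ab: "cbox a b \<subseteq> G"
      have "(\<integral>x. v x $ i * partial_deriv j (bump n a b) x \<partial>lebesgue_on G) = - (\<integral>x. D x $ i $ j * bump n a b x \<partial>lebesgue_on G)"
        using wp[of j i] test_function_bump[OF ab] by (auto simp: weak_partial_def)
      moreover have nG: "x \<notin> box a b" if "x \<notin> G" for x using ab box_subset_cbox[of a b] that by auto
      have "(\<integral>x. v x $ i * dbump n a b j x \<partial>lebesgue_on G) = (\<integral>x. vv i x * dbump n a b j x \<partial>lborel)"
        by (rule tr[OF _ _ vv(2)])
           (auto intro!: borel_measurable_continuous_onI continuous_on_dbump dbump_eq_0 nG vv(1))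
      moreover have "(\<integral>x. D x $ i $ j * bump n a b x \<partial>lebesgue_on G) = (\<integral>x. DD i j x * bump n a b x \<partial>lborel)"
        by (rule tr[OF _ _ DD(2)])
           (auto intro!: borel_measurable_continuous_onI continuous_on_bump bump_eq_0 nG DD(1))
      ultimately show "(\<integral>x. (\<chi> i. vv i x) $ i * dbump n a b j x \<partial>lborel) = - (\<integral>x. (\<chi> j. DD i j x) $ j * bump n a b x \<partial>lborel)"
        by (simp add: partial_deriv_bump)
    qed measurable
  qed
qed

lemma norm_integral_le_nn_integral:
  "ennreal (norm (integral\<^sup>L M f)) \<le> (\<integral>\<^sup>+x. ennreal (norm (f x)) \<partial>M)"
  by (cases "integrable M f") (auto intro: integral_norm_bound_ennreal simp: not_integrable_integral_eq)

text \<open>By Cauchy-Schwarz each component of the increment is controlled by the norm of its own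
  row; the sum over the rows dominates the Euclidean norm of the increment.\<close>

lemma upper_gradient_of_weak_gradient:
  fixes v :: "real^'n \<Rightarrow> real^'n"
  assumes G: "open G" and v[measurable]: "v \<in> borel_measurable borel"
    and wg: "\<And>i. weak_gradient G (\<lambda>x. v x $ i) (D i)"
  shows "upper_gradient G v (\<lambda>x. \<Sum>i\<in>UNIV. norm (D i x))"
  unfolding upper_gradient_def
proof (intro conjI allI)
  have [measurable]: "D i \<in> borel_measurable borel" for i using wg by (auto simp: weak_gradient_def)
  show "(\<lambda>x. \<Sum>i\<in>UNIV. norm (D i x)) \<in> borel_measurable borel" by measurable
  show "0 \<le> (\<Sum>i\<in>UNIV. norm (D i x))" for x by (simp add: sum_nonneg)
  fix \<xi> :: "real^'n"
  have "AE x in lborel. \<forall>i\<in>UNIV. (\<forall>t\<in>{0..1}. x + t *\<^sub>R \<xi> \<in> G) \<longrightarrow>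
           v (x + \<xi>) $ i - v x $ i = (\<integral>t. indicator {0..1} t * (D i (x + t *\<^sub>R \<xi>) \<bullet> \<xi>) \<partial>lborel)"
    using weak_gradient_line_integral[OF wg G] by (subst AE_ball_countable) auto
  then show "AE x in lborel. (\<forall>t\<in>{0..1}. x + t *\<^sub>R \<xi> \<in> G) \<longrightarrow>
        ennreal (norm (v (x + \<xi>) - v x))
          \<le> ennreal (norm \<xi>) * (\<integral>\<^sup>+t. ennreal (\<Sum>i\<in>UNIV. norm (D i (x + t *\<^sub>R \<xi>))) * indicator {0..1} t \<partial>lborel)"
  proof (eventually_elim, intro impI)
    fix x assume *: "\<forall>i\<in>UNIV. (\<forall>t\<in>{0..1}. x + t *\<^sub>R \<xi> \<in> G) \<longrightarrow>
           v (x + \<xi>) $ i - v x $ i = (\<integral>t. indicator {0..1} t * (D i (x + t *\<^sub>R \<xi>) \<bullet> \<xi>) \<partial>lborel)"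
      and seg: "\<forall>t\<in>{0..1}. x + t *\<^sub>R \<xi> \<in> G"
    have "ennreal (norm (v (x + \<xi>) - v x)) \<le> ennreal (\<Sum>i\<in>UNIV. \<bar>(v (x + \<xi>) - v x) $ i\<bar>)"
      by (intro ennreal_leI norm_le_l1_cart)
    also have "\<dots> = (\<Sum>i\<in>UNIV. ennreal (norm (\<integral>t. indicator {0..1} t * (D i (x + t *\<^sub>R \<xi>) \<bullet> \<xi>) \<partial>lborel)))"
      using * seg by (simp add: sum_ennreal)
    also have "\<dots> \<le> (\<Sum>i\<in>UNIV. \<integral>\<^sup>+t. ennreal (norm \<xi>) * (ennreal (norm (D i (x + t *\<^sub>R \<xi>))) * indicator {0..1} t) \<partial>lborel)"
    proof (intro sum_mono order_trans[OF norm_integral_le_nn_integral] nn_integral_mono)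
      fix i t
      show "ennreal (norm (indicator {0..1} t * (D i (x + t *\<^sub>R \<xi>) \<bullet> \<xi>))) \<le>
        ennreal (norm \<xi>) * (ennreal (norm (D i (x + t *\<^sub>R \<xi>))) * indicator {0..1} t)"
        using Cauchy_Schwarz_ineq2[of "D i (x + t *\<^sub>R \<xi>)" \<xi>]
        by (auto simp: indicator_def ennreal_mult[symmetric] mult.commute intro!: ennreal_leI)
    qed
    also have "\<dots> = (\<integral>\<^sup>+t. (\<Sum>i\<in>UNIV. ennreal (norm \<xi>) * (ennreal (norm (D i (x + t *\<^sub>R \<xi>))) * indicator {0..1} t)) \<partial>lborel)"
      by (rule nn_integral_sum[symmetric]) measurable
    also have "\<dots> = (\<integral>\<^sup>+t. ennreal (norm \<xi>) * (ennreal (\<Sum>i\<in>UNIV. norm (D i (x + t *\<^sub>R \<xi>))) * indicator {0..1} t) \<partial>lborel)"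
      by (subst sum_ennreal[symmetric]) (simp_all only: norm_ge_zero sum_distrib_left sum_distrib_right)
    also have "\<dots> = ennreal (norm \<xi>) * (\<integral>\<^sup>+t. ennreal (\<Sum>i\<in>UNIV. norm (D i (x + t *\<^sub>R \<xi>))) * indicator {0..1} t \<partial>lborel)"
      by (rule nn_integral_cmult) measurable
    finally show "ennreal (norm (v (x + \<xi>) - v x))
          \<le> ennreal (norm \<xi>) * (\<integral>\<^sup>+t. ennreal (\<Sum>i\<in>UNIV. norm (D i (x + t *\<^sub>R \<xi>))) * indicator {0..1} t \<partial>lborel)" .
  qed
qed (rule v)

section \<open>Upper gradients and the improved Poincare inequality\<close>

lemma powr_above_tangent:
  fixes x j p :: real
  assumes p: "1 \<le> p" and j: "0 < j" and x: "0 \<le> x"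
  shows "j powr p + p * j powr (p - 1) * (x - j) \<le> x powr p"
proof (cases "x = 0")
  case True
  have "j powr (p - 1) * j = j powr p" using powr_mult_base[of j "p - 1"] j by (simp add: mult.commute)
  then have "j powr p + p * j powr (p - 1) * (x - j) = (1 - p) * j powr p"
    using True by (simp add: algebra_simps)
  also have "\<dots> \<le> 0" using p by (simp add: mult_nonpos_nonneg)
  finally show ?thesis using True by simp
next
  case False
  have "p * j powr (p - 1) * (x - j) \<le> x powr p - j powr p"
    using p j x False powr_convex[OF p]
    by (intro convex_on_imp_above_tangent[where A="{0<..}"])
       (auto intro!: derivative_eq_intros simp: interior_open)
  then show ?thesis by simp
qed

lemma powr_add_le:
  fixes a b p :: real
  assumes "1 \<le> p" "0 \<le> a" "0 \<le> b"
  shows "(a + b) powr p \<le> 2 powr p * (a powr p + b powr p)"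
proof -
  have "(a + b) powr p \<le> (2 * max a b) powr p" using assms by (intro powr_mono2) auto
  also have "\<dots> = 2 powr p * (max a b) powr p" by (simp add: powr_mult)
  also have "\<dots> \<le> 2 powr p * (a powr p + b powr p)" by (intro mult_left_mono) (auto simp: max_def)
  finally show ?thesis .
qed

text \<open>The factor in front of \<open>a powr p\<close> has to stay below 2, because the layer
  argument gains only a factor \<open>1/2\<close>. With \<open>(1 + \<theta>) powr p = 3/2\<close>,
  either \<open>b\<close> is at most \<open>\<theta> * a\<close> and is swallowed by the first term,
  or \<open>a\<close> is at most \<open>b / \<theta>\<close>.\<close>

lemma powr_add_le_three_halves:
  fixes p :: real
  assumes p: "1 \<le> p"
  obtains C where "0 < C" "\<And>a b. 0 \<le> a \<Longrightarrow> 0 \<le> b \<Longrightarrow> (a + b) powr p \<le> 3/2 * a powr p + C * b powr p"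
proof -
  define \<theta> where "\<theta> = (3/2) powr (1/p) - (1::real)"
  have \<theta>: "\<theta> > 0" unfolding \<theta>_def using p by simp
  have \<theta>p: "(1 + \<theta>) powr p = 3/2" unfolding \<theta>_def using p by (simp add: powr_powr)
  show thesis
  proof (rule that[of "(1 / \<theta> + 1) powr p"])
    have "0 < 1 / \<theta> + 1" using \<theta> by (intro add_pos_pos) auto
    then show "0 < (1 / \<theta> + 1) powr p" by simp
    fix a b :: real assume ab: "0 \<le> a" "0 \<le> b"
    show "(a + b) powr p \<le> 3/2 * a powr p + (1 / \<theta> + 1) powr p * b powr p"
    proof (cases "b \<le> \<theta> * a")
      case True
      have "(a + b) powr p \<le> ((1 + \<theta>) * a) powr p" using ab p True by (intro powr_mono2) (auto simp: algebra_simps)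
      also have "\<dots> = 3/2 * a powr p" by (simp add: powr_mult \<theta>p)
      finally show ?thesis by (simp add: add_increasing2)
    next
      case False
      then have "a \<le> 1 / \<theta> * b" using \<theta> by (simp add: field_simps)
      then have "(a + b) powr p \<le> ((1 / \<theta> + 1) * b) powr p" using ab p by (intro powr_mono2) (auto simp: algebra_simps)
      also have "\<dots> = (1 / \<theta> + 1) powr p * b powr p" by (simp add: powr_mult)
      finally show ?thesis by (simp add: add_increasing)
    qed
  qed
qed

text \<open>Jensen's inequality for a function that may fail to be integrable. If the right-hand
  side is finite, so is the mean \<open>j\<close> of \<open>f\<close>, and integrating the tangent
  of the power function at \<open>j\<close> gives the claim.\<close>

lemma jensen_unit_interval:
  fixes f :: "real \<Rightarrow> real"
  assumes p: "1 \<le> p" and [measurable]: "f \<in> borel_measurable borel" and f: "\<And>t. 0 \<le> f t"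
    and a: "0 \<le> a" and c: "0 \<le> c"
    and le: "ennreal a \<le> ennreal c * (\<integral>\<^sup>+t. ennreal (f t) * indicator {0..1} t \<partial>lborel)"
  shows "ennreal (a powr p) \<le> ennreal (c powr p) * (\<integral>\<^sup>+t. ennreal (f t powr p) * indicator {0..1} t \<partial>lborel)"
proof (cases "a = 0")
  case True then show ?thesis by simp
next
  case False
  then have a0: "a > 0" using a by simp
  then have c0: "c > 0" using le c by (cases "c = 0") auto
  define I where "I = (\<integral>\<^sup>+t. ennreal (f t powr p) * indicator {0..1} t \<partial>lborel)"
  define J where "J = (\<integral>\<^sup>+t. ennreal (f t) * indicator {0..1} t \<partial>lborel)"
  have one: "(\<integral>\<^sup>+t. indicator {0..1::real} t \<partial>lborel) = 1" by simp
  show ?thesis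
  proof (cases "I = \<infinity>")
    case True
    then show ?thesis using c0 by (simp add: I_def ennreal_mult_top)
  next
    case False
    \<comment> \<open>Finiteness of the mean, from \<open>f t \<le> 1 + f t powr p\<close>.\<close>
    have "J \<le> (\<integral>\<^sup>+t. (1 + ennreal (f t powr p)) * indicator {0..1} t \<partial>lborel)"
      unfolding J_def
    proof (intro nn_integral_mono mult_right_mono)
      fix t
      have "f t \<le> 1 + f t powr p"
        using powr_mono[of 1 p "f t"] p f[of t] by (cases "f t \<ge> 1") (auto simp: add_increasing2)
      then have "ennreal (f t) \<le> ennreal (1 + f t powr p)" by (rule ennreal_leI)
      then show "ennreal (f t) \<le> 1 + ennreal (f t powr p)" by simp
    qed simp
    also have "\<dots> = 1 + I"
      by (simp add: distrib_right nn_integral_add I_def)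
    finally have "J < \<infinity>" using False by (auto simp: less_top[symmetric] top_unique)
    then obtain j where j: "J = ennreal j" "0 \<le> j" by (cases J) auto
    have aj: "a \<le> c * j" using le unfolding J_def[symmetric] j(1) using c0 j(2)
      by (simp add: ennreal_mult[symmetric])
    then have j0: "j > 0" using a0 c0 j(2) by (cases "j = 0") auto
    \<comment> \<open>The tangent inequality in the form
      \<open>p j^(p-1) f \<le> (p - 1) j^p + f^p\<close>: all terms are nonnegative, so it can be
      integrated in \<open>ennreal\<close>.\<close>
    have "ennreal (p * j powr p) = ennreal (p * j powr (p - 1)) * J"
      using powr_mult_base[of j "p - 1"] j0 p by (simp add: j(1) ennreal_mult[symmetric] mult_ac)
    also have "\<dots> = (\<integral>\<^sup>+t. ennreal (p * j powr (p - 1)) * (ennreal (f t) * indicator {0..1} t) \<partial>lborel)"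
      unfolding J_def by (rule nn_integral_cmult[symmetric]) measurable
    also have "\<dots> \<le> (\<integral>\<^sup>+t. ennreal ((p - 1) * j powr p) * indicator {0..1} t + ennreal (f t powr p) * indicator {0..1} t \<partial>lborel)"
    proof (intro nn_integral_mono)
      fix t
      have "j powr (p - 1) * j = j powr p" using powr_mult_base[of j "p - 1"] j0 by (simp add: mult.commute)
      then have "p * j powr (p - 1) * f t \<le> (p - 1) * j powr p + f t powr p"
        using powr_above_tangent[OF p j0 f[of t]] by (simp add: algebra_simps)
      then have "ennreal (p * j powr (p - 1) * f t) \<le> ennreal ((p - 1) * j powr p + f t powr p)" by (rule ennreal_leI)
      then have "ennreal (p * j powr (p - 1)) * ennreal (f t) \<le> ennreal ((p - 1) * j powr p) + ennreal (f t powr p)"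
        using p f[of t] by (simp add: ennreal_mult ennreal_plus)
      then show "ennreal (p * j powr (p - 1)) * (ennreal (f t) * indicator {0..1} t)
          \<le> ennreal ((p - 1) * j powr p) * indicator {0..1} t + ennreal (f t powr p) * indicator {0..1} t"
        by (auto simp: indicator_def)
    qed
    also have "\<dots> = ennreal ((p - 1) * j powr p) + I"
      by (subst nn_integral_add) (auto simp: I_def nn_integral_cmult)
    finally have "ennreal (p * j powr p) \<le> ennreal ((p - 1) * j powr p) + I" .
    moreover obtain r where r: "I = ennreal r" "0 \<le> r" using False by (cases I) auto
    moreover have "0 \<le> (p - 1) * j powr p" using p by simp
    ultimately have "ennreal (p * j powr p) \<le> ennreal ((p - 1) * j powr p + r)"
      by (simp only: ennreal_plus)
    then have "j powr p \<le> r"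
      using \<open>0 \<le> (p - 1) * j powr p\<close> r(2) by (subst (asm) ennreal_le_iff) (auto simp: algebra_simps)
    then have "ennreal (j powr p) \<le> I" by (simp add: r ennreal_leI)
    then have "ennreal (c powr p) * ennreal (j powr p) \<le> ennreal (c powr p) * I" by (rule mult_left_mono) simp
    moreover have "ennreal (a powr p) \<le> ennreal (c powr p * j powr p)"
      using aj a p by (intro ennreal_leI) (simp add: powr_mult[symmetric] powr_mono2)
    ultimately show ?thesis by (simp add: ennreal_mult I_def)
  qed
qed

text \<open>The \<open>p\<close>-th power of the norm, with values in \<open>ennreal\<close>: masses
  of pieces add up, and finiteness has to be discussed only where a term is cancelled.\<close>

definition Lp_mass :: "real \<Rightarrow> 'a::euclidean_space set \<Rightarrow> ('a \<Rightarrow> 'b::real_normed_vector) \<Rightarrow> ennreal" where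
  "Lp_mass p S f = (\<integral>\<^sup>+x. ennreal (norm (f x) powr p) * indicator S x \<partial>lborel)"

lemma Lp_mass_mono:
  assumes "0 \<le> p" and "AE x in lborel. x \<in> S \<longrightarrow> x \<in> T \<and> norm (f x) \<le> norm (g x)"
  shows "Lp_mass p S f \<le> Lp_mass p T g"
  unfolding Lp_mass_def
proof (rule nn_integral_mono_AE)
  show "AE x in lborel. ennreal (norm (f x) powr p) * indicator S x \<le> ennreal (norm (g x) powr p) * indicator T x"
    using assms(2) by eventually_elim (use assms(1) in \<open>auto simp: indicator_def intro!: ennreal_leI powr_mono2\<close>)
qed

lemma Lp_mass_subset: "S \<subseteq> T \<Longrightarrow> Lp_mass p S f \<le> Lp_mass p T f"
  unfolding Lp_mass_def by (intro nn_integral_mono) (auto simp: indicator_def)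

lemma Lp_mass_Un_le:
  fixes f :: "'a::euclidean_space \<Rightarrow> 'b::{real_normed_vector, second_countable_topology}"
  assumes [measurable]: "S \<in> sets borel" "T \<in> sets borel" "f \<in> borel_measurable borel"
  shows "Lp_mass p (S \<union> T) f \<le> Lp_mass p S f + Lp_mass p T f"
  unfolding Lp_mass_def by (subst nn_integral_add[symmetric]) (auto intro!: nn_integral_mono simp: indicator_def)

lemma Lp_mass_disjoint_Un:
  fixes f :: "'a::euclidean_space \<Rightarrow> 'b::{real_normed_vector, second_countable_topology}"
  assumes [measurable]: "S \<in> sets borel" "T \<in> sets borel" "f \<in> borel_measurable borel" and "S \<inter> T = {}"
  shows "Lp_mass p (S \<union> T) f = Lp_mass p S f + Lp_mass p T f"
  unfolding Lp_mass_def
  using assms(4) by (subst nn_integral_add[symmetric]) (auto intro!: nn_integral_cong simp: indicator_def)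

lemma Lp_mass_cmult_bound:
  fixes f :: "'a::euclidean_space \<Rightarrow> 'b::{real_normed_vector, second_countable_topology}"
    and g :: "'a \<Rightarrow> 'c::{real_normed_vector, second_countable_topology}"
  assumes p: "0 \<le> p" and c: "0 \<le> c" and [measurable]: "g \<in> borel_measurable borel" "T \<in> sets borel"
    and le: "\<And>x. x \<in> S \<Longrightarrow> x \<in> T \<and> norm (f x) \<le> c * norm (g x)"
  shows "Lp_mass p S f \<le> ennreal (c powr p) * Lp_mass p T g"
proof -
  have "Lp_mass p S f \<le> (\<integral>\<^sup>+x. ennreal (c powr p) * (ennreal (norm (g x) powr p) * indicator T x) \<partial>lborel)"
    unfolding Lp_mass_def
  proof (intro nn_integral_mono)
    fix x
    show "ennreal (norm (f x) powr p) * indicator S x \<le> ennreal (c powr p) * (ennreal (norm (g x) powr p) * indicator T x)"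
    proof (cases "x \<in> S")
      case True
      have "norm (f x) powr p \<le> (c * norm (g x)) powr p" using le[OF True] p by (intro powr_mono2) auto
      then show ?thesis using True le[OF True]
        by (simp add: powr_mult ennreal_mult[symmetric] ennreal_leI)
    qed simp
  qed
  then show ?thesis by (simp add: Lp_mass_def nn_integral_cmult)
qed

lemma Lp_mass_add_le:
  fixes f g :: "'a::euclidean_space \<Rightarrow> 'b::{real_normed_vector, second_countable_topology}"
  assumes p: "1 \<le> p" and [measurable]: "S \<in> sets borel" "f \<in> borel_measurable borel" "g \<in> borel_measurable borel"
    and k: "\<And>x. x \<in> S \<Longrightarrow> norm (k x) \<le> norm (f x) + norm (g x)"
  shows "Lp_mass p S k \<le> ennreal (2 powr p) * (Lp_mass p S f + Lp_mass p S g)"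
proof -
  have "Lp_mass p S k \<le> (\<integral>\<^sup>+x. ennreal (2 powr p) * (ennreal (norm (f x) powr p) * indicator S x + ennreal (norm (g x) powr p) * indicator S x) \<partial>lborel)"
    unfolding Lp_mass_def
  proof (intro nn_integral_mono)
    fix x
    have "ennreal (norm (k x) powr p) \<le> ennreal (2 powr p) * (ennreal (norm (f x) powr p) + ennreal (norm (g x) powr p))" if "x \<in> S"
    proof -
      have "norm (k x) powr p \<le> (norm (f x) + norm (g x)) powr p" using k[OF that] p by (intro powr_mono2) auto
      also have "\<dots> \<le> 2 powr p * (norm (f x) powr p + norm (g x) powr p)" using p by (intro powr_add_le) auto
      finally show ?thesis by (simp add: ennreal_mult[symmetric] ennreal_plus[symmetric] ennreal_leI del: ennreal_plus)
    qed
    then show "ennreal (norm (k x) powr p) * indicator S x \<le> ennreal (2 powr p) * (ennreal (norm (f x) powr p) * indicator S x + ennreal (norm (g x) powr p) * indicator S x)"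
      by (cases "x \<in> S") auto
  qed
  then show ?thesis by (simp add: Lp_mass_def nn_integral_cmult nn_integral_add)
qed

lemma Lp_mass_shift_le:
  fixes f :: "'a::euclidean_space \<Rightarrow> 'b::{real_normed_vector, second_countable_topology}"
  assumes [measurable]: "T \<in> sets borel" "f \<in> borel_measurable borel"
    and "\<And>x. x \<in> S \<Longrightarrow> x + \<xi> \<in> T"
  shows "Lp_mass p S (\<lambda>x. f (x + \<xi>)) \<le> Lp_mass p T f"
proof -
  have "Lp_mass p S (\<lambda>x. f (x + \<xi>)) \<le> (\<integral>\<^sup>+x. ennreal (norm (f (x + \<xi>)) powr p) * indicator T (x + \<xi>) \<partial>lborel)"
    unfolding Lp_mass_def using assms(3) by (intro nn_integral_mono) (auto simp: indicator_def)
  also have "\<dots> = Lp_mass p T f"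
    unfolding Lp_mass_def
    by (rule nn_integral_lborel_shift[of "\<lambda>x. ennreal (norm (f x) powr p) * indicator T x"]) measurable
  finally show ?thesis .
qed

lemma Lp_mass_le_shift:
  fixes f :: "'a::euclidean_space \<Rightarrow> 'b::{real_normed_vector, second_countable_topology}"
  assumes [measurable]: "S \<in> sets borel" "f \<in> borel_measurable borel"
    and "\<And>y. y \<in> T \<Longrightarrow> y - \<xi> \<in> S"
  shows "Lp_mass p T f \<le> Lp_mass p S (\<lambda>x. f (x + \<xi>))"
  using Lp_mass_shift_le[of S "\<lambda>x. f (x + \<xi>)" T "- \<xi>" p] assms by simp

text \<open>Jensen along each segment, then Fubini: for fixed \<open>t\<close> the translate of
  \<open>S\<close> by \<open>t \<xi>\<close> stays in \<open>T\<close>, so the integral over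
  \<open>x\<close> is bounded by the mass of \<open>h\<close> on \<open>T\<close>, uniformly in
  \<open>t\<close>.\<close>

lemma Lp_mass_increment_le:
  assumes ug: "upper_gradient G u h" and p: "1 \<le> p" and [measurable]: "S \<in> sets borel" "T \<in> sets borel"
    and TG: "T \<subseteq> G" and ST: "\<And>x t. x \<in> S \<Longrightarrow> 0 \<le> t \<Longrightarrow> t \<le> 1 \<Longrightarrow> x + t *\<^sub>R \<xi> \<in> T"
  shows "Lp_mass p S (\<lambda>x. u (x + \<xi>) - u x) \<le> ennreal (norm \<xi> powr p) * Lp_mass p T h"
proof -
  have [measurable]: "u \<in> borel_measurable borel" "h \<in> borel_measurable borel" and h0: "\<And>x. 0 \<le> h x"
    using ug by (auto simp: upper_gradient_def)
  have "AE x in lborel. (\<forall>t\<in>{0..1}. x + t *\<^sub>R \<xi> \<in> G) \<longrightarrow>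
        ennreal (norm (u (x + \<xi>) - u x))
          \<le> ennreal (norm \<xi>) * (\<integral>\<^sup>+t. ennreal (h (x + t *\<^sub>R \<xi>)) * indicator {0..1} t \<partial>lborel)"
    using ug by (auto simp: upper_gradient_def)
  then have "AE x in lborel. ennreal (norm (u (x + \<xi>) - u x) powr p) * indicator S x \<le>
      (\<integral>\<^sup>+t. ennreal (norm \<xi> powr p) * (ennreal (h (x + t *\<^sub>R \<xi>) powr p) * indicator {0..1} t * indicator S x) \<partial>lborel)"
  proof eventually_elim
    case (elim x)
    show ?case
    proof (cases "x \<in> S")
      case True
      then have "\<forall>t\<in>{0..1}. x + t *\<^sub>R \<xi> \<in> G" using ST TG by auto
      then have "ennreal (norm (u (x + \<xi>) - u x) powr p) \<le> ennreal (norm \<xi> powr p) * (\<integral>\<^sup>+t. ennreal (h (x + t *\<^sub>R \<xi>) powr p) * indicator {0..1} t \<partial>lborel)"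
        using elim by (intro jensen_unit_interval[OF p]) (auto simp: h0)
      also have "\<dots> = (\<integral>\<^sup>+t. ennreal (norm \<xi> powr p) * (ennreal (h (x + t *\<^sub>R \<xi>) powr p) * indicator {0..1} t) \<partial>lborel)"
        by (rule nn_integral_cmult[symmetric]) measurable
      finally show ?thesis using True by simp
    qed simp
  qed
  then have "Lp_mass p S (\<lambda>x. u (x + \<xi>) - u x) \<le>
      (\<integral>\<^sup>+x. \<integral>\<^sup>+t. ennreal (norm \<xi> powr p) * (ennreal (h (x + t *\<^sub>R \<xi>) powr p) * indicator {0..1} t * indicator S x) \<partial>lborel \<partial>lborel)"
    unfolding Lp_mass_def by (rule nn_integral_mono_AE)
  also have "\<dots> = (\<integral>\<^sup>+t. \<integral>\<^sup>+x. ennreal (norm \<xi> powr p) * (ennreal (h (x + t *\<^sub>R \<xi>) powr p) * indicator {0..1} t * indicator S x) \<partial>lborel \<partial>lborel)"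
    by (rule lborel_pair.Fubini'[symmetric]) measurable
  also have "\<dots> \<le> (\<integral>\<^sup>+t. indicator {0..1::real} t * (ennreal (norm \<xi> powr p) * Lp_mass p T h) \<partial>lborel)"
  proof (intro nn_integral_mono)
    fix t :: real
    show "(\<integral>\<^sup>+x. ennreal (norm \<xi> powr p) * (ennreal (h (x + t *\<^sub>R \<xi>) powr p) * indicator {0..1} t * indicator S x) \<partial>lborel)
      \<le> indicator {0..1} t * (ennreal (norm \<xi> powr p) * Lp_mass p T h)"
    proof (cases "t \<in> {0..1}")
      case True
      have "(\<integral>\<^sup>+x. ennreal (norm \<xi> powr p) * (ennreal (h (x + t *\<^sub>R \<xi>) powr p) * indicator {0..1} t * indicator S x) \<partial>lborel)
        = ennreal (norm \<xi> powr p) * Lp_mass p S (\<lambda>x. h (x + t *\<^sub>R \<xi>))"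
        using True by (simp add: Lp_mass_def nn_integral_cmult h0)
      also have "\<dots> \<le> ennreal (norm \<xi> powr p) * Lp_mass p T h"
        using True ST by (intro mult_left_mono Lp_mass_shift_le) auto
      finally show ?thesis using True by simp
    qed simp
  qed
  also have "\<dots> = ennreal (norm \<xi> powr p) * Lp_mass p T h"
    by (simp add: nn_integral_multc)
  finally show ?thesis .
qed

text \<open>The constant depends neither on \<open>u\<close> nor on \<open>h\<close>. The reference
  set \<open>B\<close> stays fixed while control spreads from it over \<open>G\<close>. The
  finiteness premise is what allows cancellation in the boundary layers.\<close>

definition controlled :: "real \<Rightarrow> 'a::euclidean_space set \<Rightarrow> ('a \<Rightarrow> real) \<Rightarrow> 'a set \<Rightarrow> 'a set \<Rightarrow> bool" where
  "controlled p G w B S \<longleftrightarrow>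
     (\<exists>C\<ge>0. \<forall>(u :: 'a \<Rightarrow> 'a) h. upper_gradient G u h \<longrightarrow> Lp_mass p G u < \<infinity> \<longrightarrow>
        Lp_mass p S u \<le> ennreal C * (Lp_mass p B u + Lp_mass p G (\<lambda>x. w x * h x)))"

lemma controlledE:
  assumes "controlled p G w B S"
  obtains C where "0 \<le> C" "\<And>(u :: 'a \<Rightarrow> 'a::euclidean_space) h. upper_gradient G u h \<Longrightarrow> Lp_mass p G u < \<infinity> \<Longrightarrow>
        Lp_mass p S u \<le> ennreal C * (Lp_mass p B u + Lp_mass p G (\<lambda>x. w x * h x))"
  using assms unfolding controlled_def by blast

lemma controlled_mono: "controlled p G w B T \<Longrightarrow> S \<subseteq> T \<Longrightarrow> controlled p G w B S"
  unfolding controlled_def by (blast intro: order_trans[OF Lp_mass_subset[of S T]])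

lemma controlled_Un:
  fixes S T :: "'a::euclidean_space set"
  assumes S: "controlled p G w B S" and T: "controlled p G w B T"
    and [measurable]: "S \<in> sets borel" "T \<in> sets borel"
  shows "controlled p G w B (S \<union> T)"
proof -
  obtain C1 where C1: "0 \<le> C1" "\<And>(u :: 'a \<Rightarrow> 'a) h. upper_gradient G u h \<Longrightarrow> Lp_mass p G u < \<infinity> \<Longrightarrow>
        Lp_mass p S u \<le> ennreal C1 * (Lp_mass p B u + Lp_mass p G (\<lambda>x. w x * h x))"
    using S by (rule controlledE) blast
  obtain C2 where C2: "0 \<le> C2" "\<And>(u :: 'a \<Rightarrow> 'a) h. upper_gradient G u h \<Longrightarrow> Lp_mass p G u < \<infinity> \<Longrightarrow>
        Lp_mass p T u \<le> ennreal C2 * (Lp_mass p B u + Lp_mass p G (\<lambda>x. w x * h x))"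
    using T by (rule controlledE) blast
  show ?thesis unfolding controlled_def
  proof (intro exI[of _ "C1 + C2"] conjI allI impI)
    fix u :: "'a \<Rightarrow> 'a" and h assume u: "upper_gradient G u h" "Lp_mass p G u < \<infinity>"
    have [measurable]: "u \<in> borel_measurable borel" using u by (auto simp: upper_gradient_def)
    have "Lp_mass p (S \<union> T) u \<le> Lp_mass p S u + Lp_mass p T u" by (rule Lp_mass_Un_le) measurable
    also have "\<dots> \<le> ennreal C1 * (Lp_mass p B u + Lp_mass p G (\<lambda>x. w x * h x)) + ennreal C2 * (Lp_mass p B u + Lp_mass p G (\<lambda>x. w x * h x))"
      using C1(2)[OF u] C2(2)[OF u] by (rule add_mono)
    also have "\<dots> = ennreal (C1 + C2) * (Lp_mass p B u + Lp_mass p G (\<lambda>x. w x * h x))"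
      using C1(1) C2(1) by (simp only: distrib_right ennreal_plus)
    finally show "Lp_mass p (S \<union> T) u \<le> ennreal (C1 + C2) * (Lp_mass p B u + Lp_mass p G (\<lambda>x. w x * h x))" .
  qed (use C1 C2 in auto)
qed

lemma controlled_Union:
  assumes "finite \<F>" "\<And>S. S \<in> \<F> \<Longrightarrow> controlled p G w B S \<and> S \<in> sets borel"
  shows "controlled p G w B (\<Union>\<F>)"
  using assms
proof (induction \<F>)
  case empty
  show ?case by (auto simp: controlled_def Lp_mass_def intro!: exI[of _ 0])
next
  case (insert S \<F>)
  have "\<Union>\<F> \<in> sets borel" using insert by auto
  then show ?case using insert by (auto intro!: controlled_Un)
qed

text \<open>On \<open>T\<close> the function is its value on the shifted set \<open>S\<close> plus
  an increment, and the increment is paid for by the gradient on \<open>K\<close>, where the weight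
  is at least \<open>m\<close>.\<close>

lemma controlled_shift:
  fixes S T K :: "'a::euclidean_space set"
  assumes p: "1 \<le> p" and S: "controlled p G w B S"
    and [measurable]: "S \<in> sets borel" "K \<in> sets borel" "w \<in> borel_measurable borel"
    and KG: "K \<subseteq> G" and m: "m > 0" "\<And>x. x \<in> K \<Longrightarrow> m \<le> w x"
    and T: "\<And>y. y \<in> T \<Longrightarrow> y - \<xi> \<in> S"
    and SK: "\<And>x t. x \<in> S \<Longrightarrow> 0 \<le> t \<Longrightarrow> t \<le> 1 \<Longrightarrow> x + t *\<^sub>R \<xi> \<in> K"
  shows "controlled p G w B T"
proof -
  obtain C where C: "0 \<le> C" "\<And>(u :: 'a \<Rightarrow> 'a) h. upper_gradient G u h \<Longrightarrow> Lp_mass p G u < \<infinity> \<Longrightarrow>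
        Lp_mass p S u \<le> ennreal C * (Lp_mass p B u + Lp_mass p G (\<lambda>x. w x * h x))"
    using S by (rule controlledE) blast
  define C' where "C' = 2 powr p * (norm \<xi> powr p * (1 / m) powr p + C)"
  show ?thesis unfolding controlled_def
  proof (intro exI[of _ C'] conjI allI impI)
    show "0 \<le> C'" using C m by (simp add: C'_def)
    fix u :: "'a \<Rightarrow> 'a" and h assume u: "upper_gradient G u h" "Lp_mass p G u < \<infinity>"
    have [measurable]: "u \<in> borel_measurable borel" "h \<in> borel_measurable borel" and h0: "\<And>x. 0 \<le> h x"
      using u by (auto simp: upper_gradient_def)
    define E where "E = Lp_mass p B u + Lp_mass p G (\<lambda>x. w x * h x)"
    have "Lp_mass p K h \<le> ennreal ((1 / m) powr p) * Lp_mass p K (\<lambda>x. w x * h x)"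
    proof (rule Lp_mass_cmult_bound)
      fix x assume "x \<in> K"
      then have "m \<le> w x" by (rule m)
      then have "m * h x \<le> w x * h x" "0 \<le> w x" using h0[of x] m(1) by (auto intro: mult_right_mono)
      then show "x \<in> K \<and> norm (h x) \<le> 1 / m * norm (w x * h x)"
        using m(1) h0[of x] \<open>x \<in> K\<close> by (simp add: field_simps abs_mult)
    qed (use p m in auto)
    also have "\<dots> \<le> ennreal ((1 / m) powr p) * E"
      unfolding E_def using Lp_mass_subset[OF KG, of p "\<lambda>x. w x * h x"]
      by (intro mult_left_mono) (auto intro: add_increasing)
    finally have K: "Lp_mass p K h \<le> ennreal ((1 / m) powr p) * E" .
    have "Lp_mass p T u \<le> Lp_mass p S (\<lambda>x. u (x + \<xi>))"
      by (rule Lp_mass_le_shift) (use T in auto)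
    also have "\<dots> \<le> ennreal (2 powr p) * (Lp_mass p S (\<lambda>x. u (x + \<xi>) - u x) + Lp_mass p S u)"
    proof (rule Lp_mass_add_le[OF p])
      show "norm (u (x + \<xi>)) \<le> norm (u (x + \<xi>) - u x) + norm (u x)" for x
        using norm_triangle_sub[of "u (x + \<xi>)" "u x"] by simp
    qed measurable
    also have "\<dots> \<le> ennreal (2 powr p) * (ennreal (norm \<xi> powr p) * (ennreal ((1 / m) powr p) * E) + ennreal C * E)"
    proof (intro mult_left_mono add_mono)
      show "Lp_mass p S (\<lambda>x. u (x + \<xi>) - u x) \<le> ennreal (norm \<xi> powr p) * (ennreal ((1 / m) powr p) * E)"
        by (rule order_trans[OF Lp_mass_increment_le[OF u(1) p, of S K \<xi>]]) (use KG SK K in \<open>auto intro: mult_left_mono\<close>)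
      show "Lp_mass p S u \<le> ennreal C * E" unfolding E_def by (rule C(2)[OF u])
    qed auto
    also have "\<dots> = ennreal C' * E"
      using C m unfolding C'_def by (simp add: ennreal_mult ennreal_plus distrib_left distrib_right mult.assoc)
    finally show "Lp_mass p T u \<le> ennreal C' * (Lp_mass p B u + Lp_mass p G (\<lambda>x. w x * h x))" unfolding E_def .
  qed
qed

text \<open>A connectedness argument: the points of \<open>G\<close> that have a controlled ball
  form an open set \<open>X\<close>, and so do the others, because a controlled ball centred near
  \<open>y\<close> can be translated to \<open>y\<close> inside \<open>G\<close>. Hence
  \<open>X = G\<close>, and finitely many controlled balls cover \<open>K\<close>.\<close>

lemma controlled_compact:
  fixes G K :: "'a::euclidean_space set"
  assumes p: "1 \<le> p" and G: "open G" "connected G"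
    and w[measurable]: "w \<in> borel_measurable borel"
    and wpos: "\<And>K. compact K \<Longrightarrow> K \<subseteq> G \<Longrightarrow> \<exists>m>0. \<forall>x\<in>K. m \<le> w x"
    and r0: "r0 > 0" and x0: "x0 \<in> G" and K: "compact K" "K \<subseteq> G"
  shows "controlled p G w (ball x0 r0) K"
proof -
  let ?c = "controlled p G w (ball x0 r0)"
  define X where "X = {x \<in> G. \<exists>r>0. ?c (ball x r)}"
  have oX: "open X"
  proof (rule openI)
    fix x assume "x \<in> X"
    then obtain r where r: "r > 0" "?c (ball x r)" "x \<in> G" by (auto simp: X_def)
    obtain s where s: "s > 0" "ball x s \<subseteq> G" using G r by (meson openE)
    have "y \<in> X" if "y \<in> ball x (min r s)" for y
    proof -
      have "ball y (r - dist x y) \<subseteq> ball x r"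
      proof
        fix z assume "z \<in> ball y (r - dist x y)"
        then show "z \<in> ball x r" using dist_triangle[of x z y] by auto
      qed
      then have "?c (ball y (r - dist x y))" by (rule controlled_mono[OF r(2)])
      then show ?thesis using that s by (auto simp: X_def intro!: exI[of _ "r - dist x y"])
    qed
    then show "\<exists>T>0. ball x T \<subseteq> X" using r s by (intro exI[of _ "min r s"]) auto
  qed
  have oGX: "open (G - X)"
  proof (rule openI)
    fix y assume y: "y \<in> G - X"
    \<comment> \<open>Three radii: the moved ball has radius at most \<open>\<rho>\<close>, its
      centre is within \<open>\<rho>\<close> of \<open>y\<close>, and the translation is shorter
      than \<open>\<rho>\<close>.\<close>
    then obtain \<rho> where \<rho>: "\<rho> > 0" "cball y (3 * \<rho>) \<subseteq> G"
    proof -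
      obtain e where "e > 0" "cball y e \<subseteq> G" using G y by (meson DiffD1 open_contains_cball)
      then show ?thesis using that[of "e / 3"] by auto
    qed
    have "z \<notin> X" if z: "z \<in> ball y \<rho>" for z
    proof
      assume "z \<in> X"
      then obtain r where r: "r > 0" "?c (ball z r)" by (auto simp: X_def)
      define r' where "r' = min r \<rho>"
      have c: "?c (ball z r')" by (rule controlled_mono[OF r(2)]) (auto simp: r'_def)
      obtain m where m: "m > 0" "\<And>x. x \<in> cball y (3 * \<rho>) \<Longrightarrow> m \<le> w x"
        using wpos[OF _ \<rho>(2)] by auto
      have "?c (ball y r')"
      proof (rule controlled_shift[OF p c _ _ w \<rho>(2) m(1) m(2), where \<xi>="y - z"])
        show "x - (y - z) \<in> ball z r'" if "x \<in> ball y r'" for x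
          using that by (simp add: dist_norm norm_minus_commute algebra_simps)
        fix x t assume xt: "x \<in> ball z r'" "0 \<le> t" "t \<le> (1::real)"
        have "norm (x + t *\<^sub>R (y - z) - y) = norm ((x - z) + ((z - y) + t *\<^sub>R (y - z)))"
          by (rule arg_cong[of _ _ norm]) simp
        also have "\<dots> \<le> norm (x - z) + (norm (z - y) + norm (t *\<^sub>R (y - z)))"
          by (intro order_trans[OF norm_triangle_ineq] add_left_mono norm_triangle_ineq)
        also have "\<dots> \<le> \<rho> + (\<rho> + 1 * norm (y - z))"
          using xt z by (intro add_mono) (auto simp: r'_def dist_norm norm_minus_commute mult_left_le_one_le intro: less_imp_le)
        also have "\<dots> \<le> 3 * \<rho>" using z by (simp add: dist_norm)
        finally show "x + t *\<^sub>R (y - z) \<in> cball y (3 * \<rho>)" by (simp add: dist_norm norm_minus_commute)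
      qed auto
      then show False using y r \<rho> by (auto simp: X_def r'_def)
    qed
    moreover have "ball y \<rho> \<subseteq> G"
    proof -
      have "ball y \<rho> \<subseteq> cball y (3 * \<rho>)" using \<rho>(1) by auto
      then show ?thesis using \<rho>(2) by blast
    qed
    ultimately show "\<exists>T>0. ball y T \<subseteq> G - X" using \<rho> by (intro exI[of _ \<rho>]) auto
  qed
  have "?c (ball x0 r0)"
    unfolding controlled_def by (intro exI[of _ 1]) (auto simp: add_increasing2)
  then have "x0 \<in> X" using r0 x0 by (auto simp: X_def)
  have "X \<inter> G = {} \<or> (G - X) \<inter> G = {}"
    using connectedD[OF G(2) oX oGX] by auto
  then have XG: "G \<subseteq> X" using \<open>x0 \<in> X\<close> x0 by auto
  then have "\<forall>x\<in>K. \<exists>r>0. ?c (ball x r)" using K by (auto simp: X_def)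
  then obtain r where r: "\<And>x. x \<in> K \<Longrightarrow> r x > 0 \<and> ?c (ball x (r x))" by metis
  have "K \<subseteq> (\<Union>x\<in>K. ball x (r x))" using r by auto
  then obtain F where F: "F \<subseteq> K" "finite F" "K \<subseteq> (\<Union>x\<in>F. ball x (r x))"
    using compactE_image[OF K(1), of K "\<lambda>x. ball x (r x)"] by auto
  have "?c (\<Union>((\<lambda>x. ball x (r x)) ` F))"
    using F r by (intro controlled_Union) auto
  then show ?thesis using F(3) by (rule controlled_mono)
qed

section \<open>Hardy's inequality in a collar\<close>

lemma Lp_mass_emeasure:
  fixes f :: "'a::euclidean_space \<Rightarrow> 'b::{real_normed_vector, second_countable_topology}"
  assumes [measurable]: "S \<in> sets borel" "f \<in> borel_measurable borel"
  shows "Lp_mass p S f = emeasure (density lborel (\<lambda>x. ennreal (norm (f x) powr p))) S"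
  unfolding Lp_mass_def by (subst emeasure_density) auto

text \<open>Dyadic layers of depth: layer \<open>k\<close> is
  \<open>2H/2^(k+1) \<le> \<tau> < 2H/2^k\<close>. Layer 0 is the controlled base, and the masses of
  the others decay geometrically up to gradient terms whose sum stays bounded.\<close>

lemma controlled_collar:
  fixes G D :: "'a::euclidean_space set" and \<tau> w :: "'a \<Rightarrow> real"
  assumes p: "1 \<le> p" and e: "norm e = 1"
    and D: "\<And>x s. x \<in> D \<Longrightarrow> x + s *\<^sub>R e \<in> D"
    and \<tau>: "\<And>x s. x \<in> D \<Longrightarrow> \<tau> (x + s *\<^sub>R e) = \<tau> x - s"
    and meas[measurable]: "\<And>a b. {x \<in> D. a \<le> \<tau> x \<and> \<tau> x < b} \<in> sets borel"
    and H: "0 < H" and c: "0 < c" and w[measurable]: "w \<in> borel_measurable borel"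
    and G[measurable]: "open G"
    and DG: "\<And>x. x \<in> D \<Longrightarrow> 0 < \<tau> x \<Longrightarrow> \<tau> x < 2 * H \<Longrightarrow> x \<in> G \<and> \<tau> x \<le> c * w x"
    and base: "controlled p G w B {x \<in> D. H \<le> \<tau> x \<and> \<tau> x < 2 * H}"
  shows "controlled p G w B {x \<in> D. 0 < \<tau> x \<and> \<tau> x < H}"
proof -
  define L where "L = (\<lambda>a b. {x \<in> D. a \<le> \<tau> x \<and> \<tau> x < b})"
  have Lm[measurable]: "L a b \<in> sets borel" for a b unfolding L_def by (rule meas)
  obtain C1 where C1: "0 < C1" "\<And>a b. 0 \<le> a \<Longrightarrow> 0 \<le> b \<Longrightarrow> (a + b) powr p \<le> 3/2 * a powr p + C1 * b powr p"
    using powr_add_le_three_halves[OF p] by metis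
  obtain C0 where C0: "0 \<le> C0" "\<And>(u :: 'a \<Rightarrow> 'a) h. upper_gradient G u h \<Longrightarrow> Lp_mass p G u < \<infinity> \<Longrightarrow>
        Lp_mass p (L H (2 * H)) u \<le> ennreal C0 * (Lp_mass p B u + Lp_mass p G (\<lambda>x. w x * h x))"
    using base unfolding L_def by (rule controlledE) blast
  define K where "K = C1 * (2 * c) powr p"
  have K0: "0 \<le> K" using C1 by (simp add: K_def)
  show ?thesis unfolding controlled_def
  proof (intro exI[of _ "4 * C0 + 8 * K"] conjI allI impI)
    show "0 \<le> 4 * C0 + 8 * K" using C0 K0 by simp
    fix u :: "'a \<Rightarrow> 'a" and h assume u: "upper_gradient G u h" "Lp_mass p G u < \<infinity>"
    have [measurable]: "u \<in> borel_measurable borel" "h \<in> borel_measurable borel" and h0: "\<And>x. 0 \<le> h x"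
      using u by (auto simp: upper_gradient_def)
    define E where "E = Lp_mass p G (\<lambda>x. w x * h x)"
    \<comment> \<open>Compares \<open>u x\<close> with its value at the point deeper by
      \<open>s\<close>. For \<open>s \<le> 2 * a\<close> the connecting segment keeps to depths
      between \<open>a\<close> and \<open>4 * a\<close>.\<close>
    have shift: "Lp_mass p (L a (2 * a)) u \<le> ennreal (3/2) * Lp_mass p (L (a + s) (2 * a + s)) u
        + ennreal K * Lp_mass p (L a (4 * a)) (\<lambda>x. w x * h x)"
      if a: "0 < a" "4 * a \<le> 2 * H" and s: "0 \<le> s" "s \<le> 2 * a" for a s
    proof -
      have LG: "x \<in> G \<and> \<tau> x \<le> c * w x" if "x \<in> L a (4 * a)" for x
        using DG[of x] that a by (auto simp: L_def)
      have "Lp_mass p (L a (2 * a)) u \<le> (\<integral>\<^sup>+x. ennreal (3/2) * (ennreal (norm (u (x + (- s) *\<^sub>R e)) powr p) * indicator (L a (2 * a)) x)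
         + ennreal C1 * (ennreal (norm (u (x + (- s) *\<^sub>R e) - u x) powr p) * indicator (L a (2 * a)) x) \<partial>lborel)"
        unfolding Lp_mass_def
      proof (intro nn_integral_mono)
        fix x
        have "norm (u x) powr p \<le> (norm (u (x + (- s) *\<^sub>R e)) + norm (u (x + (- s) *\<^sub>R e) - u x)) powr p"
          using p norm_triangle_sub[of "u x" "u (x + (- s) *\<^sub>R e)"] by (intro powr_mono2) (auto simp: norm_minus_commute)
        also have "\<dots> \<le> 3/2 * norm (u (x + (- s) *\<^sub>R e)) powr p + C1 * norm (u (x + (- s) *\<^sub>R e) - u x) powr p"
          by (rule C1) auto
        finally have "ennreal (norm (u x) powr p) \<le> ennreal (3/2 * norm (u (x + (- s) *\<^sub>R e)) powr p + C1 * norm (u (x + (- s) *\<^sub>R e) - u x) powr p)"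
          by (rule ennreal_leI)
        also have "\<dots> = ennreal (3/2) * ennreal (norm (u (x + (- s) *\<^sub>R e)) powr p) + ennreal C1 * ennreal (norm (u (x + (- s) *\<^sub>R e) - u x) powr p)"
          using C1 by (subst ennreal_plus) (simp_all only: ennreal_mult powr_ge_zero mult_nonneg_nonneg less_imp_le divide_nonneg_nonneg zero_le_numeral)
        finally show "ennreal (norm (u x) powr p) * indicator (L a (2 * a)) x \<le> ennreal (3/2) * (ennreal (norm (u (x + (- s) *\<^sub>R e)) powr p) * indicator (L a (2 * a)) x)
         + ennreal C1 * (ennreal (norm (u (x + (- s) *\<^sub>R e) - u x) powr p) * indicator (L a (2 * a)) x)"
          by (cases "x \<in> L a (2 * a)") (simp_all only: indicator_simps mult_1_right mult_zero_right zero_le not_False_eq_True)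
      qed
      also have "\<dots> = ennreal (3/2) * Lp_mass p (L a (2 * a)) (\<lambda>x. u (x + (- s) *\<^sub>R e))
         + ennreal C1 * Lp_mass p (L a (2 * a)) (\<lambda>x. u (x + (- s) *\<^sub>R e) - u x)"
        unfolding Lp_mass_def by (subst nn_integral_add, measurable, subst (1 2) nn_integral_cmult, measurable)
      also have "\<dots> \<le> ennreal (3/2) * Lp_mass p (L (a + s) (2 * a + s)) u
        + ennreal C1 * (ennreal ((2 * c) powr p) * Lp_mass p (L a (4 * a)) (\<lambda>x. w x * h x))"
      proof (intro add_mono mult_left_mono)
        show "Lp_mass p (L a (2 * a)) (\<lambda>x. u (x + (- s) *\<^sub>R e)) \<le> Lp_mass p (L (a + s) (2 * a + s)) u"
        proof (rule Lp_mass_shift_le)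
          fix x assume "x \<in> L a (2 * a)"
          then show "x + (- s) *\<^sub>R e \<in> L (a + s) (2 * a + s)"
            using D[of x "- s"] \<tau>[of x "- s"] by (auto simp: L_def)
        qed measurable
        have "Lp_mass p (L a (2 * a)) (\<lambda>x. u (x + (- s) *\<^sub>R e) - u x) \<le> ennreal (norm ((- s) *\<^sub>R e) powr p) * Lp_mass p (L a (4 * a)) h"
        proof (rule Lp_mass_increment_le[OF u(1) p])
          show "L a (4 * a) \<subseteq> G" using LG by auto
          fix x t assume x: "x \<in> L a (2 * a)" and t: "0 \<le> t" "t \<le> (1::real)"
          have "t * s \<le> 1 * (2 * a)" using t s by (intro mult_mono) auto
          moreover have "0 \<le> t * s" using t s by simp
          ultimately show "x + t *\<^sub>R (- s) *\<^sub>R e \<in> L a (4 * a)"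
            using D[of x "- (t * s)"] \<tau>[of x "- (t * s)"] x by (auto simp: L_def)
        qed measurable
        also have "\<dots> \<le> ennreal ((2 * a) powr p) * (ennreal ((c / a) powr p) * Lp_mass p (L a (4 * a)) (\<lambda>x. w x * h x))"
        proof (intro mult_mono)
          show "ennreal (norm ((- s) *\<^sub>R e) powr p) \<le> ennreal ((2 * a) powr p)"
            using e s p by (intro ennreal_leI powr_mono2) auto
          show "Lp_mass p (L a (4 * a)) h \<le> ennreal ((c / a) powr p) * Lp_mass p (L a (4 * a)) (\<lambda>x. w x * h x)"
          proof (rule Lp_mass_cmult_bound)
            fix x assume x: "x \<in> L a (4 * a)"
            have "a \<le> c * w x" using LG[OF x] x by (auto simp: L_def)
            then have "a * h x \<le> c * w x * h x" using h0 by (intro mult_right_mono) auto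
            moreover have "0 \<le> w x" using \<open>a \<le> c * w x\<close> c a by (smt (verit) mult_pos_neg)
            ultimately show "x \<in> L a (4 * a) \<and> norm (h x) \<le> c / a * norm (w x * h x)"
              using x a c h0[of x] by (simp add: field_simps abs_mult)
          qed (use p c a in auto)
        qed auto
        also have "\<dots> = ennreal ((2 * c) powr p) * Lp_mass p (L a (4 * a)) (\<lambda>x. w x * h x)"
        proof -
          \<comment> \<open>The scale \<open>a\<close> cancels: the length of the shift is at most
            \<open>2 * a\<close>, the reciprocal of the weight at most \<open>c / a\<close>. One
            constant therefore serves all layers.\<close>
          have "(2 * a) powr p * (c / a) powr p = (2 * c) powr p"
            using a by (simp add: powr_mult[symmetric])
          then show ?thesis by (simp add: mult.assoc[symmetric] ennreal_mult[symmetric])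
        qed
        finally show "Lp_mass p (L a (2 * a)) (\<lambda>x. u (x + (- s) *\<^sub>R e) - u x)
          \<le> ennreal ((2 * c) powr p) * Lp_mass p (L a (4 * a)) (\<lambda>x. w x * h x)" .
      qed auto
      finally show ?thesis using C1 by (simp add: K_def ennreal_mult mult.assoc)
    qed
    have split: "Lp_mass p (L a b) f + Lp_mass p (L b b') f = Lp_mass p (L a b') f"
      if "a \<le> b" "b \<le> b'" and [measurable]: "f \<in> borel_measurable borel" for a b b' and f :: "'a \<Rightarrow> 'b::{real_normed_vector, second_countable_topology}"
    proof -
      have "L a b \<union> L b b' = L a b'" "L a b \<inter> L b b' = {}" using that by (auto simp: L_def)
      then show ?thesis using Lp_mass_disjoint_Un[of "L a b" "L b b'" f p] by simp
    qed
    define m where "m = (\<lambda>k. Lp_mass p (L (2 * H / 2 ^ Suc k) (2 * H / 2 ^ k)) u)"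
    define r where "r = (\<lambda>k. Lp_mass p (L (2 * H / 2 ^ Suc k) (2 * H / 2 ^ k)) (\<lambda>x. w x * h x))"
    \<comment> \<open>For the layer of depths in \<open>[a, 2a)\<close> the shifts by
      \<open>a\<close> and by \<open>2a\<close> have images in \<open>[2a, 3a)\<close> and
      \<open>[3a, 4a)\<close>, which together make up the layer \<open>[2a, 4a)\<close>. Adding both
      estimates gives the ratio \<open>3/4\<close>; the doubled form avoids fractions.\<close>
    have step: "4 * m (Suc k) \<le> 3 * m k + ennreal (4 * K) * (r (Suc k) + r k)" for k
    proof -
      define a where "a = 2 * H / 2 ^ Suc (Suc k)"
      have a0: "0 < a" using H by (simp add: a_def)
      have a1: "2 * a = 2 * H / 2 ^ Suc k" and a2: "4 * a = 2 * H / 2 ^ k" by (simp_all add: a_def)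
      have a3: "4 * a \<le> 2 * H" unfolding a2 using H by (simp add: field_simps)
      have M: "m (Suc k) = Lp_mass p (L a (2 * a)) u" "m k = Lp_mass p (L (2 * a) (4 * a)) u"
        unfolding m_def a1 a2 a_def[symmetric] by (rule refl)+
      have R': "r (Suc k) = Lp_mass p (L a (2 * a)) (\<lambda>x. w x * h x)" "r k = Lp_mass p (L (2 * a) (4 * a)) (\<lambda>x. w x * h x)"
        unfolding r_def a1 a2 a_def[symmetric] by (rule refl)+
      have R: "r (Suc k) + r k = Lp_mass p (L a (4 * a)) (\<lambda>x. w x * h x)"
        unfolding R' by (rule split) (use a0 in auto)
      have "m (Suc k) + m (Suc k) \<le>
        (ennreal (3/2) * Lp_mass p (L (2 * a) (3 * a)) u + ennreal K * (r (Suc k) + r k))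
        + (ennreal (3/2) * Lp_mass p (L (3 * a) (4 * a)) u + ennreal K * (r (Suc k) + r k))"
        unfolding M R using shift[OF a0 a3, of a] shift[OF a0 a3, of "2 * a"] a0 by (intro add_mono) auto
      also have "\<dots> = ennreal (3/2) * m k + ennreal (2 * K) * (r (Suc k) + r k)"
        using split[of "2 * a" "3 * a" "4 * a" u] a0 K0 unfolding M
        by (simp add: distrib_left[symmetric] mult_2[symmetric] ennreal_mult ac_simps add.assoc[symmetric])
      finally have 1: "m (Suc k) + m (Suc k) \<le> ennreal (3/2) * m k + ennreal (2 * K) * (r (Suc k) + r k)" .
      have "4 * m (Suc k) = 2 * (m (Suc k) + m (Suc k))" by (simp add: mult_2[symmetric] mult.assoc[symmetric])
      also have "\<dots> \<le> 2 * (ennreal (3/2) * m k + ennreal (2 * K) * (r (Suc k) + r k))" by (intro mult_left_mono 1) simp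
      also have "\<dots> = (2 * ennreal (3/2)) * m k + (2 * ennreal (2 * K)) * (r (Suc k) + r k)"
        by (simp add: distrib_left mult.assoc)
      also have "2 * ennreal (3/2) = 3"
        using ennreal_mult[of 2 "3/2"] by simp
      also have "2 * ennreal (2 * K) = ennreal (4 * K)"
        using ennreal_mult[of 2 "2 * K"] K0 by simp
      finally show ?thesis .
    qed
    have tel: "(\<Sum>k<n. Lp_mass p (L (2 * H / 2 ^ Suc k) (2 * H / 2 ^ k)) f) = Lp_mass p (L (2 * H / 2 ^ n) (2 * H)) f"
      if [measurable]: "f \<in> borel_measurable borel" for n and f :: "'a \<Rightarrow> 'b::{real_normed_vector, second_countable_topology}"
    proof (induction n)
      case 0
      have "L (2 * H) (2 * H) = {}" by (auto simp: L_def)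
      then show ?case by (simp add: Lp_mass_def)
    next
      case (Suc n)
      have "(1::real) \<le> 2 ^ n" by simp
      then have "2 * H / 2 ^ Suc n \<le> 2 * H / 2 ^ n" "2 * H / 2 ^ n \<le> 2 * H" using H
        by (auto simp: field_simps)
      from split[OF this, of f] show ?case using Suc by (simp add: add.commute)
    qed
    have sr: "(\<Sum>k<n. r k) \<le> E" for n
    proof -
      have "L (2 * H / 2 ^ n) (2 * H) \<subseteq> G" using DG H by (force simp: L_def intro: order_less_le_trans[of 0 "2 * H / 2 ^ n"])
      then show ?thesis unfolding r_def E_def by (subst tel) (auto intro: Lp_mass_subset)
    qed
    have fin: "(\<Sum>k<n. m k) < \<infinity>" for n
    proof -
      have "L (2 * H / 2 ^ n) (2 * H) \<subseteq> G" using DG H by (force simp: L_def intro: order_less_le_trans[of 0 "2 * H / 2 ^ n"])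
      then show ?thesis unfolding m_def using u(2) by (subst tel) (auto intro: le_less_trans[OF Lp_mass_subset])
    qed
    \<comment> \<open>Summing \<open>step\<close> bounds four times the partial sum by three times
      itself plus the desired right-hand side, so that one copy survives the cancellation.\<close>
    have P: "(\<Sum>k<Suc n. m k) \<le> 4 * m 0 + ennreal (8 * K) * E" for n
    proof -
      let ?P = "\<Sum>k<Suc n. m k"
      have four: "4 * x = 3 * x + x" for x :: ennreal using distrib_right[of 3 1 x] by simp
      have "3 * ?P + ?P = 4 * ?P" by (rule four[symmetric])
      also have "4 * ?P = 4 * m 0 + (\<Sum>k<n. 4 * m (Suc k))"
        by (simp only: sum.lessThan_Suc_shift distrib_left sum_distrib_left)
      also have "\<dots> \<le> 4 * m 0 + (\<Sum>k<n. 3 * m k + ennreal (4 * K) * (r (Suc k) + r k))"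
        by (intro add_left_mono sum_mono step)
      also have "\<dots> = 4 * m 0 + (3 * (\<Sum>k<n. m k) + ennreal (4 * K) * ((\<Sum>k<n. r (Suc k)) + (\<Sum>k<n. r k)))"
        by (simp only: sum.distrib sum_distrib_left distrib_left)
      also have "\<dots> \<le> 4 * m 0 + (3 * ?P + ennreal (4 * K) * (E + E))"
      proof (intro add_left_mono add_mono mult_left_mono sr)
        show "(\<Sum>k<n. m k) \<le> ?P" by (rule sum_mono2) auto
        have "(\<Sum>k<n. r (Suc k)) \<le> (\<Sum>k<Suc n. r k)" by (simp only: sum.lessThan_Suc_shift) (simp add: add_increasing)
        then show "(\<Sum>k<n. r (Suc k)) \<le> E" using sr by (rule order_trans)
      qed auto
      also have "\<dots> = 3 * ?P + (4 * m 0 + ennreal (8 * K) * E)"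
      proof -
        have "ennreal (4 * K) * (E + E) = ennreal (8 * K) * E"
          using K0 ennreal_mult[of "4 * K" 2] by (simp add: mult_2[symmetric] mult.assoc[symmetric])
        then show ?thesis by (simp only: ac_simps)
      qed
      finally have "3 * ?P + ?P \<le> 3 * ?P + (4 * m 0 + ennreal (8 * K) * E)"
        .
      \<comment> \<open>Cancellation in \<open>ennreal\<close> requires a finite term; finiteness
        comes from the assumption on the mass of \<open>u\<close> over \<open>G\<close>.\<close>
      moreover have "3 * ?P \<noteq> \<infinity>" using fin[of "Suc n"] by (auto simp: ennreal_mult_eq_top_iff less_top[symmetric])
      ultimately show ?thesis using ennreal_add_left_cancel_le by blast
    qed
    have "Lp_mass p {x \<in> D. 0 < \<tau> x \<and> \<tau> x < H} u \<le> Lp_mass p (\<Union>n. L (2 * H / 2 ^ Suc n) (2 * H)) u"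
    proof (rule Lp_mass_subset, safe)
      fix x assume x: "x \<in> D" "0 < \<tau> x" "\<tau> x < H"
      obtain n where "(1/2) ^ n < \<tau> x / H" using real_arch_pow_inv[of "\<tau> x / H" "1/2"] x H by auto
      then have "2 * H / 2 ^ Suc n \<le> \<tau> x" using H by (simp add: field_simps)
      then show "x \<in> (\<Union>n. L (2 * H / 2 ^ Suc n) (2 * H))" using x H by (auto simp: L_def intro!: exI[of _ n])
    qed
    also have "\<dots> = (SUP n. Lp_mass p (L (2 * H / 2 ^ Suc n) (2 * H)) u)"
    proof -
      have "incseq (\<lambda>n. L (2 * H / 2 ^ Suc n) (2 * H))"
      proof (rule incseq_SucI)
        fix n
        have "2 * H / 2 ^ Suc (Suc n) \<le> 2 * H / 2 ^ Suc n" using H by (simp add: field_simps)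
        then show "L (2 * H / 2 ^ Suc n) (2 * H) \<le> L (2 * H / 2 ^ Suc (Suc n)) (2 * H)" by (auto simp: L_def)
      qed
      then show ?thesis
        by (subst (1 2) Lp_mass_emeasure, measurable) (subst SUP_emeasure_incseq, auto)
    qed
    also have "\<dots> \<le> 4 * m 0 + ennreal (8 * K) * E"
    proof (rule SUP_least)
      fix n show "Lp_mass p (L (2 * H / 2 ^ Suc n) (2 * H)) u \<le> 4 * m 0 + ennreal (8 * K) * E"
        using P[of n] unfolding m_def by (subst (asm) tel) auto
    qed
    also have "\<dots> \<le> 4 * (ennreal C0 * (Lp_mass p B u + E)) + ennreal (8 * K) * (Lp_mass p B u + E)"
    proof (intro add_mono mult_left_mono)
      show "m 0 \<le> ennreal C0 * (Lp_mass p B u + E)" using C0(2)[OF u] by (simp add: m_def E_def)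
    qed (auto simp: add_increasing)
    also have "\<dots> = ennreal (4 * C0 + 8 * K) * (Lp_mass p B u + E)"
      using C0(1) K0 by (simp add: ennreal_plus ennreal_mult distrib_right mult.assoc)
    finally show "Lp_mass p {x \<in> D. 0 < \<tau> x \<and> \<tau> x < H} u \<le> ennreal (4 * C0 + 8 * K) * (Lp_mass p B u + Lp_mass p G (\<lambda>x. w x * h x))"
      unfolding E_def .
  qed
qed

text \<open>An averaging argument. The mass of \<open>u - u y\<close>, integrated over
  \<open>y\<close> in the ball, is a double integral; substituting \<open>\<xi> = x - y\<close>
  turns it into increments by vectors shorter than \<open>2 * r\<close>, each bounded by the
  gradient. So points \<open>y\<close> at which the mass is at most twice the bound for the mean
  form a set that is not null, and almost all of them satisfy \<open>P\<close>.\<close>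

lemma ball_increment_point:
  fixes u :: "'a::euclidean_space \<Rightarrow> 'b::{real_normed_vector, second_countable_topology}"
  assumes ug: "upper_gradient G u h" and p: "1 \<le> p" and r: "0 < r" and BG: "ball x0 r \<subseteq> G"
    and P: "AE x in lborel. x \<in> ball x0 r \<longrightarrow> P x"
  shows "\<exists>y\<in>ball x0 r. P y \<and> Lp_mass p (ball x0 r) (\<lambda>x. u x - u y) \<le>
    ennreal (2 * (2 * r) powr p * measure lborel (ball (0::'a) (2 * r)) / measure lborel (ball x0 r)) * Lp_mass p (ball x0 r) h"
proof -
  have [measurable]: "u \<in> borel_measurable borel" "h \<in> borel_measurable borel" and h0: "\<And>x. 0 \<le> h x"
    using ug by (auto simp: upper_gradient_def)
  define B where "B = ball x0 r"
  have [measurable]: "B \<in> sets borel" by (simp add: B_def)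
  define X where "X = Lp_mass p B h"
  define V1 where "V1 = measure lborel (ball x0 r)"
  define V2 where "V2 = measure lborel (ball (0::'a) (2 * r))"
  have V: "V1 > 0" "V2 > 0" unfolding V1_def V2_def using r content_ball_pos[of r x0] content_ball_pos[of "2 * r" "0::'a"] by auto
  have eV1: "emeasure lborel B = ennreal V1" unfolding B_def V1_def
    using emeasure_bounded_finite[of "ball x0 r"] by (intro emeasure_eq_ennreal_measure) (auto simp: less_top)
  have eV2: "emeasure lborel (ball (0::'a) (2 * r)) = ennreal V2" unfolding V2_def
    using emeasure_bounded_finite[of "ball (0::'a) (2 * r)"] by (intro emeasure_eq_ennreal_measure) (auto simp: less_top)
  define C where "C = 2 * (2 * r) powr p * V2 / V1"
  define \<Phi> where "\<Phi> = (\<lambda>y. Lp_mass p B (\<lambda>x. u x - u y))"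
  have mPhi[measurable]: "\<Phi> \<in> borel_measurable borel" unfolding \<Phi>_def Lp_mass_def by measurable
  define M where "M = ennreal V2 * (ennreal ((2 * r) powr p) * X)"
  have "(\<integral>\<^sup>+y. \<Phi> y * indicator B y \<partial>lborel) = (\<integral>\<^sup>+y. \<integral>\<^sup>+\<xi>. ennreal (norm (u (y + \<xi>) - u y) powr p) * indicator B (y + \<xi>) * indicator B y \<partial>lborel \<partial>lborel)"
  proof (rule nn_integral_cong)
    fix y
    have "\<Phi> y = (\<integral>\<^sup>+\<xi>. ennreal (norm (u (\<xi> + y) - u y) powr p) * indicator B (\<xi> + y) \<partial>lborel)"
      unfolding \<Phi>_def Lp_mass_def
      by (rule nn_integral_lborel_shift[of "\<lambda>x. ennreal (norm (u x - u y) powr p) * indicator B x" y, symmetric]) measurable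
    then show "\<Phi> y * indicator B y = (\<integral>\<^sup>+\<xi>. ennreal (norm (u (y + \<xi>) - u y) powr p) * indicator B (y + \<xi>) * indicator B y \<partial>lborel)"
      by (simp add: nn_integral_multc add.commute)
  qed
  also have "\<dots> = (\<integral>\<^sup>+\<xi>. \<integral>\<^sup>+y. ennreal (norm (u (y + \<xi>) - u y) powr p) * indicator B (y + \<xi>) * indicator B y \<partial>lborel \<partial>lborel)"
    by (rule lborel_pair.Fubini'[symmetric]) measurable
  also have "\<dots> \<le> (\<integral>\<^sup>+\<xi>. (ennreal ((2 * r) powr p) * X) * indicator (ball (0::'a) (2 * r)) \<xi> \<partial>lborel)"
  proof (rule nn_integral_mono)
    fix \<xi> :: 'a
    define S where "S = {y \<in> B. y + \<xi> \<in> B}"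
    have [measurable]: "S \<in> sets borel" unfolding S_def by measurable
    have eq: "(\<integral>\<^sup>+y. ennreal (norm (u (y + \<xi>) - u y) powr p) * indicator B (y + \<xi>) * indicator B y \<partial>lborel) = Lp_mass p S (\<lambda>y. u (y + \<xi>) - u y)"
      unfolding Lp_mass_def by (intro nn_integral_cong) (auto simp: S_def indicator_def)
    show "(\<integral>\<^sup>+y. ennreal (norm (u (y + \<xi>) - u y) powr p) * indicator B (y + \<xi>) * indicator B y \<partial>lborel)
       \<le> (ennreal ((2 * r) powr p) * X) * indicator (ball 0 (2 * r)) \<xi>"
    proof (cases "norm \<xi> < 2 * r")
      case True
      have "Lp_mass p S (\<lambda>y. u (y + \<xi>) - u y) \<le> ennreal (norm \<xi> powr p) * Lp_mass p B h"
      proof (rule Lp_mass_increment_le[OF ug p])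
        fix x t assume x: "x \<in> S" and t: "0 \<le> t" "t \<le> (1::real)"
        have "(1 - t) *\<^sub>R x + t *\<^sub>R (x + \<xi>) \<in> B"
          using x t convexD_alt[OF convex_ball[of x0 r], of x "x + \<xi>" t] by (auto simp: S_def B_def)
        then show "x + t *\<^sub>R \<xi> \<in> B" by (simp add: algebra_simps)
      qed (use BG in \<open>auto simp: B_def[symmetric]\<close>)
      also have "\<dots> \<le> ennreal ((2 * r) powr p) * X"
        unfolding X_def using True p by (intro mult_right_mono ennreal_leI powr_mono2) auto
      finally show ?thesis using True unfolding eq by simp
    next
      case False
      have "S = {}"
      proof (rule equals0I)
        fix y assume "y \<in> S"
        then have "dist x0 y < r" "dist x0 (y + \<xi>) < r" by (auto simp: S_def B_def)
        then have "dist y (y + \<xi>) < 2 * r" using dist_triangle3[of y "y + \<xi>" x0] by linarith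
        then show False using False by (simp add: dist_norm)
      qed
      then show ?thesis unfolding eq by (simp add: Lp_mass_def)
    qed
  qed
  also have "\<dots> = M" unfolding M_def eV2[symmetric]
    by (subst nn_integral_cmult_indicator) (auto simp: mult.commute)
  finally have IM: "(\<integral>\<^sup>+y. \<Phi> y * indicator B y \<partial>lborel) \<le> M" .
  have nonnull: "\<not> (AE y in lborel. y \<notin> B)"
  proof
    assume "AE y in lborel. y \<notin> B"
    then have "emeasure lborel B = 0" by (subst (asm) AE_iff_measurable[of B]) auto
    then show False using eV1 V by simp
  qed
  have "\<exists>y\<in>B. P y \<and> \<Phi> y \<le> ennreal C * X"
  proof (rule ccontr)
    assume neg: "\<not> (\<exists>y\<in>B. P y \<and> \<Phi> y \<le> ennreal C * X)"
    have AEp: "AE y in lborel. y \<in> B \<longrightarrow> ennreal C * X < \<Phi> y"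
      using P by eventually_elim (use neg in \<open>auto simp: B_def not_le\<close>)
    have C0: "C > 0" using V r by (simp add: C_def)
    \<comment> \<open>Nothing exceeds an infinite bound; if \<open>X = 0\<close> then
      \<open>\<Phi>\<close> vanishes almost everywhere on the ball; otherwise the factor 2 in
      \<open>C\<close> would make \<open>\<Phi>\<close> exceed twice an upper bound for its
      mean.\<close>
    consider "X = 0" | "X = \<infinity>" | "0 < X" "X < \<infinity>" by (metis infinity_ennreal_def less_top not_gr_zero)
    then show False
    proof cases
      case 1
      then have "(\<integral>\<^sup>+y. \<Phi> y * indicator B y \<partial>lborel) = 0" using IM by (simp add: M_def)
      then have "AE y in lborel. \<Phi> y * indicator B y = 0" by (subst (asm) nn_integral_0_iff_AE) auto
      with AEp have "AE y in lborel. y \<notin> B" by eventually_elim (auto simp: indicator_def)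
      then show False using nonnull by simp
    next
      case 2
      from AEp have "AE y in lborel. y \<notin> B" by eventually_elim (use C0 2 in \<open>auto simp: ennreal_mult_top\<close>)
      then show False using nonnull by simp
    next
      case 3
      then obtain x where x: "X = ennreal x" "x > 0" by (cases X) auto
      have "ennreal C * X * ennreal V1 = (\<integral>\<^sup>+y. ennreal C * X * indicator B y \<partial>lborel)"
        by (simp add: nn_integral_cmult eV1)
      also have "\<dots> \<le> (\<integral>\<^sup>+y. \<Phi> y * indicator B y \<partial>lborel)"
        using AEp by (intro nn_integral_mono_AE, eventually_elim) (auto simp: indicator_def)
      also have "\<dots> \<le> M" by (rule IM)
      finally have "C * x * V1 \<le> V2 * ((2 * r) powr p * x)"
        using x C0 V r by (simp add: M_def ennreal_mult[symmetric])
      moreover have "C * x * V1 = 2 * (V2 * ((2 * r) powr p * x))" using V by (simp add: C_def)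
      moreover have "V2 * ((2 * r) powr p * x) > 0" using V r x by simp
      ultimately show False by linarith
    qed
  qed
  then show ?thesis unfolding \<Phi>_def X_def C_def V1_def V2_def B_def by blast
qed

section \<open>From a reference ball to the whole domain\<close>

lemma upper_gradient_diff_const:
  "upper_gradient G u h \<Longrightarrow> upper_gradient G (\<lambda>x. u x - c) h"
  unfolding upper_gradient_def by (simp add: borel_measurable_diff)

lemma Lp_mass_const:
  assumes "S \<in> sets borel"
  shows "Lp_mass p S (\<lambda>_. c) = ennreal (norm c powr p) * emeasure lborel S"
  unfolding Lp_mass_def using assms by (simp add: nn_integral_cmult)

text \<open>The data that \<open>controlled_collar\<close> asks for at one boundary point. The set
  \<open>D\<close> is a union of lines in direction \<open>e\<close>, and \<open>\<tau>\<close> is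
  the depth measured along \<open>e\<close>. The layer of depths in \<open>[H, 2H)\<close> sits in a
  compact \<open>K\<close>, so that \<open>controlled_compact\<close> can start the
  iteration.\<close>

definition collar_neighborhood :: "'a::euclidean_space set \<Rightarrow> ('a \<Rightarrow> real) \<Rightarrow> 'a set \<Rightarrow> bool" where
  "collar_neighborhood G w W \<longleftrightarrow>
     (\<exists>e D \<tau> H c K. norm e = 1 \<and> (\<forall>x\<in>D. \<forall>s. x + s *\<^sub>R e \<in> D \<and> \<tau> (x + s *\<^sub>R e) = \<tau> x - s) \<and>
        (\<forall>a b. {x \<in> D. a \<le> \<tau> x \<and> \<tau> x < b} \<in> sets borel) \<and> 0 < H \<and> 0 < c \<and>
        (\<forall>x\<in>D. 0 < \<tau> x \<and> \<tau> x < 2 * H \<longrightarrow> x \<in> G \<and> \<tau> x \<le> c * w x) \<and>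
        compact K \<and> K \<subseteq> G \<and> {x \<in> D. H \<le> \<tau> x \<and> \<tau> x < 2 * H} \<subseteq> K \<and>
        G \<inter> W \<subseteq> {x \<in> D. 0 < \<tau> x \<and> \<tau> x < H})"

text \<open>Finitely many interior balls and collar neighbourhoods cover the compact closure, so
  \<open>G\<close> is controlled by one ball. Applied to \<open>u - u y\<close> with
  \<open>y\<close> from \<open>ball_increment_point\<close>, the ball term becomes a gradient term
  too. Through \<open>P\<close> the value \<open>u y\<close> can later be required to lie in the
  span of the normals.\<close>

theorem improved_poincare:
  fixes G :: "'a::euclidean_space set" and w :: "'a \<Rightarrow> real"
  assumes p: "1 \<le> p" and G: "open G" "connected G" "bounded G" "G \<noteq> {}"
    and w[measurable]: "w \<in> borel_measurable borel"
    and wpos: "\<And>K. compact K \<Longrightarrow> K \<subseteq> G \<Longrightarrow> \<exists>m>0. \<forall>x\<in>K. m \<le> w x"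
    and collar: "\<And>x. x \<in> frontier G \<Longrightarrow> \<exists>W. open W \<and> x \<in> W \<and> collar_neighborhood G w W"
  shows "\<exists>C\<ge>0. \<forall>(u :: 'a \<Rightarrow> 'a) h P. upper_gradient G u h \<longrightarrow> Lp_mass p G u < \<infinity> \<longrightarrow>
    (AE x in lborel. x \<in> G \<longrightarrow> P x) \<longrightarrow>
    (\<exists>y\<in>G. P y \<and> Lp_mass p G (\<lambda>x. u x - u y) \<le> ennreal C * Lp_mass p G (\<lambda>x. w x * h x))"
proof -
  have [measurable]: "G \<in> sets borel" using G by simp
  obtain x0 where x0: "x0 \<in> G" using G by auto
  obtain r where r: "r > 0" "cball x0 r \<subseteq> G" using G(1) x0 by (meson open_contains_cball)
  define B where "B = ball x0 r"
  let ?c = "controlled p G w B"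
  have ck: "?c K" if "compact K" "K \<subseteq> G" for K
    unfolding B_def by (rule controlled_compact[OF p G(1,2) w wpos r(1) x0 that])
  have "\<exists>W. open W \<and> x \<in> W \<and> ?c (G \<inter> W)" if x: "x \<in> closure G" for x
  proof (cases "x \<in> G")
    case True
    obtain s where s: "s > 0" "cball x s \<subseteq> G" using G(1) True by (meson open_contains_cball)
    have "?c (G \<inter> ball x s)" by (rule controlled_mono[OF ck[OF compact_cball s(2)]]) auto
    then show ?thesis using s(1) by (intro exI[of _ "ball x s"]) auto
  next
    case False
    then have "x \<in> frontier G" using x G(1) by (simp add: frontier_def interior_open)
    from collar[OF this] obtain W where W: "open W" "x \<in> W" "collar_neighborhood G w W" by auto
    from W(3)[unfolded collar_neighborhood_def] obtain e D \<tau> H c K where e: "norm e = 1"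
      and D: "\<forall>x\<in>D. \<forall>s. x + s *\<^sub>R e \<in> D \<and> \<tau> (x + s *\<^sub>R e) = \<tau> x - s"
      and meas: "\<forall>a b. {x \<in> D. a \<le> \<tau> x \<and> \<tau> x < b} \<in> sets borel" and H: "0 < H" and c: "0 < c"
      and DG: "\<forall>x\<in>D. 0 < \<tau> x \<and> \<tau> x < 2 * H \<longrightarrow> x \<in> G \<and> \<tau> x \<le> c * w x"
      and K: "compact K" "K \<subseteq> G" "{x \<in> D. H \<le> \<tau> x \<and> \<tau> x < 2 * H} \<subseteq> K"
      and GW: "G \<inter> W \<subseteq> {x \<in> D. 0 < \<tau> x \<and> \<tau> x < H}"
      by (elim exE conjE)
    have "?c {x \<in> D. H \<le> \<tau> x \<and> \<tau> x < 2 * H}"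
      by (rule controlled_mono[OF ck[OF K(1,2)] K(3)])
    then have "?c {x \<in> D. 0 < \<tau> x \<and> \<tau> x < H}"
      using D meas DG by (intro controlled_collar[OF p e _ _ _ H c w G(1)]) auto
    then have "?c (G \<inter> W)" using GW by (rule controlled_mono)
    then show ?thesis using W by auto
  qed
  then obtain W where W: "\<And>x. x \<in> closure G \<Longrightarrow> open (W x) \<and> x \<in> W x \<and> ?c (G \<inter> W x)" by metis
  have "compact (closure G)" using G(3) by (simp add: compact_closure)
  moreover have "closure G \<subseteq> (\<Union>x\<in>closure G. W x)" using W by auto
  ultimately obtain F where F: "F \<subseteq> closure G" "finite F" "closure G \<subseteq> (\<Union>x\<in>F. W x)"
    using compactE_image[of "closure G" "closure G" W] W by metis
  have "?c (\<Union>((\<lambda>x. G \<inter> W x) ` F))"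
    using F W G(1) by (intro controlled_Union) (auto simp: open_Int subset_iff)
  then have "?c G" by (rule controlled_mono) (use F(3) closure_subset in fastforce)
  then obtain C where C: "0 \<le> C" "\<And>(u :: 'a \<Rightarrow> 'a) h. upper_gradient G u h \<Longrightarrow> Lp_mass p G u < \<infinity> \<Longrightarrow>
        Lp_mass p G u \<le> ennreal C * (Lp_mass p B u + Lp_mass p G (\<lambda>x. w x * h x))"
    by (rule controlledE) blast
  obtain m where m: "m > 0" "\<And>x. x \<in> cball x0 r \<Longrightarrow> m \<le> w x" using wpos[OF compact_cball r(2)] by auto
  define C1 where "C1 = 2 * (2 * r) powr p * measure lborel (ball (0::'a) (2 * r)) / measure lborel (ball x0 r)"
  have C1: "0 \<le> C1" by (simp add: C1_def)
  show ?thesis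
  proof (intro exI[of _ "C * (C1 * (1 / m) powr p + 1)"] conjI allI impI)
    show "0 \<le> C * (C1 * (1 / m) powr p + 1)" using C C1 by simp
    fix u :: "'a \<Rightarrow> 'a" and h P
    assume u: "upper_gradient G u h" "Lp_mass p G u < \<infinity>" and P: "AE x in lborel. x \<in> G \<longrightarrow> P x"
    have [measurable]: "u \<in> borel_measurable borel" "h \<in> borel_measurable borel" and h0: "\<And>x. 0 \<le> h x"
      using u by (auto simp: upper_gradient_def)
    have BG: "ball x0 r \<subseteq> G" using r(2) ball_subset_cball by blast
    have "AE x in lborel. x \<in> ball x0 r \<longrightarrow> P x" using P by eventually_elim (use BG in auto)
    from ball_increment_point[OF u(1) p r(1) BG this] obtain y where
      y: "y \<in> ball x0 r" "P y" "Lp_mass p B (\<lambda>x. u x - u y) \<le> ennreal C1 * Lp_mass p B h"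
      unfolding C1_def B_def by blast
    define E where "E = Lp_mass p G (\<lambda>x. w x * h x)"
    have "Lp_mass p B h \<le> ennreal ((1 / m) powr p) * Lp_mass p G (\<lambda>x. w x * h x)"
    proof (rule Lp_mass_cmult_bound)
      fix x assume "x \<in> B"
      then have x: "m \<le> w x" "x \<in> G" using m(2)[of x] BG by (auto simp: B_def)
      then have "m * h x \<le> w x * h x" "0 \<le> w x" using h0[of x] m(1) by (auto intro: mult_right_mono)
      then show "x \<in> G \<and> norm (h x) \<le> 1 / m * norm (w x * h x)"
        using m(1) h0[of x] x by (simp add: field_simps abs_mult)
    qed (use p m in auto)
    then have B: "Lp_mass p B (\<lambda>x. u x - u y) \<le> ennreal C1 * (ennreal ((1 / m) powr p) * E)"
      unfolding E_def by (intro order_trans[OF y(3)] mult_left_mono) auto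
    have fin: "Lp_mass p G (\<lambda>x. u x - u y) < \<infinity>"
    proof -
      have "Lp_mass p G (\<lambda>x. u x - u y) \<le> ennreal (2 powr p) * (Lp_mass p G u + Lp_mass p G (\<lambda>_. u y))"
        using p by (intro Lp_mass_add_le) (auto intro: norm_triangle_ineq4)
      also have "\<dots> < \<infinity>"
        using u(2) emeasure_bounded_finite[OF G(3)] by (simp add: Lp_mass_const ennreal_mult_less_top)
      finally show ?thesis .
    qed
    have "Lp_mass p G (\<lambda>x. u x - u y) \<le> ennreal C * (Lp_mass p B (\<lambda>x. u x - u y) + E)"
      unfolding E_def by (rule C(2)[OF upper_gradient_diff_const[OF u(1)] fin])
    also have "\<dots> \<le> ennreal C * (ennreal C1 * (ennreal ((1 / m) powr p) * E) + E)"
      by (intro mult_left_mono add_right_mono B) auto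
    also have "\<dots> = ennreal (C * (C1 * (1 / m) powr p + 1)) * E"
      using C C1 by (simp add: ennreal_mult ennreal_plus distrib_left distrib_right mult.assoc)
    finally show "\<exists>y\<in>G. P y \<and> Lp_mass p G (\<lambda>x. u x - u y) \<le> ennreal (C * (C1 * (1 / m) powr p + 1)) * Lp_mass p G (\<lambda>x. w x * h x)"
      using y BG unfolding E_def by blast
  qed
qed

section \<open>Collars of boundary charts\<close>

lemma horizontal_diff: "horizontal e (x - y) = horizontal e x - horizontal e y"
  by (simp add: horizontal_def inner_diff_left algebra_simps)

lemma horizontal_add_scaleR: "norm e = 1 \<Longrightarrow> horizontal e (x + s *\<^sub>R e) = horizontal e x"
  by (simp add: horizontal_def inner_add_left algebra_simps dot_square_norm)

lemma continuous_on_horizontal: "continuous_on S (horizontal e)"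
  unfolding horizontal_def by (intro continuous_intros)

lemma horizontal_decomp: "x = horizontal e x + (x \<bullet> e) *\<^sub>R e"
  by (simp add: horizontal_def)

lemma norm_le_horizontal: "norm e = 1 \<Longrightarrow> norm x \<le> norm (horizontal e x) + \<bar>x \<bullet> e\<bar>"
  using norm_triangle_ineq[of "horizontal e x" "(x \<bullet> e) *\<^sub>R e"] by (simp add: horizontal_def)

lemma norm_horizontal_le:
  assumes "norm e = 1" shows "norm (horizontal e x) \<le> norm x"
proof -
  have "(norm (horizontal e x))\<^sup>2 = (norm x)\<^sup>2 - (x \<bullet> e)\<^sup>2"
    using assms unfolding power2_norm_eq_inner horizontal_def norm_eq_1
    by (simp add: inner_diff_left inner_diff_right inner_commute power2_eq_square)
  then have "(norm (horizontal e x))\<^sup>2 \<le> (norm x)\<^sup>2" by simp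
  then show ?thesis by (rule power2_le_imp_le) simp
qed

text \<open>A cylinder whose height is large compared with the oscillation of the graph. The factor
  8 leaves room for collars of depth \<open>4 * \<eta>\<close> below a graph that stays within
  \<open>\<eta>\<close> of the height of \<open>x\<close>, and for a margin beyond them. The choices
  of \<open>\<rho>\<close> and \<open>\<eta>\<close> keep the cylinder within
  \<open>\<delta> / 2\<close> of \<open>x\<close>.\<close>

lemma graph_chart_cylinder:
  fixes G U W :: "'a::euclidean_space set"
  assumes chart: "graph_chart G U e \<phi>" and x: "x \<in> frontier G" "x \<in> U" and W: "open W" "x \<in> W"
  obtains \<rho> \<eta> where "0 < \<rho>" "0 < \<eta>"
    "\<And>y. norm (horizontal e (y - x)) \<le> \<rho> \<Longrightarrow> \<bar>y \<bullet> e - x \<bullet> e\<bar> < 8 * \<eta> \<Longrightarrow> y \<in> U \<inter> W"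
    "\<And>y. norm (horizontal e (y - x)) \<le> \<rho> \<Longrightarrow> \<bar>\<phi> (horizontal e y) - x \<bullet> e\<bar> < \<eta>"
    "continuous_on {y. norm (horizontal e (y - x)) \<le> \<rho>} (\<lambda>y. \<phi> (horizontal e y))"
proof -
  have U: "open U" "norm e = 1" "continuous_on (horizontal e ` U) \<phi>"
    using chart by (auto simp: graph_chart_def)
  have "x \<in> frontier G \<inter> U" using x by simp
  then have "x \<in> {y \<in> U. y \<bullet> e = \<phi> (horizontal e y)}" using chart unfolding graph_chart_def by blast
  then have \<phi>x: "\<phi> (horizontal e x) = x \<bullet> e" by simp
  obtain \<delta> where \<delta>: "\<delta> > 0" "ball x \<delta> \<subseteq> U \<inter> W"
    using openE[of "U \<inter> W" x] U W x by (metis IntI open_Int)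
  define \<eta> where "\<eta> = \<delta> / 32"
  have \<eta>: "\<eta> > 0" using \<delta> by (simp add: \<eta>_def)
  obtain d where d: "d > 0" "\<And>z. z \<in> horizontal e ` U \<Longrightarrow> dist z (horizontal e x) < d \<Longrightarrow> dist (\<phi> z) (\<phi> (horizontal e x)) < \<eta>"
    using U(3) x \<eta> unfolding continuous_on_iff by (metis image_eqI)
  define \<rho> where "\<rho> = min (\<delta> / 4) (d / 2)"
  have \<rho>: "\<rho> > 0" "\<rho> \<le> \<delta> / 4" "\<rho> < d" using \<delta> d by (auto simp: \<rho>_def)
  have 1: "y \<in> U \<inter> W" if "norm (horizontal e (y - x)) \<le> \<rho>" "\<bar>y \<bullet> e - x \<bullet> e\<bar> < 8 * \<eta>" for y
  proof -
    have "norm (y - x) \<le> \<rho> + 8 * \<eta>"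
      using norm_le_horizontal[OF U(2), of "y - x"] that by (simp add: inner_diff_left)
    also have "\<dots> < \<delta>" using \<rho> \<delta> by (simp add: \<eta>_def)
    finally show ?thesis using \<delta> by (auto simp: dist_norm norm_minus_commute)
  qed
  \<comment> \<open>Properties of \<open>\<phi>\<close> are known only on the horizontal image of
    \<open>U\<close>, so the vertical line through \<open>y\<close> must meet \<open>U\<close>; it
    does so at the height of \<open>x\<close>.\<close>
  have hU: "horizontal e y \<in> horizontal e ` U" if "norm (horizontal e (y - x)) \<le> \<rho>" for y
  proof -
    define y0 where "y0 = y + (x \<bullet> e - y \<bullet> e) *\<^sub>R e"
    have h: "horizontal e y0 = horizontal e y" by (simp add: y0_def horizontal_add_scaleR[OF U(2)])
    have "y0 \<bullet> e = x \<bullet> e" using U(2) by (simp add: y0_def inner_add_left dot_square_norm)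
    then have "y0 \<in> U" using 1[of y0] that h \<eta> by (simp add: horizontal_diff)
    then show ?thesis using h by (metis image_eqI)
  qed
  show thesis
  proof (rule that[OF \<rho>(1) \<eta> 1])
    show "\<bar>\<phi> (horizontal e y) - x \<bullet> e\<bar> < \<eta>" if "norm (horizontal e (y - x)) \<le> \<rho>" for y
      using d(2)[OF hU[OF that]] that \<rho> by (simp add: \<phi>x dist_norm horizontal_diff)
    show "continuous_on {y. norm (horizontal e (y - x)) \<le> \<rho>} (\<lambda>y. \<phi> (horizontal e y))"
      by (rule continuous_on_compose2[OF U(3) continuous_on_horizontal]) (use hU in auto)
  qed auto
qed

section \<open>The distance weight\<close>

lemma borel_measurable_dist_weight [measurable]: "dist_weight \<alpha> \<Gamma> \<in> borel_measurable borel"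
  for \<Gamma> :: "'a::euclidean_space set"
proof (cases "\<Gamma> = {}")
  case True
  then have "dist_weight \<alpha> \<Gamma> = (\<lambda>_. 1)" by (auto simp: dist_weight_def)
  then show ?thesis by simp
next
  case False
  have [measurable]: "(\<lambda>x. infdist x \<Gamma>) \<in> borel_measurable borel"
    by (intro borel_measurable_continuous_onI continuous_intros)
  have "dist_weight \<alpha> \<Gamma> = (\<lambda>x. infdist x \<Gamma> powr \<alpha>)" using False by (auto simp: dist_weight_def)
  then show ?thesis by simp
qed

lemma dist_weight_nonneg: "0 \<le> dist_weight \<alpha> \<Gamma> x"
  by (simp add: dist_weight_def)

lemma dist_weight_lower_bound:
  fixes K :: "'a::euclidean_space set"
  assumes \<alpha>: "0 \<le> \<alpha>" and K: "compact K" "K \<inter> closure \<Gamma> = {}"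
  shows "\<exists>m>0. \<forall>x\<in>K. m \<le> dist_weight \<alpha> \<Gamma> x"
proof (cases "\<Gamma> = {} \<or> K = {}")
  case True then show ?thesis by (auto simp: dist_weight_def intro!: exI[of _ 1])
next
  case False
  have "continuous_on K (\<lambda>x. infdist x \<Gamma>)" by (intro continuous_intros)
  then obtain y where y: "y \<in> K" "\<And>x. x \<in> K \<Longrightarrow> infdist y \<Gamma> \<le> infdist x \<Gamma>"
    using continuous_attains_inf[OF K(1)] False by blast
  have "infdist y \<Gamma> > 0"
    using y K False in_closure_iff_infdist_zero[of \<Gamma> y] infdist_nonneg[of y \<Gamma>] by (metis disjoint_iff order_le_less)
  then show ?thesis using y \<alpha> False
    by (intro exI[of _ "infdist y \<Gamma> powr \<alpha>"]) (auto simp: dist_weight_def intro!: powr_mono2)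
qed

text \<open>The power is removed before the infimum over \<open>\<Gamma>\<close> is taken and
  restored afterwards, since \<open>powr \<alpha>\<close> is monotone for positive
  \<open>\<alpha>\<close>.\<close>

lemma dist_weight_lower_boundI:
  fixes \<Gamma> :: "'a::euclidean_space set"
  assumes \<alpha>: "0 < \<alpha>" and c: "0 < c" and t: "0 < t" and \<Gamma>: "\<Gamma> \<noteq> {}"
    and le: "\<And>z. z \<in> \<Gamma> \<Longrightarrow> t \<le> c * dist y z powr \<alpha>"
  shows "t \<le> c * dist_weight \<alpha> \<Gamma> y"
proof -
  have "(t / c) powr (1 / \<alpha>) \<le> infdist y \<Gamma>"
    unfolding infdist_notempty[OF \<Gamma>]
  proof (rule cINF_greatest[OF \<Gamma>])
    fix z assume "z \<in> \<Gamma>"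
    then have "t / c \<le> dist y z powr \<alpha>" using le[of z] c by (simp add: field_simps)
    then have "(t / c) powr (1 / \<alpha>) \<le> (dist y z powr \<alpha>) powr (1 / \<alpha>)" using \<alpha> t c by (intro powr_mono2) auto
    then show "(t / c) powr (1 / \<alpha>) \<le> dist y z" using \<alpha> by (simp add: powr_powr)
  qed
  then have "((t / c) powr (1 / \<alpha>)) powr \<alpha> \<le> infdist y \<Gamma> powr \<alpha>" using \<alpha> by (intro powr_mono2) auto
  then show ?thesis using \<alpha> t c \<Gamma> by (simp add: powr_powr dist_weight_def field_simps)
qed

text \<open>The point is that depth is at most a multiple of the weight. A point \<open>z\<close> of
  \<open>\<Gamma>\<close> in the cylinder lies on the graph, so the depth of \<open>y\<close> is the
  difference of two values of \<open>\<phi>\<close> plus a height difference. Hoelder continuity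
  bounds the first by \<open>dist y z powr \<alpha>\<close>; the second is at most
  \<open>dist y z\<close>, which is of the same order on a bounded set because
  \<open>\<alpha> \<le> 1\<close>. Points of \<open>\<Gamma>\<close> outside the cylinder are at a
  distance bounded below.\<close>

lemma collar_neighborhood_of_chart:
  fixes G \<Gamma> :: "'a::euclidean_space set"
  assumes \<alpha>: "0 \<le> \<alpha>" "\<alpha> \<le> 1" and G: "open G" and \<Gamma>: "\<Gamma> \<subseteq> frontier G"
    and x: "x \<in> frontier G" "x \<in> U" and chart: "graph_chart G U e \<phi>"
    and hoelder: "hoelder_on \<alpha> (horizontal e ` U) \<phi>"
  shows "\<exists>W. open W \<and> x \<in> W \<and> collar_neighborhood G (dist_weight \<alpha> \<Gamma>) W"
proof -
  have U: "open U" "norm e = 1" "frontier G \<inter> U = {y \<in> U. y \<bullet> e = \<phi> (horizontal e y)}"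
    "G \<inter> U = {y \<in> U. y \<bullet> e < \<phi> (horizontal e y)}"
    using chart by (auto simp: graph_chart_def)
  obtain \<rho> \<eta> where \<rho>: "0 < \<rho>" and \<eta>: "0 < \<eta>"
    and cyl: "\<And>y. norm (horizontal e (y - x)) \<le> \<rho> \<Longrightarrow> \<bar>y \<bullet> e - x \<bullet> e\<bar> < 8 * \<eta> \<Longrightarrow> y \<in> U \<inter> UNIV"
    and \<phi>: "\<And>y. norm (horizontal e (y - x)) \<le> \<rho> \<Longrightarrow> \<bar>\<phi> (horizontal e y) - x \<bullet> e\<bar> < \<eta>"
    and cont: "continuous_on {y. norm (horizontal e (y - x)) \<le> \<rho>} (\<lambda>y. \<phi> (horizontal e y))"
    using graph_chart_cylinder[OF chart x open_UNIV UNIV_I] by metis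
  define D where "D = {y. norm (horizontal e (y - x)) \<le> \<rho> / 2}"
  define \<tau> where "\<tau> = (\<lambda>y. \<phi> (horizontal e y) - y \<bullet> e)"
  \<comment> \<open>In \<open>W\<close> both the graph and the point are within
    \<open>\<eta>\<close> of the height of \<open>x\<close>, so depths in \<open>W\<close> are below
    \<open>2 * \<eta>\<close>. Depths up to \<open>2 * H\<close> keep heights within
    \<open>5 * \<eta>\<close>, still inside the cylinder.\<close>
  define H where "H = 2 * \<eta>"
  define W where "W = {y. norm (horizontal e (y - x)) < \<rho> / 2 \<and> \<bar>(y - x) \<bullet> e\<bar> < \<eta>}"
  define K where "K = {y \<in> D. H \<le> \<tau> y \<and> \<tau> y \<le> 2 * H}"
  have ch: "continuous_on S (\<lambda>y. norm (horizontal e (y - x)))" for S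
    by (intro continuous_intros continuous_on_compose2[OF continuous_on_horizontal[of UNIV]]) auto
  have Dc: "closed D" unfolding D_def by (rule closed_Collect_le[OF ch continuous_on_const])
  have c\<tau>: "continuous_on D \<tau>"
    unfolding \<tau>_def using \<rho> by (intro continuous_intros continuous_on_subset[OF cont]) (auto simp: D_def)
  have clos: "closed {y \<in> D. a \<le> \<tau> y}" for a
    using continuous_closed_preimage[OF c\<tau> Dc closed_atLeast[of a]] by (simp add: vimage_def Int_def conj_commute)
  have clos': "closed {y \<in> D. \<tau> y \<le> a}" for a
    using continuous_closed_preimage[OF c\<tau> Dc closed_atMost[of a]] by (simp add: vimage_def Int_def conj_commute)
  have DU: "y \<in> U \<and> \<bar>y \<bullet> e - x \<bullet> e\<bar> < 5 * \<eta> \<and> y \<in> G" if "y \<in> D" "0 < \<tau> y" "\<tau> y \<le> 2 * H" for y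
  proof -
    have "norm (horizontal e (y - x)) \<le> \<rho>" using that \<rho> by (simp add: D_def)
    from \<phi>[OF this] have 1: "\<bar>y \<bullet> e - x \<bullet> e\<bar> < 5 * \<eta>" using that \<eta> by (auto simp: \<tau>_def H_def)
    then have "y \<in> U" using cyl[of y] \<eta> \<open>norm (horizontal e (y - x)) \<le> \<rho>\<close> by auto
    moreover have "y \<bullet> e < \<phi> (horizontal e y)" using that by (simp add: \<tau>_def)
    ultimately show ?thesis using U(4) 1 by blast
  qed
  have dpos: "infdist y \<Gamma> > 0" if "y \<in> G" "\<Gamma> \<noteq> {}" for y
  proof -
    have "closure \<Gamma> \<subseteq> frontier G" using \<Gamma> by (simp add: closure_minimal)
    then have "y \<notin> closure \<Gamma>" using that G by (auto simp: frontier_def interior_open)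
    then show ?thesis using in_closure_iff_infdist_zero[OF that(2)] infdist_nonneg[of y \<Gamma>] by (metis order_le_less)
  qed
  have bound: "\<exists>c>0. \<forall>y\<in>D. 0 < \<tau> y \<and> \<tau> y < 2 * H \<longrightarrow> \<tau> y \<le> c * dist_weight \<alpha> \<Gamma> y"
  proof (cases "\<Gamma> = {} \<or> \<alpha> = 0")
    case True
    \<comment> \<open>For \<open>\<alpha> = 0\<close> positivity of the distance is essential, since
      \<open>0 powr 0 = 0\<close>.\<close>
    have "dist_weight \<alpha> \<Gamma> y = 1" if "y \<in> D" "0 < \<tau> y" "\<tau> y < 2 * H" for y
    proof (cases "\<Gamma> = {}")
      case False
      then have "infdist y \<Gamma> > 0" using dpos[of y] DU[of y] that by auto
      then show ?thesis using True False by (simp add: dist_weight_def)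
    qed (simp add: dist_weight_def)
    then show ?thesis using \<eta> by (intro exI[of _ "2 * H"]) (auto simp: H_def)
  next
    case False
    then have \<alpha>0: "0 < \<alpha>" and \<Gamma>0: "\<Gamma> \<noteq> {}" using \<alpha> by auto
    obtain C where C: "\<And>y z. y \<in> horizontal e ` U \<Longrightarrow> z \<in> horizontal e ` U \<Longrightarrow> \<bar>\<phi> y - \<phi> z\<bar> \<le> C * dist y z powr \<alpha>"
      using hoelder \<alpha>0 unfolding hoelder_on_def by auto
    \<comment> \<open>\<open>R\<close> bounds the distance of \<open>y\<close> from a point of the
      cylinder. A point outside it is at least \<open>\<rho> - \<rho> / 2\<close> away horizontally
      or \<open>8 * \<eta> - 5 * \<eta>\<close> away vertically, whence \<open>d0\<close>.\<close>
    define R where "R = 2 * \<rho> + 16 * \<eta>"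
    define d0 where "d0 = min (\<rho> / 2) (3 * \<eta>)"
    have d0: "d0 > 0" using \<rho> \<eta> by (simp add: d0_def)
    define c where "c = \<bar>C\<bar> + R powr (1 - \<alpha>) + 2 * H / d0 powr \<alpha>"
    have cpos: "c > 0" unfolding c_def using d0 \<eta> \<rho> by (intro add_nonneg_pos divide_pos_pos) (auto simp: H_def)
    have parts: "\<bar>C\<bar> + R powr (1 - \<alpha>) \<le> c" "2 * H / d0 powr \<alpha> \<le> c"
      using d0 \<eta> by (auto simp: c_def H_def)
    have "\<tau> y \<le> c * dist_weight \<alpha> \<Gamma> y" if y: "y \<in> D" "0 < \<tau> y" "\<tau> y < 2 * H" for y
    proof (rule dist_weight_lower_boundI[OF \<alpha>0 cpos y(2) \<Gamma>0])
      fix z assume z: "z \<in> \<Gamma>"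
      have yU: "y \<in> U" "\<bar>y \<bullet> e - x \<bullet> e\<bar> < 5 * \<eta>" using DU[of y] y by auto
      have ye: "\<bar>(z - y) \<bullet> e\<bar> \<le> dist y z"
        using Cauchy_Schwarz_ineq2[of "z - y" e] U(2) by (simp add: dist_norm norm_minus_commute)
      have yh: "norm (horizontal e (z - y)) \<le> dist y z"
        using norm_horizontal_le[OF U(2), of "z - y"] by (simp add: dist_norm norm_minus_commute)
      show "\<tau> y \<le> c * dist y z powr \<alpha>"
      proof (cases "norm (horizontal e (z - x)) \<le> \<rho> \<and> \<bar>z \<bullet> e - x \<bullet> e\<bar> < 8 * \<eta>")
        case True
        then have "z \<in> U" using cyl by blast
        then have ze: "z \<bullet> e = \<phi> (horizontal e z)" using z \<Gamma> U(3) by blast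
        have "norm (y - z) \<le> norm (horizontal e (y - z)) + \<bar>(y - z) \<bullet> e\<bar>" by (rule norm_le_horizontal[OF U(2)])
        also have "norm (horizontal e (y - z)) \<le> norm (horizontal e (y - x)) + norm (horizontal e (z - x))"
          using norm_triangle_ineq4[of "horizontal e (y - x)" "horizontal e (z - x)"] by (simp add: horizontal_diff)
        finally have dR: "dist y z \<le> R"
          using True yU y(1) \<rho> \<eta> by (auto simp: dist_norm R_def D_def inner_diff_left)
        have "dist y z = dist y z powr \<alpha> * dist y z powr (1 - \<alpha>)"
          by (cases "y = z") (auto simp: powr_add[symmetric])
        also have "\<dots> \<le> dist y z powr \<alpha> * R powr (1 - \<alpha>)"
          using dR \<alpha> by (intro mult_left_mono powr_mono2) auto
        finally have d1: "dist y z \<le> R powr (1 - \<alpha>) * dist y z powr \<alpha>" by (simp add: mult.commute)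
        have "\<tau> y = (\<phi> (horizontal e y) - \<phi> (horizontal e z)) + (z - y) \<bullet> e"
          by (simp add: \<tau>_def ze[symmetric] inner_diff_left)
        also have "\<dots> \<le> C * dist (horizontal e y) (horizontal e z) powr \<alpha> + dist y z"
          using C[of "horizontal e y" "horizontal e z"] yU \<open>z \<in> U\<close> ye by auto
        also have "\<dots> \<le> \<bar>C\<bar> * dist y z powr \<alpha> + R powr (1 - \<alpha>) * dist y z powr \<alpha>"
        proof (intro add_mono d1 mult_mono)
          show "dist (horizontal e y) (horizontal e z) powr \<alpha> \<le> dist y z powr \<alpha>"
            using yh \<alpha> by (intro powr_mono2) (auto simp: dist_norm horizontal_diff norm_minus_commute)
        qed auto
        also have "\<dots> \<le> c * dist y z powr \<alpha>"
          using parts(1) by (simp add: distrib_right[symmetric] mult_right_mono)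
        finally show ?thesis .
      next
        case False
        have "d0 \<le> dist y z"
        proof (cases "norm (horizontal e (z - x)) \<le> \<rho>")
          case True
          then have "8 * \<eta> \<le> \<bar>z \<bullet> e - x \<bullet> e\<bar>" using False by auto
          then show ?thesis using ye yU by (auto simp: d0_def inner_diff_left)
        next
          case F: False
          have "norm (horizontal e (z - x)) \<le> norm (horizontal e (z - y)) + norm (horizontal e (y - x))"
            using norm_triangle_ineq[of "horizontal e (z - y)" "horizontal e (y - x)"] by (simp add: horizontal_diff)
          then show ?thesis using F yh y(1) by (auto simp: d0_def D_def)
        qed
        then have "d0 powr \<alpha> \<le> dist y z powr \<alpha>" using d0 \<alpha> by (intro powr_mono2) auto
        then have "2 * H / d0 powr \<alpha> * d0 powr \<alpha> \<le> c * dist y z powr \<alpha>"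
          using parts(2) cpos by (intro mult_mono) auto
        then show ?thesis using y(3) d0 by simp
      qed
    qed
    then show ?thesis using cpos by blast
  qed
  then obtain c where c: "c > 0" "\<And>y. y \<in> D \<Longrightarrow> 0 < \<tau> y \<Longrightarrow> \<tau> y < 2 * H \<Longrightarrow> \<tau> y \<le> c * dist_weight \<alpha> \<Gamma> y" by blast
  have "collar_neighborhood G (dist_weight \<alpha> \<Gamma>) W"
    unfolding collar_neighborhood_def
  proof (rule exI[of _ e], rule exI[of _ D], rule exI[of _ \<tau>], rule exI[of _ H], rule exI[of _ c], rule exI[of _ K],
      intro conjI ballI allI impI)
    show "norm e = 1" by (rule U)
    fix y s assume "y \<in> D"
    then show "y + s *\<^sub>R e \<in> D" by (simp add: D_def horizontal_diff horizontal_add_scaleR[OF U(2)])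
    show "\<tau> (y + s *\<^sub>R e) = \<tau> y - s" using U(2) by (simp add: \<tau>_def horizontal_add_scaleR inner_add_left dot_square_norm)
  next
    fix a b
    have "{y \<in> D. a \<le> \<tau> y \<and> \<tau> y < b} = {y \<in> D. a \<le> \<tau> y} - {y \<in> D. b \<le> \<tau> y}" by auto
    then show "{y \<in> D. a \<le> \<tau> y \<and> \<tau> y < b} \<in> sets borel" using clos by (simp add: borel_closed sets.Diff)
  next
    show "0 < H" using \<eta> by (simp add: H_def)
    show "0 < c" by (rule c)
    fix y assume "y \<in> D" "0 < \<tau> y \<and> \<tau> y < 2 * H"
    then show "y \<in> G" "\<tau> y \<le> c * dist_weight \<alpha> \<Gamma> y" using DU[of y] c(2)[of y] by auto
  next
    show KG: "K \<subseteq> G" using DU \<eta> by (force simp: K_def H_def)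
    have "K = {y \<in> D. H \<le> \<tau> y} \<inter> {y \<in> D. \<tau> y \<le> 2 * H}" by (auto simp: K_def)
    then have "closed K" using clos clos' by auto
    moreover have "bounded K"
    proof (rule bounded_subset[of "cball x (\<rho> + 5 * \<eta>)"])
      show "K \<subseteq> cball x (\<rho> + 5 * \<eta>)"
      proof
        fix y assume "y \<in> K"
        then have "y \<in> D" "\<bar>y \<bullet> e - x \<bullet> e\<bar> < 5 * \<eta>" using DU[of y] \<eta> by (auto simp: K_def H_def)
        then show "y \<in> cball x (\<rho> + 5 * \<eta>)"
          using norm_le_horizontal[OF U(2), of "y - x"] \<rho> by (auto simp: D_def dist_norm norm_minus_commute inner_diff_left)
      qed
    qed simp
    ultimately show "compact K" by (simp add: compact_eq_bounded_closed)
    show "{x \<in> D. H \<le> \<tau> x \<and> \<tau> x < 2 * H} \<subseteq> K" by (auto simp: K_def)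
    show "G \<inter> W \<subseteq> {x \<in> D. 0 < \<tau> x \<and> \<tau> x < H}"
    proof
      fix y assume y: "y \<in> G \<inter> W"
      then have D: "norm (horizontal e (y - x)) \<le> \<rho> / 2" "\<bar>y \<bullet> e - x \<bullet> e\<bar> < \<eta>" by (auto simp: W_def inner_diff_left)
      then have "y \<in> U" using cyl[of y] \<rho> \<eta> by auto
      then have "0 < \<tau> y" using y U(4) by (auto simp: \<tau>_def)
      moreover have "\<tau> y < H" using \<phi>[of y] D \<rho> by (auto simp: \<tau>_def H_def)
      ultimately show "y \<in> {x \<in> D. 0 < \<tau> x \<and> \<tau> x < H}" using D by (simp add: D_def)
    qed
  qed
  moreover have "open W"
    unfolding W_def Collect_conj_eq
    by (intro open_Int open_Collect_less ch continuous_on_rabs continuous_on_const continuous_intros)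
  moreover have "x \<in> W" using \<rho> \<eta> by (simp add: W_def horizontal_def)
  ultimately show ?thesis by blast
qed

section \<open>Vertical cylinders and Hausdorff measure\<close>

text \<open>The cylinder of height \<open>2 * b\<close> over a set of diameter
  \<open>\<delta>\<close> is covered by about \<open>2 * b / \<delta>\<close> balls of radius
  \<open>2 * \<delta>\<close>, stacked at spacing \<open>\<delta>\<close>; one power of
  \<open>\<delta>\<close> in their volume cancels against their number. For
  \<open>\<delta> = 0\<close> the cylinder is a vertical segment, which lies in a null
  hyperplane.\<close>

lemma cylinder_over_small_set:
  fixes S :: "'a::euclidean_space set"
  assumes e: "norm e = 1" and N: "DIM('a) = Suc m" "1 \<le> m" and b: "0 \<le> b"
    and S: "bounded S" "diameter S \<le> 1" "S \<noteq> {}"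
  shows "\<exists>T\<in>sets borel. {y. \<exists>x\<in>S. horizontal e y = horizontal e x \<and> \<bar>y \<bullet> e - a\<bar> \<le> b} \<subseteq> T \<and>
     emeasure lborel T \<le> ennreal ((2 * b + 1) * unit_ball_vol (real (Suc m)) * 2 ^ Suc m * diameter S ^ m)"
proof -
  obtain s where s: "s \<in> S" using S by auto
  let ?Z = "{y. \<exists>x\<in>S. horizontal e y = horizontal e x \<and> \<bar>y \<bullet> e - a\<bar> \<le> b}"
  let ?V = "unit_ball_vol (real (Suc m))"
  define \<delta> where "\<delta> = diameter S"
  have \<delta>: "0 \<le> \<delta>" "\<delta> \<le> 1" "\<And>x. x \<in> S \<Longrightarrow> dist x s \<le> \<delta>"
    using S s diameter_bounded_bound[OF S(1)] by (auto simp: \<delta>_def diameter_ge_0)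
  show ?thesis
  proof (cases "\<delta> = 0")
    case True
    obtain f where f: "f \<noteq> 0" "orthogonal e f" using orthogonal_to_vector_exists[of e] N by auto
    have "?Z \<subseteq> {y. f \<bullet> y = f \<bullet> horizontal e s}"
    proof safe
      fix y x assume "x \<in> S" and h: "horizontal e y = horizontal e x"
      then have "x = s" using \<delta>(3)[of x] True by simp
      have "f \<bullet> y = f \<bullet> (horizontal e y + (y \<bullet> e) *\<^sub>R e)" using horizontal_decomp[of y e] by simp
      then show "f \<bullet> y = f \<bullet> horizontal e s"
        using h f(2) \<open>x = s\<close> by (simp add: inner_add_right orthogonal_def inner_commute)
    qed
    moreover have "negligible {y. f \<bullet> y = f \<bullet> horizontal e s}" using f by (intro negligible_hyperplane) auto
    moreover have "{y. f \<bullet> y = f \<bullet> horizontal e s} \<in> sets borel" by (intro borel_closed closed_hyperplane)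
    ultimately show ?thesis
      by (intro bexI[of _ "{y. f \<bullet> y = f \<bullet> horizontal e s}"]) (auto simp: negligible_iff_null_sets null_sets_def)
  next
    case False
    then have \<delta>0: "\<delta> > 0" using \<delta> by simp
    define n where "n = nat \<lfloor>2 * b / \<delta>\<rfloor>"
    define c where "c = (\<lambda>k::nat. horizontal e s + (a - b + real k * \<delta>) *\<^sub>R e)"
    have "?Z \<subseteq> (\<Union>k\<le>n. cball (c k) (2 * \<delta>))"
    proof safe
      fix y x assume x: "x \<in> S" and h: "horizontal e y = horizontal e x" and y: "\<bar>y \<bullet> e - a\<bar> \<le> b"
      define q where "q = (y \<bullet> e - a + b) / \<delta>"
      have q: "0 \<le> q" "q \<le> 2 * b / \<delta>" using y \<delta>0 by (auto simp: q_def divide_right_mono)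
      define k where "k = nat \<lfloor>q\<rfloor>"
      have "k \<le> n" unfolding k_def n_def using q by (intro nat_mono floor_mono)
      have kq: "real k \<le> q" "q < real k + 1" using q by (auto simp: k_def)
      have ye: "y \<bullet> e = a - b + q * \<delta>" using \<delta>0 by (simp add: q_def)
      have yy: "y = horizontal e y + (a - b + q * \<delta>) *\<^sub>R e" using horizontal_decomp[of y e] unfolding ye .
      have "y - c k = (horizontal e y + (a - b + q * \<delta>) *\<^sub>R e) - c k"
        using arg_cong[OF yy, of "\<lambda>z. z - c k"] .
      also have "\<dots> = (horizontal e y - horizontal e s) + ((q - real k) * \<delta>) *\<^sub>R e"
        by (simp add: c_def algebra_simps)
      finally have "y - c k = (horizontal e y - horizontal e s) + ((q - real k) * \<delta>) *\<^sub>R e" .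
      then have "norm (y - c k) \<le> norm (horizontal e y - horizontal e s) + norm (((q - real k) * \<delta>) *\<^sub>R e)"
        by (simp only: norm_triangle_ineq)
      also have "\<dots> \<le> \<delta> + 1 * \<delta>"
      proof (rule add_mono)
        show "norm (horizontal e y - horizontal e s) \<le> \<delta>"
          using norm_horizontal_le[OF e, of "x - s"] \<delta>(3)[OF x] h by (simp add: horizontal_diff dist_norm)
        show "norm (((q - real k) * \<delta>) *\<^sub>R e) \<le> 1 * \<delta>"
          using e kq \<delta>0 by (simp add: abs_mult mult_right_mono)
      qed
      finally show "y \<in> (\<Union>k\<le>n. cball (c k) (2 * \<delta>))" using \<open>k \<le> n\<close>
        by (auto simp: dist_norm norm_minus_commute intro!: bexI[of _ k])
    qed
    moreover have "emeasure lborel (\<Union>k\<le>n. cball (c k) (2 * \<delta>)) \<le> ennreal ((2 * b + 1) * ?V * 2 ^ Suc m * diameter S ^ m)"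
    proof -
      have "emeasure lborel (\<Union>k\<le>n. cball (c k) (2 * \<delta>)) \<le> (\<Sum>k\<le>n. emeasure lborel (cball (c k) (2 * \<delta>)))"
        by (intro emeasure_subadditive_finite) auto
      also have "\<dots> = (\<Sum>k\<le>n. ennreal (?V * (2 * \<delta>) ^ Suc m))"
        using \<delta> N by (simp add: emeasure_cball)
      also have "\<dots> = ennreal ((real n + 1) * (?V * (2 * \<delta>) ^ Suc m))"
        using \<delta> by (simp add: ennreal_of_nat_eq_real_of_nat ennreal_mult[symmetric] ennreal_plus[symmetric] add.commute del: ennreal_plus)
      also have "\<dots> \<le> ennreal ((2 * b + 1) * ?V * 2 ^ Suc m * diameter S ^ m)"
      proof (rule ennreal_leI)
        have "real n \<le> 2 * b / \<delta>" using b \<delta>0 by (simp add: n_def)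
        then have "(real n + 1) * \<delta> \<le> 2 * b + \<delta>" using \<delta>0 by (simp add: field_simps)
        then have "(real n + 1) * \<delta> \<le> 2 * b + 1" using \<delta> by linarith
        then have "((real n + 1) * \<delta>) * (?V * 2 ^ Suc m * \<delta> ^ m) \<le> (2 * b + 1) * (?V * 2 ^ Suc m * \<delta> ^ m)"
          using \<delta> by (intro mult_right_mono mult_nonneg_nonneg) auto
        then show "(real n + 1) * (?V * (2 * \<delta>) ^ Suc m) \<le> (2 * b + 1) * ?V * 2 ^ Suc m * diameter S ^ m"
          unfolding \<delta>_def[symmetric] by (simp add: power_mult_distrib mult_ac)
      qed
      finally show ?thesis .
    qed
    ultimately show ?thesis by (intro bexI[of _ "\<Union>k\<le>n. cball (c k) (2 * \<delta>)"]) auto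
  qed
qed

text \<open>Each member of a cover of \<open>E\<close> is replaced by the cylinder over it, whose
  volume is at most a fixed multiple of the summand in \<open>hausdorff_pre\<close>. Hausdorff outer
  measure is a supremum over mesh sizes, so the single size 1 already bounds it from below.\<close>

lemma emeasure_cylinder_le_hausdorff_outer:
  fixes E M :: "'a::euclidean_space set"
  assumes e: "norm e = 1" and N: "DIM('a) = Suc m" "1 \<le> m" and b: "0 \<le> b"
    and M: "\<And>y. y \<in> M \<Longrightarrow> \<exists>x\<in>E. horizontal e y = horizontal e x \<and> \<bar>y \<bullet> e - a\<bar> \<le> b"
  shows "emeasure lborel M \<le> ennreal ((2 * b + 1) * unit_ball_vol (real (Suc m)) * 2 ^ Suc m * 2 ^ m / unit_ball_vol (real m))
     * hausdorff_outer m E"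
proof (cases "M \<in> sets borel")
  case False then show ?thesis by (simp add: emeasure_notin_sets)
next
  case True
  define C where "C = (2 * b + 1) * unit_ball_vol (real (Suc m)) * 2 ^ Suc m"
  define Q where "Q = C * 2 ^ m / unit_ball_vol (real m)"
  have C: "C > 0" using b by (simp add: C_def)
  have V: "unit_ball_vol (real m) > 0" by simp
  have Q: "Q > 0" unfolding Q_def using C V by simp
  have cover: "emeasure lborel M \<le> ennreal Q * (\<Sum>i. if A i = {} then 0 else ennreal (unit_ball_vol (real m) * (diameter (A i) / 2) ^ m))"
    if A: "E \<subseteq> (\<Union>i. A i)" "\<forall>i. bounded (A i) \<and> diameter (A i) \<le> 1" for A :: "nat \<Rightarrow> 'a set"
  proof -
    let ?Z = "\<lambda>S. {y. \<exists>x\<in>S. horizontal e y = horizontal e x \<and> \<bar>y \<bullet> e - a\<bar> \<le> b}"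
    have "\<forall>i. \<exists>T. T \<in> sets borel \<and> ?Z (A i) \<subseteq> T \<and> emeasure lborel T \<le> (if A i = {} then 0 else ennreal (C * diameter (A i) ^ m))"
    proof
      fix i
      show "\<exists>T. T \<in> sets borel \<and> ?Z (A i) \<subseteq> T \<and> emeasure lborel T \<le> (if A i = {} then 0 else ennreal (C * diameter (A i) ^ m))"
      proof (cases "A i = {}")
        case True then show ?thesis by (intro exI[of _ "{}"]) auto
      next
        case False
        then show ?thesis
          using cylinder_over_small_set[OF e N b, of "A i" a] A(2) unfolding C_def by auto
      qed
    qed
    from this[unfolded choice_iff] obtain T where T: "\<And>i. T i \<in> sets borel" "\<And>i. ?Z (A i) \<subseteq> T i"
      "\<And>i. emeasure lborel (T i) \<le> (if A i = {} then 0 else ennreal (C * diameter (A i) ^ m))" by blast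
    have "M \<subseteq> (\<Union>i. T i)"
    proof
      fix y assume "y \<in> M"
      then obtain x where x: "x \<in> E" "horizontal e y = horizontal e x \<and> \<bar>y \<bullet> e - a\<bar> \<le> b" using M by blast
      then obtain i where "x \<in> A i" using A(1) by auto
      then have "y \<in> ?Z (A i)" using x by blast
      then show "y \<in> (\<Union>i. T i)" using T(2) by blast
    qed
    then have "emeasure lborel M \<le> emeasure lborel (\<Union>i. T i)" using T(1) by (intro emeasure_mono) auto
    also have "\<dots> \<le> (\<Sum>i. emeasure lborel (T i))" using T(1) by (intro emeasure_subadditive_countably) auto
    also have "\<dots> \<le> (\<Sum>i. ennreal Q * (if A i = {} then 0 else ennreal (unit_ball_vol (real m) * (diameter (A i) / 2) ^ m)))"
    proof (intro suminf_le)
      fix i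
      have d: "0 \<le> diameter (A i)" using A(2) diameter_ge_0 by blast
      have "C * diameter (A i) ^ m = Q * (unit_ball_vol (real m) * (diameter (A i) / 2) ^ m)"
        using less_imp_neq[OF V, symmetric] by (simp add: Q_def power_divide)
      then show "emeasure lborel (T i) \<le> ennreal Q * (if A i = {} then 0 else ennreal (unit_ball_vol (real m) * (diameter (A i) / 2) ^ m))"
        using T(3)[of i] Q d by (cases "A i = {}") (simp_all add: ennreal_mult[symmetric])
    qed auto
    also have "\<dots> = ennreal Q * (\<Sum>i. if A i = {} then 0 else ennreal (unit_ball_vol (real m) * (diameter (A i) / 2) ^ m))"
      by (rule ennreal_suminf_cmult)
    finally show ?thesis .
  qed
  have QQ: "ennreal (1 / Q) * ennreal Q = 1" using Q by (simp add: ennreal_mult[symmetric])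
  have "ennreal (1 / Q) * emeasure lborel M \<le> hausdorff_pre m 1 E"
    unfolding hausdorff_pre_def
  proof (rule INF_greatest)
    fix A assume "A \<in> {C :: nat \<Rightarrow> 'a set. E \<subseteq> (\<Union>i. C i) \<and> (\<forall>i. bounded (C i) \<and> diameter (C i) \<le> 1)}"
    then have "ennreal (1 / Q) * emeasure lborel M \<le> ennreal (1 / Q) * (ennreal Q * (\<Sum>i. if A i = {} then 0 else ennreal (unit_ball_vol (real m) * (diameter (A i) / 2) ^ m)))"
      by (intro mult_left_mono cover) auto
    then show "ennreal (1 / Q) * emeasure lborel M \<le> (\<Sum>i. if A i = {} then 0 else ennreal (unit_ball_vol (real m) * (diameter (A i) / 2) ^ m))"
      by (simp only: mult.assoc[symmetric] QQ mult_1_left)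
  qed
  also have "\<dots> \<le> hausdorff_outer m E"
    unfolding hausdorff_outer_def by (rule SUP_upper) simp
  finally have "ennreal Q * (ennreal (1 / Q) * emeasure lborel M) \<le> ennreal Q * hausdorff_outer m E"
    by (rule mult_left_mono) simp
  moreover have "ennreal Q * ennreal (1 / Q) = 1" using QQ by (simp only: mult.commute)
  ultimately have "emeasure lborel M \<le> ennreal Q * hausdorff_outer m E"
    by (simp only: mult.assoc[symmetric] mult_1_left)
  then show ?thesis unfolding Q_def C_def .
qed

lemma sets_hausdorff_measure [simp, measurable_cong]: "sets (hausdorff_measure m) = sets borel"
  unfolding hausdorff_measure_def using sets.sigma_sets_eq[of borel] by (subst sets_measure_of) auto

text \<open>
  The constant \<^const>\<open>measure_of\<close> returns the zero measure unless the set function is a measure, so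
  a single set of positive measure shows that Hausdorff outer measure is countably additive on the
  Borel sets; there is no need for Caratheodory's criterion.
\<close>

lemma emeasure_hausdorff_measure:
  fixes A X :: "'a::metric_space set"
  assumes "emeasure (hausdorff_measure m) A > 0" and X: "X \<in> sets borel"
  shows "emeasure (hausdorff_measure m) X = hausdorff_outer m X"
proof -
  have "measure_space (UNIV :: 'a set) (sets borel) (hausdorff_outer m)"
    using assms(1) sets.sigma_sets_eq[of "borel :: 'a measure"]
    unfolding hausdorff_measure_def emeasure_measure_of_conv by (auto split: if_splits)
  then show ?thesis
    using X sets.sigma_sets_eq[of "borel :: 'a measure"] unfolding hausdorff_measure_def emeasure_measure_of_conv by auto
qed

text \<open>\<open>P\<close> moves a point of \<open>K\<close> vertically to the graph. The volume
  estimate for cylinders says that the image under \<open>P\<close> of Lebesgue measure on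
  \<open>K\<close> is at most a multiple of Hausdorff measure on \<open>S\<close>; inequality of
  measures gives inequality of integrals.\<close>

lemma nn_integral_graph_le_hausdorff:
  fixes K S :: "'a::euclidean_space set" and P :: "'a \<Rightarrow> 'a"
  assumes e: "norm e = 1" and N: "DIM('a) = Suc m" "1 \<le> m" and b: "0 \<le> b"
    and H: "\<And>X. X \<in> sets borel \<Longrightarrow> emeasure (hausdorff_measure m) X = hausdorff_outer m (X :: 'a set)"
    and K[measurable]: "K \<in> sets borel" and S[measurable]: "S \<in> sets borel"
    and P: "P \<in> restrict_space borel K \<rightarrow>\<^sub>M borel"
    and PK: "\<And>y. y \<in> K \<Longrightarrow> P y \<in> S \<and> horizontal e (P y) = horizontal e y \<and> \<bar>y \<bullet> e - a\<bar> \<le> b"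
    and F: "F \<in> borel_measurable (restrict_space (hausdorff_measure m) S)"
  shows "(\<integral>\<^sup>+y. F (P y) \<partial>restrict_space lborel K) \<le>
    ennreal ((2 * b + 1) * unit_ball_vol (real (Suc m)) * 2 ^ Suc m * 2 ^ m / unit_ball_vol (real m))
      * (\<integral>\<^sup>+x. F x \<partial>restrict_space (hausdorff_measure m) S)"
proof -
  let ?Q = "ennreal ((2 * b + 1) * unit_ball_vol (real (Suc m)) * 2 ^ Suc m * 2 ^ m / unit_ball_vol (real m))"
  let ?R = "restrict_space (hausdorff_measure m) S"
  have sR: "sets ?R = sets (restrict_space borel S)" by (simp add: sets_restrict_space)
  have spR: "space ?R = S" by (simp add: space_restrict_space hausdorff_measure_def)
  have P1: "P \<in> restrict_space lborel K \<rightarrow>\<^sub>M ?R"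
  proof -
    have "P \<in> restrict_space borel K \<rightarrow>\<^sub>M restrict_space borel S"
      using P PK by (intro measurable_restrict_space2) (auto simp: space_restrict_space)
    then show ?thesis
      using measurable_cong_sets[OF _ sR, of "restrict_space lborel K" "restrict_space borel K"]
      by (simp add: sets_restrict_space)
  qed
  have "(\<integral>\<^sup>+y. F (P y) \<partial>restrict_space lborel K) = (\<integral>\<^sup>+x. F x \<partial>distr (restrict_space lborel K) ?R P)"
    by (rule nn_integral_distr[OF P1, symmetric]) (simp add: F)
  also have "\<dots> \<le> (\<integral>\<^sup>+x. F x \<partial>scale_measure ?Q ?R)"
  proof (rule nn_integral_mono_measure)
    show "sets (distr (restrict_space lborel K) ?R P) = sets (scale_measure ?Q ?R)" by simp
    show "distr (restrict_space lborel K) ?R P \<le> scale_measure ?Q ?R"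
    proof -
      have "emeasure (distr (restrict_space lborel K) ?R P) X \<le> emeasure (scale_measure ?Q ?R) X" for X
      proof (cases "X \<in> sets ?R")
        case True
        then have X: "X \<in> sets borel" "X \<subseteq> S" using S by (auto simp: sets_restrict_space)
        have pre: "P -` X \<inter> K \<in> sets borel"
          using measurable_sets[OF P X(1)] K by (simp add: space_restrict_space sets_restrict_space_iff)
        have "emeasure (distr (restrict_space lborel K) ?R P) X = emeasure lborel (P -` X \<inter> K)"
          using True by (subst emeasure_distr[OF P1]) (auto simp: space_restrict_space emeasure_restrict_space)
        also have "\<dots> \<le> ?Q * hausdorff_outer m X"
        proof (rule emeasure_cylinder_le_hausdorff_outer[OF e N b, where a=a])
          fix y assume "y \<in> P -` X \<inter> K"
          then show "\<exists>x\<in>X. horizontal e y = horizontal e x \<and> \<bar>y \<bullet> e - a\<bar> \<le> b"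
            using PK[of y] by (intro bexI[of _ "P y"]) auto
        qed
        also have "\<dots> = emeasure (scale_measure ?Q ?R) X"
          using X H[OF X(1)] by (simp add: emeasure_restrict_space)
        finally show ?thesis .
      qed (simp add: emeasure_notin_sets)
      then show ?thesis unfolding le_measure_iff by (simp add: space_scale_measure le_fun_def)
    qed
  qed
  also have "\<dots> = ?Q * (\<integral>\<^sup>+x. F x \<partial>?R)"
    by (rule nn_integral_scale_measure[OF F])
  finally show ?thesis .
qed

section \<open>Traces\<close>

lemma Lp_tendsto_nn_integral:
  assumes p: "1 \<le> p" and L: "Lp_tendsto p M f g"
  shows "(\<lambda>k. \<integral>\<^sup>+x. ennreal (\<bar>f k x - g x\<bar> powr p) \<partial>M) \<longlonglongrightarrow> 0"
proof -
  have int: "integrable M (\<lambda>x. \<bar>f k x - g x\<bar> powr p)" for k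
    using L by (auto simp: Lp_tendsto_def Lp_def)
  have lim: "(\<lambda>k. Lp_norm p M (\<lambda>x. f k x - g x)) \<longlonglongrightarrow> 0" using L by (simp add: Lp_tendsto_def)
  have nn: "0 \<le> (\<integral>x. \<bar>f k x - g x\<bar> powr p \<partial>M)" for k by (intro integral_nonneg_AE) simp
  have eq: "(Lp_norm p M (\<lambda>x. f k x - g x)) powr p = (\<integral>x. \<bar>f k x - g x\<bar> powr p \<partial>M)" for k
    unfolding Lp_norm_def using nn[of k] p by (simp add: powr_powr)
  have "(\<lambda>k. (Lp_norm p M (\<lambda>x. f k x - g x)) powr p) \<longlonglongrightarrow> 0"
    by (rule tendsto_zero_powrI[OF lim tendsto_const]) (use p in \<open>auto simp: Lp_norm_def\<close>)
  then have "(\<lambda>k. ennreal (\<integral>x. \<bar>f k x - g x\<bar> powr p \<partial>M)) \<longlonglongrightarrow> ennreal 0"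
    unfolding eq by (rule tendsto_ennrealI)
  then show ?thesis using nn_integral_eq_integral[OF int] by simp
qed

text \<open>Convergence in \<open>L^p\<close> implies convergence in \<open>L^1\<close> on a finite
  measure space. In place of Hoelder's inequality, \<open>\<bar>q\<bar> \<le> \<epsilon> +
  \<epsilon> powr (1 - p) * \<bar>q\<bar> powr p\<close> holds pointwise; \<open>\<epsilon>\<close>
  and \<open>\<delta>\<close> are chosen so that each term contributes at most
  \<open>r / 2\<close>.\<close>

lemma nn_integral_tendsto_0_of_powr:
  fixes q :: "nat \<Rightarrow> 'a \<Rightarrow> real"
  assumes p: "1 \<le> p" and fin: "emeasure M (space M) < \<infinity>"
    and [measurable]: "\<And>k. q k \<in> borel_measurable M"
    and J: "(\<lambda>k. \<integral>\<^sup>+x. ennreal (\<bar>q k x\<bar> powr p) \<partial>M) \<longlonglongrightarrow> 0"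
  shows "(\<lambda>k. \<integral>\<^sup>+x. ennreal \<bar>q k x\<bar> \<partial>M) \<longlonglongrightarrow> 0"
proof (rule tendsto_zero_ennreal)
  fix r :: real assume r: "0 < r"
  obtain V where V: "emeasure M (space M) = ennreal V" "0 \<le> V" using fin by (cases "emeasure M (space M)") auto
  define \<epsilon> where "\<epsilon> = r / (2 * (V + 1))"
  have \<epsilon>: "\<epsilon> > 0" using r V by (simp add: \<epsilon>_def)
  define \<delta> where "\<delta> = r / 2 * \<epsilon> powr (p - 1)"
  have \<delta>: "\<delta> > 0" using r \<epsilon> by (simp add: \<delta>_def)
  have "\<forall>\<^sub>F k in sequentially. (\<integral>\<^sup>+x. ennreal (\<bar>q k x\<bar> powr p) \<partial>M) < ennreal \<delta>"
    using J \<delta> by (intro order_tendstoD) auto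
  then show "\<forall>\<^sub>F k in sequentially. (\<integral>\<^sup>+x. ennreal \<bar>q k x\<bar> \<partial>M) < ennreal r"
  proof eventually_elim
    case (elim k)
    have "(\<integral>\<^sup>+x. ennreal \<bar>q k x\<bar> \<partial>M) \<le> (\<integral>\<^sup>+x. ennreal \<epsilon> + ennreal (\<epsilon> powr (1 - p)) * ennreal (\<bar>q k x\<bar> powr p) \<partial>M)"
    proof (rule nn_integral_mono)
      fix x
      have "\<bar>q k x\<bar> \<le> \<epsilon> + \<epsilon> powr (1 - p) * \<bar>q k x\<bar> powr p"
      proof (cases "\<bar>q k x\<bar> \<le> \<epsilon>")
        case True then show ?thesis by (simp add: add_increasing2)
      next
        case False
        then have q: "\<bar>q k x\<bar> > 0" "\<epsilon> \<le> \<bar>q k x\<bar>" using \<epsilon> by auto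
        have "\<bar>q k x\<bar> = \<bar>q k x\<bar> powr (1 - p) * \<bar>q k x\<bar> powr p" using q by (simp add: powr_add[symmetric])
        also have "\<dots> \<le> \<epsilon> powr (1 - p) * \<bar>q k x\<bar> powr p"
          using q \<epsilon> p by (intro mult_right_mono powr_mono2') auto
        finally show ?thesis using \<epsilon> by simp
      qed
      then have "ennreal \<bar>q k x\<bar> \<le> ennreal (\<epsilon> + \<epsilon> powr (1 - p) * \<bar>q k x\<bar> powr p)" by (rule ennreal_leI)
      then show "ennreal \<bar>q k x\<bar> \<le> ennreal \<epsilon> + ennreal (\<epsilon> powr (1 - p)) * ennreal (\<bar>q k x\<bar> powr p)"
        using \<epsilon> by (simp add: ennreal_plus ennreal_mult)
    qed
    also have "\<dots> = ennreal \<epsilon> * ennreal V + ennreal (\<epsilon> powr (1 - p)) * (\<integral>\<^sup>+x. ennreal (\<bar>q k x\<bar> powr p) \<partial>M)"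
      by (simp add: nn_integral_add nn_integral_cmult V)
    also have "\<dots> \<le> ennreal \<epsilon> * ennreal V + ennreal (\<epsilon> powr (1 - p)) * ennreal \<delta>"
      using elim by (intro add_left_mono mult_left_mono) auto
    also have "\<dots> = ennreal (\<epsilon> * V + \<epsilon> powr (1 - p) * \<delta>)"
      using \<epsilon> V \<delta> by (simp add: ennreal_plus ennreal_mult)
    also have "\<dots> < ennreal r"
    proof (rule ennreal_lessI[OF r])
      have "\<epsilon> powr (1 - p) * \<delta> = r / 2" using \<epsilon> by (simp add: \<delta>_def powr_add[symmetric])
      moreover have "\<epsilon> * V < r / 2" using r V by (simp add: \<epsilon>_def field_simps)
      ultimately show "\<epsilon> * V + \<epsilon> powr (1 - p) * \<delta> < r" by linarith
    qed
    finally show ?case .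
  qed
qed

text \<open>The truncated difference \<open>X - Y\<close> in \<open>ennreal\<close> is bounded by
  every \<open>E k\<close>, so its integral is 0. No almost everywhere convergent subsequence has to
  be extracted.\<close>

lemma AE_le_of_vanishing_error:
  fixes X Y :: "'a \<Rightarrow> ennreal"
  assumes [measurable]: "X \<in> borel_measurable M" "Y \<in> borel_measurable M" "\<And>k. E k \<in> borel_measurable M"
    and fin: "\<And>x. X x < \<infinity>"
    and le: "\<And>k::nat. AE x in M. X x \<le> Y x + E k x"
    and E: "(\<lambda>k. \<integral>\<^sup>+x. E k x \<partial>M) \<longlonglongrightarrow> 0"
  shows "AE x in M. X x \<le> Y x"
proof -
  have "(\<integral>\<^sup>+x. X x - Y x \<partial>M) \<le> (\<integral>\<^sup>+x. E k x \<partial>M)" for k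
  proof (rule nn_integral_mono_AE)
    show "AE x in M. X x - Y x \<le> E k x"
      using le[of k]
    proof eventually_elim
      case (elim x)
      then show ?case using fin[of x] by (auto simp: ennreal_minus_le_iff)
    qed
  qed
  then have "(\<integral>\<^sup>+x. X x - Y x \<partial>M) \<le> 0"
    by (intro LIMSEQ_le_const[OF E]) auto
  then have "(\<integral>\<^sup>+x. X x - Y x \<partial>M) = 0" by simp
  then have "AE x in M. X x - Y x = 0" by (subst (asm) nn_integral_0_iff_AE) auto
  then show ?thesis by eventually_elim (auto simp: diff_eq_0_iff_ennreal)
qed

text \<open>The fundamental theorem of calculus on a vertical segment. The interval is half open
  because the upper endpoint will lie on the boundary, whereas the points before it lie in the
  domain.\<close>

lemma C1_function_increment_le:
  fixes f :: "real^'n \<Rightarrow> real^'n"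
  assumes f: "C1_function f" and e: "norm e = 1" and t: "0 < t"
  shows "ennreal (norm (f (y + t *\<^sub>R e) - f y)) \<le>
    (\<integral>\<^sup>+s. ennreal (\<Sum>i\<in>UNIV. norm (jacobian f (at (y + s *\<^sub>R e)) $ i)) * indicator {0..<t} s \<partial>lborel)"
proof -
  have diff: "f differentiable (at x)" for x using f by (simp add: C1_function_def)
  have cont: "continuous_on UNIV (\<lambda>x. jacobian f (at x))" using f by (simp add: C1_function_def)
  have der: "((\<lambda>s. f (y + s *\<^sub>R e)) has_vector_derivative (jacobian f (at (y + s *\<^sub>R e)) *v e)) (at s within S)" for s S
  proof -
    have "(f has_derivative (\<lambda>h. jacobian f (at (y + s *\<^sub>R e)) *v h)) (at (y + s *\<^sub>R e))"
      using diff jacobian_works by blast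
    moreover have "((\<lambda>s. y + s *\<^sub>R e) has_derivative (\<lambda>h. h *\<^sub>R e)) (at s within S)"
      by (auto intro!: derivative_eq_intros)
    ultimately have "((\<lambda>s. f (y + s *\<^sub>R e)) has_derivative (\<lambda>h. jacobian f (at (y + s *\<^sub>R e)) *v (h *\<^sub>R e))) (at s within S)"
      by (rule has_derivative_compose[rotated])
    then show ?thesis
      by (simp add: has_vector_derivative_def matrix_vector_mult_scaleR)
  qed
  have cont2: "continuous_on S (\<lambda>s. jacobian f (at (y + s *\<^sub>R e)) *v e)" for S
  proof -
    have "continuous_on S (\<lambda>s. jacobian f (at (y + s *\<^sub>R e)))"
      by (rule continuous_on_compose2[OF cont]) (auto intro!: continuous_intros)
    then have "continuous_on S (\<lambda>s. \<chi> i. (jacobian f (at (y + s *\<^sub>R e)) $ i) \<bullet> e)"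
      by (intro continuous_intros)
    moreover have "(\<chi> i. (A $ i) \<bullet> e) = A *v e" for A :: "real^'n^'n"
      by (simp add: vec_eq_iff matrix_vector_mul_component)
    ultimately show ?thesis by simp
  qed
  have "f (y + t *\<^sub>R e) - f (y + 0 *\<^sub>R e) = (\<integral>s. indicator {0..t} s *\<^sub>R (jacobian f (at (y + s *\<^sub>R e)) *v e) \<partial>lborel)"
    by (rule integral_FTC_Icc[symmetric, OF less_imp_le[OF t] der cont2])
  then have "ennreal (norm (f (y + t *\<^sub>R e) - f y)) \<le>
     (\<integral>\<^sup>+s. ennreal (norm (indicator {0..t} s *\<^sub>R (jacobian f (at (y + s *\<^sub>R e)) *v e))) \<partial>lborel)"
    using norm_integral_le_nn_integral[of lborel "\<lambda>s. indicator {0..t} s *\<^sub>R (jacobian f (at (y + s *\<^sub>R e)) *v e)"]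
    by (simp only: scaleR_zero_left add_0_right)
  also have "\<dots> \<le> (\<integral>\<^sup>+s. ennreal (\<Sum>i\<in>UNIV. norm (jacobian f (at (y + s *\<^sub>R e)) $ i)) * indicator {0..<t} s \<partial>lborel)"
  proof (rule nn_integral_mono_AE)
    have "AE s in lborel. s \<noteq> t" by (rule AE_lborel_singleton)
    then show "AE s in lborel. ennreal (norm (indicator {0..t} s *\<^sub>R (jacobian f (at (y + s *\<^sub>R e)) *v e)))
       \<le> ennreal (\<Sum>i\<in>UNIV. norm (jacobian f (at (y + s *\<^sub>R e)) $ i)) * indicator {0..<t} s"
    proof eventually_elim
      case (elim s)
      let ?J = "jacobian f (at (y + s *\<^sub>R e))"
      have "norm (?J *v e) \<le> (\<Sum>i\<in>UNIV. \<bar>(?J *v e) $ i\<bar>)" by (rule norm_le_l1_cart)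
      also have "\<dots> \<le> (\<Sum>i\<in>UNIV. norm (?J $ i))"
        using Cauchy_Schwarz_ineq2[of "?J $ i" e for i] e
        by (intro sum_mono) (simp add: matrix_vector_mul_component)
      finally show ?case using elim by (auto simp: indicator_def intro!: ennreal_leI)
    qed
  qed
  finally show ?thesis .
qed

text \<open>For the smooth \<open>f k\<close> the estimate between \<open>y\<close> and the graph
  point above it is the fundamental theorem of calculus. Passing to \<open>v\<close>,
  \<open>w\<close> and \<open>D0\<close> costs three errors: on the graph, at \<open>y\<close>, and
  along the segment. All three tend to 0 in \<open>L^1\<close> of \<open>K\<close>: the first by
  \<open>nn_integral_graph_le_hausdorff\<close>, the last by Fubini.\<close>

lemma trace_collar_local:
  fixes v w :: "real^'n \<Rightarrow> real^'n" and f :: "nat \<Rightarrow> real^'n \<Rightarrow> real^'n" and D0 :: "'n \<Rightarrow> real^'n \<Rightarrow> real^'n"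
    and F :: "real^'n \<Rightarrow> real" and D K S :: "(real^'n) set"
  assumes p: "1 \<le> p" and e: "norm e = 1" and N: "CARD('n) = Suc m" "1 \<le> m" and b: "0 \<le> b"
    and Hm: "\<And>X :: (real^'n) set. X \<in> sets borel \<Longrightarrow> emeasure (hausdorff_measure m) X = hausdorff_outer m X"
    and D: "\<And>y s. y \<in> D \<Longrightarrow> y + s *\<^sub>R e \<in> D"
    and F[measurable]: "F \<in> borel_measurable borel" and FD: "\<And>y s. y \<in> D \<Longrightarrow> F (y + s *\<^sub>R e) = F y"
    and K: "K = {y \<in> D. 0 < F y - y \<bullet> e \<and> F y - y \<bullet> e < H}" and Kb[measurable]: "K \<in> sets borel"
    and Kfin: "emeasure lborel K < \<infinity>"
    and f: "\<And>k. C1_function (f k)"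
    and v[measurable]: "v \<in> borel_measurable borel" and D0[measurable]: "\<And>i. D0 i \<in> borel_measurable borel"
    and S[measurable]: "S \<in> sets borel"
    and PS: "\<And>y. y \<in> K \<Longrightarrow> y + (F y - y \<bullet> e) *\<^sub>R e \<in> S" and ab: "\<And>y. y \<in> K \<Longrightarrow> \<bar>y \<bullet> e - a\<bar> \<le> b"
    and cv: "\<And>i. (\<lambda>k. \<integral>\<^sup>+y. ennreal (\<bar>f k y $ i - v y $ i\<bar> powr p) \<partial>restrict_space lborel K) \<longlonglongrightarrow> 0"
    and cD: "\<And>i j. (\<lambda>k. \<integral>\<^sup>+y. ennreal (\<bar>jacobian (f k) (at y) $ i $ j - D0 i y $ j\<bar> powr p) \<partial>restrict_space lborel K) \<longlonglongrightarrow> 0"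
    and cw: "\<And>i. Lp_tendsto p (restrict_space (hausdorff_measure m) S) (\<lambda>k y. f k y $ i) (\<lambda>y. w y $ i)"
  shows "AE y in lborel. y \<in> K \<longrightarrow> ennreal (norm (w (y + (F y - y \<bullet> e) *\<^sub>R e) - v y))
     \<le> (\<integral>\<^sup>+s. ennreal (\<Sum>i\<in>UNIV. norm (D0 i (y + s *\<^sub>R e))) * indicator {0..<F y - y \<bullet> e} s \<partial>lborel)"
proof -
  let ?M = "restrict_space lborel K"
  let ?R = "restrict_space (hausdorff_measure m) S"
  define \<tau> where "\<tau> = (\<lambda>y. F y - y \<bullet> e)"
  define P where "P = (\<lambda>y. y + \<tau> y *\<^sub>R e)"
  have [measurable]: "\<tau> \<in> borel_measurable borel" unfolding \<tau>_def by measurable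
  have Pm[measurable]: "P \<in> borel_measurable borel" unfolding P_def by measurable
  have fc: "continuous_on UNIV (f k)" for k
    using f[of k] by (auto simp: C1_function_def intro!: continuous_at_imp_continuous_on differentiable_imp_continuous_within)
  have fm[measurable]: "f k \<in> borel_measurable borel" for k
    by (rule borel_measurable_continuous_onI[OF fc])
  have Jm[measurable]: "(\<lambda>y. jacobian (f k) (at y) $ i $ j) \<in> borel_measurable borel" for k i j
    using f[of k] by (intro borel_measurable_continuous_onI continuous_intros) (auto simp: C1_function_def)
  have fin: "emeasure ?M (space ?M) < \<infinity>"
    using Kfin by (simp add: space_restrict_space emeasure_restrict_space)
  have PM: "P \<in> ?M \<rightarrow>\<^sub>M ?R"
  proof -
    have "P \<in> restrict_space borel K \<rightarrow>\<^sub>M restrict_space borel S"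
      using PS by (intro measurable_restrict_space2 measurable_restrict_space1 Pm) (auto simp: space_restrict_space P_def \<tau>_def)
    then show ?thesis
      using measurable_cong_sets[of ?M "restrict_space borel K" ?R "restrict_space borel S"]
      by (simp add: sets_restrict_space)
  qed
  have sR: "sets ?R = sets (restrict_space borel S)" by (simp add: sets_restrict_space)
  have fR[measurable]: "(\<lambda>y. f k y $ i) \<in> borel_measurable ?R" for k i
  proof -
    have "(\<lambda>y. f k y $ i) \<in> borel_measurable (restrict_space borel S)"
      by (intro measurable_restrict_space1) measurable
    then show ?thesis using measurable_cong_sets[OF sR refl] by blast
  qed
  \<comment> \<open>The convergence hypothesis provides measurability of the differences only; that
    of \<open>w\<close> is recovered with the help of the continuous \<open>f 0\<close>.\<close>
  have wR[measurable]: "(\<lambda>y. w y $ i) \<in> borel_measurable ?R" for i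
  proof -
    have "(\<lambda>y. f 0 y $ i - w y $ i) \<in> borel_measurable ?R"
      using cw[of i] by (auto simp: Lp_tendsto_def Lp_def)
    then have "(\<lambda>y. f 0 y $ i - (f 0 y $ i - w y $ i)) \<in> borel_measurable ?R"
      by (rule borel_measurable_diff[OF fR])
    moreover have "f 0 y $ i - (f 0 y $ i - w y $ i) = w y $ i" for y by simp
    ultimately show ?thesis by (simp only:)
  qed
  have wP[measurable]: "(\<lambda>y. w (P y) $ i) \<in> borel_measurable ?M" for i
    using measurable_compose[OF PM wR] .
  have wPv: "(\<lambda>y. w (P y)) \<in> borel_measurable ?M"
  proof -
    have "(\<lambda>y. \<chi> i. w (P y) $ i) \<in> borel_measurable ?M" by (intro measurable_vec_lambda wP)
    then show ?thesis by simp
  qed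
  have b1: "g \<in> borel_measurable borel \<Longrightarrow> g \<in> borel_measurable ?M" for g :: "real^'n \<Rightarrow> 'c::topological_space"
    by (intro measurable_restrict_space1) simp
  define q where "q = (\<lambda>k y. \<Sum>i\<in>UNIV. \<Sum>j\<in>UNIV. \<bar>jacobian (f k) (at y) $ i $ j - D0 i y $ j\<bar>)"
  have qm[measurable]: "q k \<in> borel_measurable borel" for k unfolding q_def by measurable
  have q0: "0 \<le> q k y" for k y unfolding q_def by (intro sum_nonneg) auto
  define X where "X = (\<lambda>y. ennreal (norm (w (P y) - v y)))"
  define Y where "Y = (\<lambda>y. \<integral>\<^sup>+s. ennreal (\<Sum>i\<in>UNIV. norm (D0 i (y + s *\<^sub>R e))) * indicator {0..<\<tau> y} s \<partial>lborel)"
  define E3 where "E3 = (\<lambda>k y. \<integral>\<^sup>+s. ennreal (q k (y + s *\<^sub>R e)) * indicator {0..<\<tau> y} s \<partial>lborel)"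
  define E where "E = (\<lambda>k y. (\<Sum>i\<in>UNIV. ennreal \<bar>f k (P y) $ i - w (P y) $ i\<bar>) + (\<Sum>i\<in>UNIV. ennreal \<bar>f k y $ i - v y $ i\<bar>) + E3 k y)"
  have [measurable]: "Measurable.pred (borel \<Otimes>\<^sub>M borel) (\<lambda>x. snd x \<in> {0..<\<tau> (fst x)})"
    unfolding atLeastLessThan_iff by measurable
  have E3m: "E3 k \<in> borel_measurable borel" for k unfolding E3_def by measurable
  have Ym: "Y \<in> borel_measurable borel" unfolding Y_def by measurable
  have dm: "(\<lambda>y. f k (P y) $ i - w (P y) $ i) \<in> borel_measurable ?M" for k i
    by (intro borel_measurable_diff wP, rule b1) measurable
  have E1m: "(\<lambda>y. ennreal \<bar>f k (P y) $ i - w (P y) $ i\<bar>) \<in> borel_measurable ?M" for k i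
    by (rule measurable_compose[OF borel_measurable_abs[OF dm] measurable_ennreal])
  have E2m: "(\<lambda>y. ennreal \<bar>f k y $ i - v y $ i\<bar>) \<in> borel_measurable ?M" for k i
    by (rule b1) measurable
  have "AE y in ?M. X y \<le> Y y"
  proof (rule AE_le_of_vanishing_error[where E=E])
    show "X \<in> borel_measurable ?M" unfolding X_def
      by (rule measurable_compose[OF measurable_compose[OF borel_measurable_diff[OF wPv b1[OF v]] borel_measurable_norm] measurable_ennreal])
    show "Y \<in> borel_measurable ?M" by (rule b1[OF Ym])
    show "E k \<in> borel_measurable ?M" for k
      unfolding E_def by (intro borel_measurable_add borel_measurable_sum E1m E2m b1[OF E3m])
    show "X y < \<infinity>" for y by (simp add: X_def)
    show "AE y in ?M. X y \<le> Y y + E k y" for k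
    proof (rule AE_I2)
      fix y assume "y \<in> space ?M"
      then have y: "y \<in> K" by (simp add: space_restrict_space)
      then have \<tau>y: "0 < \<tau> y" by (simp add: K \<tau>_def)
      have "norm (w (P y) - v y) \<le> norm (f k (P y) - w (P y)) + norm (f k (P y) - f k y) + norm (f k y - v y)"
      proof -
        have "w (P y) - v y = (f k (P y) - f k y) + (f k y - v y) - (f k (P y) - w (P y))" by simp
        then show ?thesis using norm_triangle_ineq4[of "(f k (P y) - f k y) + (f k y - v y)" "f k (P y) - w (P y)"]
          norm_triangle_ineq[of "f k (P y) - f k y" "f k y - v y"] by simp
      qed
      also have "\<dots> \<le> (\<Sum>i\<in>UNIV. \<bar>f k (P y) $ i - w (P y) $ i\<bar>) + norm (f k (P y) - f k y) + (\<Sum>i\<in>UNIV. \<bar>f k y $ i - v y $ i\<bar>)"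
        using norm_le_l1_cart[of "f k (P y) - w (P y)"] norm_le_l1_cart[of "f k y - v y"] by simp
      finally have "X y \<le> ennreal ((\<Sum>i\<in>UNIV. \<bar>f k (P y) $ i - w (P y) $ i\<bar>) + norm (f k (P y) - f k y) + (\<Sum>i\<in>UNIV. \<bar>f k y $ i - v y $ i\<bar>))"
        unfolding X_def by (rule ennreal_leI)
      also have "\<dots> = (\<Sum>i\<in>UNIV. ennreal \<bar>f k (P y) $ i - w (P y) $ i\<bar>) + ennreal (norm (f k (P y) - f k y)) + (\<Sum>i\<in>UNIV. ennreal \<bar>f k y $ i - v y $ i\<bar>)"
        by (simp add: ennreal_plus sum_nonneg add_nonneg_nonneg sum_ennreal)
      also have "ennreal (norm (f k (P y) - f k y)) \<le> Y y + E3 k y"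
      proof -
        have "ennreal (norm (f k (P y) - f k y)) \<le> (\<integral>\<^sup>+s. ennreal (\<Sum>i\<in>UNIV. norm (jacobian (f k) (at (y + s *\<^sub>R e)) $ i)) * indicator {0..<\<tau> y} s \<partial>lborel)"
          unfolding P_def by (rule C1_function_increment_le[OF f e \<tau>y])
        also have "\<dots> \<le> (\<integral>\<^sup>+s. ennreal (\<Sum>i\<in>UNIV. norm (D0 i (y + s *\<^sub>R e))) * indicator {0..<\<tau> y} s
            + ennreal (q k (y + s *\<^sub>R e)) * indicator {0..<\<tau> y} s \<partial>lborel)"
        proof (rule nn_integral_mono)
          fix s :: real
          let ?y = "y + s *\<^sub>R e"
          have "norm (jacobian (f k) (at ?y) $ i) \<le> norm (D0 i ?y) + (\<Sum>j\<in>UNIV. \<bar>jacobian (f k) (at ?y) $ i $ j - D0 i ?y $ j\<bar>)" for i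
            using norm_triangle_sub[of "jacobian (f k) (at ?y) $ i" "D0 i ?y"] norm_le_l1_cart[of "jacobian (f k) (at ?y) $ i - D0 i ?y"] by simp
          then have "(\<Sum>i\<in>UNIV. norm (jacobian (f k) (at ?y) $ i)) \<le> (\<Sum>i\<in>UNIV. norm (D0 i ?y)) + q k ?y"
            unfolding q_def sum.distrib[symmetric] by (rule sum_mono)
          then have "ennreal (\<Sum>i\<in>UNIV. norm (jacobian (f k) (at ?y) $ i)) \<le> ennreal ((\<Sum>i\<in>UNIV. norm (D0 i ?y)) + q k ?y)"
            by (rule ennreal_leI)
          also have "\<dots> = ennreal (\<Sum>i\<in>UNIV. norm (D0 i ?y)) + ennreal (q k ?y)"
            by (rule ennreal_plus) (simp_all add: sum_nonneg q0)
          finally show "ennreal (\<Sum>i\<in>UNIV. norm (jacobian (f k) (at ?y) $ i)) * indicator {0..<\<tau> y} s \<le>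
            ennreal (\<Sum>i\<in>UNIV. norm (D0 i ?y)) * indicator {0..<\<tau> y} s + ennreal (q k ?y) * indicator {0..<\<tau> y} s"
            by (auto simp: indicator_def)
        qed
        also have "\<dots> = Y y + E3 k y"
          unfolding Y_def E3_def by (rule nn_integral_add) measurable
        finally show ?thesis .
      qed
      finally show "X y \<le> Y y + E k y" by (simp add: E_def ac_simps)
    qed
    have L1: "(\<lambda>k. \<integral>\<^sup>+y. ennreal \<bar>f k (P y) $ i - w (P y) $ i\<bar> \<partial>?M) \<longlonglongrightarrow> 0" for i
    proof (rule nn_integral_tendsto_0_of_powr[OF p fin])
      show "(\<lambda>y. f k (P y) $ i - w (P y) $ i) \<in> borel_measurable ?M" for k
        by (rule dm)
      define Q where "Q = ennreal ((2 * b + 1) * unit_ball_vol (real (Suc m)) * 2 ^ Suc m * 2 ^ m / unit_ball_vol (real m))"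
      have le: "(\<integral>\<^sup>+y. ennreal (\<bar>f k (P y) $ i - w (P y) $ i\<bar> powr p) \<partial>?M) \<le> Q * (\<integral>\<^sup>+x. ennreal (\<bar>f k x $ i - w x $ i\<bar> powr p) \<partial>?R)" for k
        unfolding Q_def
      proof (rule nn_integral_graph_le_hausdorff[OF e _ N(2) b Hm Kb S, where a=a])
        show "DIM(real^'n) = Suc m" using N by simp
        show "P \<in> restrict_space borel K \<rightarrow>\<^sub>M borel" by (intro measurable_restrict_space1 Pm)
        show "P y \<in> S \<and> horizontal e (P y) = horizontal e y \<and> \<bar>y \<bullet> e - a\<bar> \<le> b" if "y \<in> K" for y
          using PS[OF that] ab[OF that] by (simp add: P_def \<tau>_def horizontal_add_scaleR[OF e])
        show "(\<lambda>x. ennreal (\<bar>f k x $ i - w x $ i\<bar> powr p)) \<in> borel_measurable ?R" using fR wR by measurable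
      qed
      have "(\<lambda>k. Q * (\<integral>\<^sup>+x. ennreal (\<bar>f k x $ i - w x $ i\<bar> powr p) \<partial>?R)) \<longlonglongrightarrow> Q * 0"
        by (intro ennreal_tendsto_cmult Lp_tendsto_nn_integral[OF p cw]) (simp add: Q_def)
      then have "(\<lambda>k. Q * (\<integral>\<^sup>+x. ennreal (\<bar>f k x $ i - w x $ i\<bar> powr p) \<partial>?R)) \<longlonglongrightarrow> 0" by simp
      then show "(\<lambda>k. \<integral>\<^sup>+y. ennreal (\<bar>f k (P y) $ i - w (P y) $ i\<bar> powr p) \<partial>?M) \<longlonglongrightarrow> 0"
        by (rule tendsto_sandwich[OF _ _ tendsto_const, rotated 2]) (use le in auto)
    qed
    have L2: "(\<lambda>k. \<integral>\<^sup>+y. ennreal \<bar>f k y $ i - v y $ i\<bar> \<partial>?M) \<longlonglongrightarrow> 0" for i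
      by (rule nn_integral_tendsto_0_of_powr[OF p fin _ cv]) (rule b1, measurable)
    have Lq: "(\<lambda>k. \<integral>\<^sup>+y. ennreal (q k y) \<partial>?M) \<longlonglongrightarrow> 0"
    proof -
      have "(\<lambda>k. \<Sum>i\<in>UNIV. \<Sum>j\<in>UNIV. \<integral>\<^sup>+y. ennreal \<bar>jacobian (f k) (at y) $ i $ j - D0 i y $ j\<bar> \<partial>?M) \<longlonglongrightarrow> (\<Sum>i\<in>(UNIV::'n set). \<Sum>j\<in>(UNIV::'n set). 0)"
        by (intro tendsto_sum nn_integral_tendsto_0_of_powr[OF p fin _ cD]) (rule b1, measurable)
      moreover have "(\<integral>\<^sup>+y. ennreal (q k y) \<partial>?M) = (\<Sum>i\<in>UNIV. \<Sum>j\<in>UNIV. \<integral>\<^sup>+y. ennreal \<bar>jacobian (f k) (at y) $ i $ j - D0 i y $ j\<bar> \<partial>?M)" for k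
      proof -
        have m: "(\<lambda>y. ennreal \<bar>jacobian (f k) (at y) $ i $ j - D0 i y $ j\<bar>) \<in> borel_measurable ?M" for i j
          by (rule b1) measurable
        have "(\<integral>\<^sup>+y. ennreal (q k y) \<partial>?M) = (\<integral>\<^sup>+y. (\<Sum>i\<in>UNIV. \<Sum>j\<in>UNIV. ennreal \<bar>jacobian (f k) (at y) $ i $ j - D0 i y $ j\<bar>) \<partial>?M)"
          unfolding q_def by (simp add: sum_ennreal sum_nonneg)
        also have "\<dots> = (\<Sum>i\<in>UNIV. \<integral>\<^sup>+y. (\<Sum>j\<in>UNIV. ennreal \<bar>jacobian (f k) (at y) $ i $ j - D0 i y $ j\<bar>) \<partial>?M)"
          by (rule nn_integral_sum) (intro borel_measurable_sum m)
        also have "\<dots> = (\<Sum>i\<in>UNIV. \<Sum>j\<in>UNIV. \<integral>\<^sup>+y. ennreal \<bar>jacobian (f k) (at y) $ i $ j - D0 i y $ j\<bar> \<partial>?M)"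
          by (intro sum.cong refl nn_integral_sum m)
        finally show ?thesis .
      qed
      ultimately show ?thesis by simp
    qed
    \<comment> \<open>For fixed \<open>s\<close> the point \<open>y + s e\<close> is again in
      \<open>K\<close>, at depth smaller by \<open>s\<close>, so by translation the inner integral
      is at most the integral over \<open>K\<close>; and \<open>s\<close> runs over an interval of
      length \<open>\<bar>H\<bar>\<close>.\<close>
    have E3le: "(\<integral>\<^sup>+y. E3 k y \<partial>?M) \<le> ennreal \<bar>H\<bar> * (\<integral>\<^sup>+y. ennreal (q k y) \<partial>?M)" for k
    proof -
      have "(\<integral>\<^sup>+y. E3 k y \<partial>?M) = (\<integral>\<^sup>+y. E3 k y * indicator K y \<partial>lborel)"
        by (rule nn_integral_restrict_space) simp
      also have "\<dots> = (\<integral>\<^sup>+y. \<integral>\<^sup>+s. ennreal (q k (y + s *\<^sub>R e)) * indicator {0..<\<tau> y} s * indicator K y \<partial>lborel \<partial>lborel)"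
        unfolding E3_def by (intro nn_integral_cong nn_integral_multc[symmetric]) measurable
      also have "\<dots> = (\<integral>\<^sup>+s. \<integral>\<^sup>+y. ennreal (q k (y + s *\<^sub>R e)) * indicator {0..<\<tau> y} s * indicator K y \<partial>lborel \<partial>lborel)"
        by (rule lborel_pair.Fubini'[symmetric]) measurable
      also have "\<dots> \<le> (\<integral>\<^sup>+s. \<integral>\<^sup>+y. indicator {0..\<bar>H\<bar>} s * (ennreal (q k (y + s *\<^sub>R e)) * indicator K (y + s *\<^sub>R e)) \<partial>lborel \<partial>lborel)"
      proof (intro nn_integral_mono)
        fix s :: real and y :: "real^'n"
        show "ennreal (q k (y + s *\<^sub>R e)) * indicator {0..<\<tau> y} s * indicator K y
          \<le> indicator {0..\<bar>H\<bar>} s * (ennreal (q k (y + s *\<^sub>R e)) * indicator K (y + s *\<^sub>R e))"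
        proof (cases "y \<in> K \<and> s \<in> {0..<\<tau> y}")
          case True
          then have "y + s *\<^sub>R e \<in> K" "s \<in> {0..\<bar>H\<bar>}"
            using D[of y s] FD[of y s] e unfolding K \<tau>_def by (auto simp: inner_add_left dot_square_norm)
          then show ?thesis using True by simp
        qed auto
      qed
      also have "\<dots> = (\<integral>\<^sup>+s. indicator {0..\<bar>H\<bar>} s * (\<integral>\<^sup>+y. ennreal (q k y) * indicator K y \<partial>lborel) \<partial>lborel)"
        by (subst nn_integral_cmult, measurable)
           (subst nn_integral_lborel_shift[of "\<lambda>y. ennreal (q k y) * indicator K y"], auto)
      also have "\<dots> = ennreal \<bar>H\<bar> * (\<integral>\<^sup>+y. ennreal (q k y) \<partial>?M)"
        by (simp add: nn_integral_multc nn_integral_restrict_space)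
      finally show ?thesis .
    qed
    have L3: "(\<lambda>k. \<integral>\<^sup>+y. E3 k y \<partial>?M) \<longlonglongrightarrow> 0"
    proof -
      have "(\<lambda>k. ennreal \<bar>H\<bar> * (\<integral>\<^sup>+y. ennreal (q k y) \<partial>?M)) \<longlonglongrightarrow> ennreal \<bar>H\<bar> * 0"
        by (intro ennreal_tendsto_cmult Lq) simp
      then have "(\<lambda>k. ennreal \<bar>H\<bar> * (\<integral>\<^sup>+y. ennreal (q k y) \<partial>?M)) \<longlonglongrightarrow> 0" by simp
      then show ?thesis
        by (rule tendsto_sandwich[OF _ _ tendsto_const, rotated 2]) (use E3le in auto)
    qed
    have "(\<integral>\<^sup>+y. E k y \<partial>?M) = (\<Sum>i\<in>UNIV. \<integral>\<^sup>+y. ennreal \<bar>f k (P y) $ i - w (P y) $ i\<bar> \<partial>?M)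
        + (\<Sum>i\<in>UNIV. \<integral>\<^sup>+y. ennreal \<bar>f k y $ i - v y $ i\<bar> \<partial>?M) + (\<integral>\<^sup>+y. E3 k y \<partial>?M)" for k
    proof -
      have m1: "(\<lambda>y. \<Sum>i\<in>UNIV. ennreal \<bar>f k (P y) $ i - w (P y) $ i\<bar>) \<in> borel_measurable ?M"
        and m2: "(\<lambda>y. \<Sum>i\<in>UNIV. ennreal \<bar>f k y $ i - v y $ i\<bar>) \<in> borel_measurable ?M"
        by (intro borel_measurable_sum E1m E2m)+
      have "(\<integral>\<^sup>+y. (\<Sum>i\<in>UNIV. ennreal \<bar>f k (P y) $ i - w (P y) $ i\<bar>) \<partial>?M) = (\<Sum>i\<in>UNIV. \<integral>\<^sup>+y. ennreal \<bar>f k (P y) $ i - w (P y) $ i\<bar> \<partial>?M)"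
        "(\<integral>\<^sup>+y. (\<Sum>i\<in>UNIV. ennreal \<bar>f k y $ i - v y $ i\<bar>) \<partial>?M) = (\<Sum>i\<in>UNIV. \<integral>\<^sup>+y. ennreal \<bar>f k y $ i - v y $ i\<bar> \<partial>?M)"
        by (intro nn_integral_sum E1m E2m)+
      then show ?thesis unfolding E_def
        by (simp only: nn_integral_add[OF borel_measurable_add[OF m1 m2] b1[OF E3m]] nn_integral_add[OF m1 m2])
    qed
    moreover have "(\<lambda>k. (\<Sum>i\<in>UNIV. \<integral>\<^sup>+y. ennreal \<bar>f k (P y) $ i - w (P y) $ i\<bar> \<partial>?M)
        + (\<Sum>i\<in>UNIV. \<integral>\<^sup>+y. ennreal \<bar>f k y $ i - v y $ i\<bar> \<partial>?M) + (\<integral>\<^sup>+y. E3 k y \<partial>?M)) \<longlonglongrightarrow> (\<Sum>i\<in>(UNIV::'n set). 0) + (\<Sum>i\<in>(UNIV::'n set). 0) + 0"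
      by (intro tendsto_add tendsto_sum L1 L2 L3)
    ultimately show "(\<lambda>k. \<integral>\<^sup>+y. E k y \<partial>?M) \<longlonglongrightarrow> 0" by simp
  qed
  then have "AE y in lborel. y \<in> K \<longrightarrow> X y \<le> Y y"
    by (subst (asm) AE_restrict_space_iff) auto
  then show ?thesis by (simp add: X_def Y_def P_def \<tau>_def)
qed

lemma nn_integral_restrict_lborel_le_lebesgue_on:
  fixes q q' :: "'a::euclidean_space \<Rightarrow> ennreal"
  assumes [measurable]: "q \<in> borel_measurable borel" "K \<in> sets borel" and S: "S \<in> sets lebesgue" and KS: "K \<subseteq> S"
    and eq: "AE x in lborel. x \<in> S \<longrightarrow> q x = q' x"
  shows "(\<integral>\<^sup>+x. q x \<partial>restrict_space lborel K) \<le> (\<integral>\<^sup>+x. q' x \<partial>lebesgue_on S)"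
proof -
  have "(\<integral>\<^sup>+x. q x \<partial>restrict_space lborel K) = (\<integral>\<^sup>+x. q x * indicator K x \<partial>lborel)"
    by (rule nn_integral_restrict_space) simp
  also have "\<dots> = (\<integral>\<^sup>+x. q x * indicator K x \<partial>lebesgue)"
    by (rule nn_integral_completion[symmetric])
  also have "\<dots> \<le> (\<integral>\<^sup>+x. q' x * indicator S x \<partial>lebesgue)"
  proof (rule nn_integral_mono_AE)
    show "AE x in lebesgue. q x * indicator K x \<le> q' x * indicator S x"
      unfolding AE_completion_iff using eq by eventually_elim (use KS in \<open>auto simp: indicator_def\<close>)
  qed
  also have "\<dots> = (\<integral>\<^sup>+x. q' x \<partial>lebesgue_on S)"
    by (rule nn_integral_restrict_space[symmetric]) (use S in simp)
  finally show ?thesis .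
qed

text \<open>Inside a small cylinder about \<open>z\<close> the boundary belongs to \<open>A\<close>
  and the approximations from \<open>has_trace\<close> are available, so
  \<open>trace_collar_local\<close> applies. The Jacobian that comes with the neighbourhood is first
  identified with \<open>D0\<close>.\<close>

lemma trace_near_point:
  fixes v w v0 :: "real^'n \<Rightarrow> real^'n" and D :: "real^'n \<Rightarrow> real^'n^'n" and D0 :: "'n \<Rightarrow> real^'n \<Rightarrow> real^'n"
  assumes p: "1 \<le> p" and N: "CARD('n) = Suc m" "1 \<le> m"
    and Hm: "\<And>X :: (real^'n) set. X \<in> sets borel \<Longrightarrow> emeasure (hausdorff_measure m) X = hausdorff_outer m X"
    and G: "open G" and A: "A = frontier G \<inter> Q" "open Q"
    and chart: "graph_chart G U e \<phi>" and z: "z \<in> A" "z \<in> U"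
    and tr: "has_trace p G A v w"
    and v0[measurable]: "v0 \<in> borel_measurable borel" and wg: "\<And>i. weak_gradient G (\<lambda>x. v0 x $ i) (D0 i)"
    and eq: "AE x in lborel. x \<in> G \<longrightarrow> v x = v0 x"
  shows "\<exists>W. open W \<and> z \<in> W \<and> (AE y in lborel. y \<in> G \<inter> W \<longrightarrow>
     ennreal (norm (w (y + (\<phi> (horizontal e y) - y \<bullet> e) *\<^sub>R e) - v0 y))
     \<le> (\<integral>\<^sup>+s. ennreal (\<Sum>i\<in>UNIV. norm (D0 i (y + s *\<^sub>R e))) * indicator {0..<\<phi> (horizontal e y) - y \<bullet> e} s \<partial>lborel))"
proof -
  have U: "open U" "norm e = 1" "frontier G \<inter> U = {y \<in> U. y \<bullet> e = \<phi> (horizontal e y)}"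
    "G \<inter> U = {y \<in> U. y \<bullet> e < \<phi> (horizontal e y)}"
    using chart by (auto simp: graph_chart_def)
  have [measurable]: "D0 i \<in> borel_measurable borel" for i using wg by (auto simp: weak_gradient_def)
  from tr[unfolded has_trace_def, THEN bspec, OF z(1)] obtain U' D' f where U': "open U'" "z \<in> U'"
    and D': "weak_jacobian (G \<inter> U') v D'" and f': "\<forall>k::nat. C1_function (f k)"
    and fv': "\<forall>i. Lp_tendsto p (lebesgue_on (G \<inter> U')) (\<lambda>k y. f k y $ i) (\<lambda>y. v y $ i)"
    and fD': "\<forall>i j. Lp_tendsto p (lebesgue_on (G \<inter> U')) (\<lambda>k y. jacobian (f k) (at y) $ i $ j) (\<lambda>y. D' y $ i $ j)"
    and fw': "\<forall>i. Lp_tendsto p (restrict_space (hausdorff_measure (CARD('n) - 1)) (A \<inter> U')) (\<lambda>k y. f k y $ i) (\<lambda>y. w y $ i)"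
    by (elim exE conjE)
  note f = f'[rule_format] and fv = fv'[rule_format] and fD = fD'[rule_format] and fw = fw'[rule_format]
  have GU: "open (G \<inter> U')" using G U' by auto
  obtain v1 D1 where v1: "v1 \<in> borel_measurable borel" "\<And>i. D1 i \<in> borel_measurable borel"
    "AE x in lborel. x \<in> G \<inter> U' \<longrightarrow> v x = v1 x \<and> (\<forall>i. D' x $ i = D1 i x)"
    "\<And>i. weak_gradient (G \<inter> U') (\<lambda>x. v1 x $ i) (D1 i)"
    by (rule weak_jacobian_ex_borel[OF GU D']) (rule that)
  have "AE x in lborel. x \<in> (G \<inter> U') \<inter> G \<longrightarrow> D1 i x = D0 i x" for i
  proof (rule weak_gradient_unique[OF v1(4) wg GU G])
    show "AE x in lborel. x \<in> (G \<inter> U') \<inter> G \<longrightarrow> v1 x $ i = v0 x $ i"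
      using v1(3) eq by eventually_elim auto
  qed
  then have "AE x in lborel. \<forall>i\<in>UNIV. x \<in> (G \<inter> U') \<inter> G \<longrightarrow> D1 i x = D0 i x"
    by (subst AE_ball_countable) auto
  with v1(3) have eqD: "AE x in lborel. x \<in> G \<inter> U' \<longrightarrow> (\<forall>i. D' x $ i = D0 i x)"
    by eventually_elim auto
  have zf: "z \<in> frontier G" using z A by auto
  have "open (U' \<inter> Q)" "z \<in> U' \<inter> Q" using U' A z by auto
  from graph_chart_cylinder[OF chart zf z(2) this] obtain \<rho> \<eta> where \<rho>: "0 < \<rho>" and \<eta>: "0 < \<eta>"
    and cyl: "\<And>y. norm (horizontal e (y - z)) \<le> \<rho> \<Longrightarrow> \<bar>y \<bullet> e - z \<bullet> e\<bar> < 8 * \<eta> \<Longrightarrow> y \<in> U \<inter> (U' \<inter> Q)"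
    and \<phi>: "\<And>y. norm (horizontal e (y - z)) \<le> \<rho> \<Longrightarrow> \<bar>\<phi> (horizontal e y) - z \<bullet> e\<bar> < \<eta>"
    and cont: "continuous_on {y. norm (horizontal e (y - z)) \<le> \<rho>} (\<lambda>y. \<phi> (horizontal e y))"
    by metis
  define DD where "DD = {y. norm (horizontal e (y - z)) \<le> \<rho>}"
  \<comment> \<open>The graph function extended by 0 off the closed cylinder, which makes it Borel
    on the whole space.\<close>
  define F where "F = (\<lambda>y. indicator DD y *\<^sub>R \<phi> (horizontal e y))"
  define K where "K = {y \<in> DD. 0 < F y - y \<bullet> e \<and> F y - y \<bullet> e < 2 * \<eta>}"
  define W where "W = {y. norm (horizontal e (y - z)) < \<rho> \<and> \<bar>(y - z) \<bullet> e\<bar> < \<eta>}"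
  have ch: "continuous_on S (\<lambda>y. norm (horizontal e (y - z)))" for S
    by (intro continuous_intros continuous_on_compose2[OF continuous_on_horizontal[of UNIV]]) auto
  have DDc: "closed DD" unfolding DD_def by (rule closed_Collect_le[OF ch continuous_on_const])
  then have [measurable]: "DD \<in> sets borel" by (rule borel_closed)
  have Fm[measurable]: "F \<in> borel_measurable borel"
    unfolding F_def by (rule borel_measurable_continuous_on_indicator) (use cont in \<open>auto simp: DD_def[symmetric]\<close>)
  have Km: "K \<in> sets borel" unfolding K_def by measurable
  have FD: "F y = \<phi> (horizontal e y)" if "y \<in> DD" for y using that by (simp add: F_def)
  \<comment> \<open>Depth below \<open>2 * \<eta>\<close> under a graph within \<open>\<eta>\<close>
    of the height of \<open>z\<close> keeps \<open>y\<close> within \<open>3 * \<eta>\<close> of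
    that height, well inside the cylinder.\<close>
  have Kp: "\<bar>y \<bullet> e - z \<bullet> e\<bar> \<le> 3 * \<eta> \<and> y \<in> G \<inter> U' \<and> y + (F y - y \<bullet> e) *\<^sub>R e \<in> A \<inter> U'" if "y \<in> K" for y
  proof -
    have y: "y \<in> DD" "0 < F y - y \<bullet> e" "F y - y \<bullet> e < 2 * \<eta>" using that by (auto simp: K_def)
    then have n: "norm (horizontal e (y - z)) \<le> \<rho>" by (simp add: DD_def)
    have h: "\<bar>y \<bullet> e - z \<bullet> e\<bar> < 3 * \<eta>" using \<phi>[OF n] y FD[OF y(1)] by auto
    then have yU: "y \<in> U \<inter> (U' \<inter> Q)" using cyl[OF n] \<eta> by auto
    have "y \<in> G" using yU y FD[OF y(1)] U(4) by auto
    let ?P = "y + (F y - y \<bullet> e) *\<^sub>R e"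
    have Pe: "?P \<bullet> e = F y" using U(2) by (simp add: inner_add_left dot_square_norm)
    have Ph: "horizontal e ?P = horizontal e y" by (rule horizontal_add_scaleR[OF U(2)])
    have "?P \<in> U \<inter> (U' \<inter> Q)"
    proof (rule cyl)
      show "norm (horizontal e (?P - z)) \<le> \<rho>" using n by (simp add: horizontal_diff Ph)
      show "\<bar>?P \<bullet> e - z \<bullet> e\<bar> < 8 * \<eta>" unfolding Pe using \<phi>[OF n] \<eta> FD[OF y(1)] by auto
    qed
    then have PU: "?P \<in> U" and PQ: "?P \<in> U'" "?P \<in> Q" by auto
    have "?P \<bullet> e = \<phi> (horizontal e ?P)"
      by (rule trans[OF Pe], rule trans[OF FD[OF y(1)]], rule arg_cong[OF Ph[symmetric]])
    then have "?P \<in> frontier G \<inter> U" unfolding U(3) using PU by blast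
    then have "?P \<in> A \<inter> U'" unfolding A(1) using PQ by blast
    moreover have "y \<in> G \<inter> U'" using yU \<open>y \<in> G\<close> by blast
    ultimately show ?thesis using less_imp_le[OF h] by blast
  qed
  have Kfin: "emeasure lborel K < \<infinity>"
  proof (rule emeasure_bounded_finite, rule bounded_subset[of "cball z (\<rho> + 3 * \<eta>)"])
    show "K \<subseteq> cball z (\<rho> + 3 * \<eta>)"
    proof
      fix y assume "y \<in> K"
      then show "y \<in> cball z (\<rho> + 3 * \<eta>)"
        using Kp[of y] norm_le_horizontal[OF U(2), of "y - z"]
        by (auto simp: K_def DD_def dist_norm norm_minus_commute inner_diff_left)
    qed
  qed simp
  have Sm: "G \<inter> U' \<in> sets lebesgue" using GU by auto
  have KGU: "K \<subseteq> G \<inter> U'" using Kp by auto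
  have AUm: "A \<inter> U' \<in> sets borel" using A U' by (auto intro!: sets.Int borel_closed)
  have m: "CARD('n) - 1 = m" using N by simp
  have T: "AE y in lborel. y \<in> K \<longrightarrow> ennreal (norm (w (y + (F y - y \<bullet> e) *\<^sub>R e) - v0 y))
     \<le> (\<integral>\<^sup>+s. ennreal (\<Sum>i\<in>UNIV. norm (D0 i (y + s *\<^sub>R e))) * indicator {0..<F y - y \<bullet> e} s \<partial>lborel)"
  proof (rule trace_collar_local[OF p U(2) N _ Hm _ Fm _ K_def Km Kfin f v0, where b="3 * \<eta>" and a="z \<bullet> e" and S="A \<inter> U'"])
    show "0 \<le> 3 * \<eta>" using \<eta> by simp
    fix y :: "real^'n" and s
    assume "y \<in> DD"
    then show "y + s *\<^sub>R e \<in> DD" by (simp add: DD_def horizontal_diff horizontal_add_scaleR[OF U(2)])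
    then show "F (y + s *\<^sub>R e) = F y" using \<open>y \<in> DD\<close> by (simp add: FD horizontal_add_scaleR[OF U(2)])
  next
    fix i
    show "D0 i \<in> borel_measurable borel" by measurable
    have eqk: "AE y in lborel. y \<in> G \<inter> U' \<longrightarrow> ennreal (\<bar>f k y $ i - v0 y $ i\<bar> powr p) = ennreal (\<bar>f k y $ i - v y $ i\<bar> powr p)" for k
      using eq by eventually_elim auto
    have fm[measurable]: "f k \<in> borel_measurable borel" for k
      using f[of k] by (intro borel_measurable_continuous_onI)
        (auto simp: C1_function_def intro!: continuous_at_imp_continuous_on differentiable_imp_continuous_within)
    have "(\<integral>\<^sup>+y. ennreal (\<bar>f k y $ i - v0 y $ i\<bar> powr p) \<partial>restrict_space lborel K) \<le>
      (\<integral>\<^sup>+y. ennreal (\<bar>f k y $ i - v y $ i\<bar> powr p) \<partial>lebesgue_on (G \<inter> U'))" for k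
      by (rule nn_integral_restrict_lborel_le_lebesgue_on[OF _ Km Sm KGU eqk]) measurable
    then show "(\<lambda>k. \<integral>\<^sup>+y. ennreal (\<bar>f k y $ i - v0 y $ i\<bar> powr p) \<partial>restrict_space lborel K) \<longlonglongrightarrow> 0"
      by (intro tendsto_sandwich[OF _ _ tendsto_const Lp_tendsto_nn_integral[OF p fv[of i]]]) auto
  next
    fix i j
    have eqk: "AE y in lborel. y \<in> G \<inter> U' \<longrightarrow> ennreal (\<bar>jacobian (f k) (at y) $ i $ j - D0 i y $ j\<bar> powr p)
       = ennreal (\<bar>jacobian (f k) (at y) $ i $ j - D' y $ i $ j\<bar> powr p)" for k
      using eqD by eventually_elim auto
    have [measurable]: "(\<lambda>y. jacobian (f k) (at y) $ i $ j) \<in> borel_measurable borel" for k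
      using f[of k] by (intro borel_measurable_continuous_onI continuous_intros) (auto simp: C1_function_def)
    have "(\<integral>\<^sup>+y. ennreal (\<bar>jacobian (f k) (at y) $ i $ j - D0 i y $ j\<bar> powr p) \<partial>restrict_space lborel K) \<le>
      (\<integral>\<^sup>+y. ennreal (\<bar>jacobian (f k) (at y) $ i $ j - D' y $ i $ j\<bar> powr p) \<partial>lebesgue_on (G \<inter> U'))" for k
      by (rule nn_integral_restrict_lborel_le_lebesgue_on[OF _ Km Sm KGU eqk]) measurable
    then show "(\<lambda>k. \<integral>\<^sup>+y. ennreal (\<bar>jacobian (f k) (at y) $ i $ j - D0 i y $ j\<bar> powr p) \<partial>restrict_space lborel K) \<longlonglongrightarrow> 0"
      by (intro tendsto_sandwich[OF _ _ tendsto_const Lp_tendsto_nn_integral[OF p fD[of i j]]]) auto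
  next
    show "A \<inter> U' \<in> sets borel" by (rule AUm)
    show "y + (F y - y \<bullet> e) *\<^sub>R e \<in> A \<inter> U'" "\<bar>y \<bullet> e - z \<bullet> e\<bar> \<le> 3 * \<eta>" if "y \<in> K" for y using Kp[OF that] by auto
    show "Lp_tendsto p (restrict_space (hausdorff_measure m) (A \<inter> U')) (\<lambda>k y. f k y $ i) (\<lambda>y. w y $ i)" for i
      using fw[of i] unfolding m .
  qed
  have KW: "y \<in> K \<and> F y = \<phi> (horizontal e y)" if "y \<in> G \<inter> W" for y
  proof -
    have n: "norm (horizontal e (y - z)) \<le> \<rho>" "\<bar>y \<bullet> e - z \<bullet> e\<bar> < \<eta>" using that by (auto simp: W_def inner_diff_left)
    then have "y \<in> DD" by (simp add: DD_def)
    moreover have "y \<in> U" using cyl[OF n(1)] n \<eta> by auto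
    then have "y \<bullet> e < \<phi> (horizontal e y)" using that U(4) by blast
    moreover have "\<phi> (horizontal e y) - y \<bullet> e < 2 * \<eta>" using \<phi>[OF n(1)] n(2) by auto
    ultimately show ?thesis using FD[of y] by (auto simp: K_def)
  qed
  have "AE y in lborel. y \<in> G \<inter> W \<longrightarrow>
     ennreal (norm (w (y + (\<phi> (horizontal e y) - y \<bullet> e) *\<^sub>R e) - v0 y))
     \<le> (\<integral>\<^sup>+s. ennreal (\<Sum>i\<in>UNIV. norm (D0 i (y + s *\<^sub>R e))) * indicator {0..<\<phi> (horizontal e y) - y \<bullet> e} s \<partial>lborel)"
    using T
  proof eventually_elim
    case (elim y)
    show ?case
    proof
      assume y: "y \<in> G \<inter> W"
      have "F y = \<phi> (horizontal e y)" using KW[OF y] by blast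
      then show "ennreal (norm (w (y + (\<phi> (horizontal e y) - y \<bullet> e) *\<^sub>R e) - v0 y))
        \<le> (\<integral>\<^sup>+s. ennreal (\<Sum>i\<in>UNIV. norm (D0 i (y + s *\<^sub>R e))) * indicator {0..<\<phi> (horizontal e y) - y \<bullet> e} s \<partial>lborel)"
        using elim KW[OF y] by simp
    qed
  qed
  moreover have "open W"
    unfolding W_def Collect_conj_eq
    by (intro open_Int open_Collect_less ch continuous_on_rabs continuous_on_const continuous_intros)
  moreover have "z \<in> W" using \<rho> \<eta> by (simp add: W_def horizontal_def)
  ultimately show ?thesis by blast
qed

section \<open>From neighbourhoods depending on the field to a fixed collar\<close>

lemma nn_integral_segment_scale:
  fixes h :: "real \<Rightarrow> ennreal"
  assumes [measurable]: "h \<in> borel_measurable borel" and s: "0 < \<sigma>"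
  shows "ennreal \<sigma> * (\<integral>\<^sup>+r. h (r * \<sigma>) * indicator {0..1} r \<partial>lborel) = (\<integral>\<^sup>+r. h r * indicator {0..\<sigma>} r \<partial>lborel)"
proof -
  have "(\<integral>\<^sup>+r. h r * indicator {0..\<sigma>} r \<partial>lborel) = ennreal \<bar>\<sigma>\<bar> * (\<integral>\<^sup>+r. h (0 + \<sigma> * r) * indicator {0..\<sigma>} (0 + \<sigma> * r) \<partial>lborel)"
    using s by (intro nn_integral_real_affine) auto
  also have "(\<integral>\<^sup>+r. h (0 + \<sigma> * r) * indicator {0..\<sigma>} (0 + \<sigma> * r) \<partial>lborel) = (\<integral>\<^sup>+r. h (r * \<sigma>) * indicator {0..1} r \<partial>lborel)"
    using s by (intro nn_integral_cong) (auto simp: indicator_def zero_le_mult_iff mult.commute)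
  finally show ?thesis using s by simp
qed

lemma nn_integral_concat_segments:
  fixes h :: "real \<Rightarrow> ennreal"
  assumes [measurable]: "h \<in> borel_measurable borel" and s: "0 < \<sigma>" "\<sigma> < t"
  shows "ennreal \<sigma> * (\<integral>\<^sup>+r. h (r * \<sigma>) * indicator {0..1} r \<partial>lborel) + (\<integral>\<^sup>+r. h (\<sigma> + r) * indicator {0..<t - \<sigma>} r \<partial>lborel)
    = (\<integral>\<^sup>+r. h r * indicator {0..<t} r \<partial>lborel)"
proof -
  note 1 = nn_integral_segment_scale[OF assms(1,2)]
  have "(\<integral>\<^sup>+r. h (\<sigma> + r) * indicator {0..<t - \<sigma>} r \<partial>lborel) = (\<integral>\<^sup>+r. h (r + \<sigma>) * indicator {\<sigma>..<t} (r + \<sigma>) \<partial>lborel)"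
    by (intro nn_integral_cong) (auto simp: indicator_def add.commute)
  also have "\<dots> = (\<integral>\<^sup>+r. h r * indicator {\<sigma>..<t} r \<partial>lborel)"
    by (rule nn_integral_lborel_shift[of "\<lambda>r. h r * indicator {\<sigma>..<t} r"]) measurable
  finally have 2: "(\<integral>\<^sup>+r. h (\<sigma> + r) * indicator {0..<t - \<sigma>} r \<partial>lborel) = (\<integral>\<^sup>+r. h r * indicator {\<sigma>..<t} r \<partial>lborel)" .
  have "(\<integral>\<^sup>+r. h r * indicator {0..\<sigma>} r \<partial>lborel) + (\<integral>\<^sup>+r. h r * indicator {\<sigma>..<t} r \<partial>lborel)
     = (\<integral>\<^sup>+r. h r * indicator {0..\<sigma>} r + h r * indicator {\<sigma>..<t} r \<partial>lborel)"
    by (rule nn_integral_add[symmetric]) measurable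
  also have "\<dots> = (\<integral>\<^sup>+r. h r * indicator {0..<t} r \<partial>lborel)"
  proof (rule nn_integral_cong_AE)
    have "AE r in lborel. r \<noteq> \<sigma>" by (rule AE_lborel_singleton)
    then show "AE r in lborel. h r * indicator {0..\<sigma>} r + h r * indicator {\<sigma>..<t} r = h r * indicator {0..<t} r"
      by eventually_elim (use s in \<open>auto simp: indicator_def\<close>)
  qed
  finally show ?thesis unfolding 1 2 .
qed

text \<open>
  The neighbourhoods provided by \<^const>\<open>has_trace\<close> depend on \<open>v\<close>.  Vertical translations through
  rational distances carry the estimate to a collar whose depth does not.
\<close>

lemma trace_collar:
  fixes v w v0 :: "real^'n \<Rightarrow> real^'n" and D0 :: "'n \<Rightarrow> real^'n \<Rightarrow> real^'n" and DD K :: "(real^'n) set"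
  assumes p: "1 \<le> p" and N: "CARD('n) = Suc m" "1 \<le> m"
    and Hm: "\<And>X :: (real^'n) set. X \<in> sets borel \<Longrightarrow> emeasure (hausdorff_measure m) X = hausdorff_outer m X"
    and G: "open G" and A: "A = frontier G \<inter> Q" "open Q"
    and chart: "graph_chart G U e \<phi>"
    and tr: "has_trace p G A v w"
    and v0[measurable]: "v0 \<in> borel_measurable borel" and wg: "\<And>i. weak_gradient G (\<lambda>x. v0 x $ i) (D0 i)"
    and eq: "AE x in lborel. x \<in> G \<longrightarrow> v x = v0 x"
    and DD: "\<And>y s. y \<in> DD \<Longrightarrow> y + s *\<^sub>R e \<in> DD"
    and K: "K = {y \<in> DD. 0 < \<phi> (horizontal e y) - y \<bullet> e \<and> \<phi> (horizontal e y) - y \<bullet> e < H}"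
    and KG: "K \<subseteq> G" and PK: "\<And>y. y \<in> K \<Longrightarrow> y + (\<phi> (horizontal e y) - y \<bullet> e) *\<^sub>R e \<in> A \<inter> U"
  shows "AE y in lborel. y \<in> K \<longrightarrow>
     ennreal (norm (w (y + (\<phi> (horizontal e y) - y \<bullet> e) *\<^sub>R e) - v0 y))
     \<le> (\<integral>\<^sup>+s. ennreal (\<Sum>i\<in>UNIV. norm (D0 i (y + s *\<^sub>R e))) * indicator {0..<\<phi> (horizontal e y) - y \<bullet> e} s \<partial>lborel)"
proof -
  define \<tau> where "\<tau> = (\<lambda>y. \<phi> (horizontal e y) - y \<bullet> e)"
  define h where "h = (\<lambda>x. \<Sum>i\<in>UNIV. norm (D0 i x))"
  define T where "T = (\<lambda>y. ennreal (norm (w (y + \<tau> y *\<^sub>R e) - v0 y)) \<le> (\<integral>\<^sup>+s. ennreal (h (y + s *\<^sub>R e)) * indicator {0..<\<tau> y} s \<partial>lborel))"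
  have e: "norm e = 1" using chart by (auto simp: graph_chart_def)
  have [measurable]: "D0 i \<in> borel_measurable borel" for i using wg by (auto simp: weak_gradient_def)
  have [measurable]: "h \<in> borel_measurable borel" unfolding h_def by measurable
  have ug: "upper_gradient G v0 h" unfolding h_def by (rule upper_gradient_of_weak_gradient[OF G v0 wg])
  have "\<forall>z\<in>A \<inter> U. \<exists>W. open W \<and> z \<in> W \<and> (AE y in lborel. y \<in> G \<inter> W \<longrightarrow> T y)"
    unfolding T_def \<tau>_def h_def
    using trace_near_point[OF p N Hm G A chart _ _ tr v0 wg eq] by blast
  from this[THEN bchoice] obtain W where W: "\<And>z. z \<in> A \<inter> U \<Longrightarrow> open (W z) \<and> z \<in> W z \<and> (AE y in lborel. y \<in> G \<inter> W z \<longrightarrow> T y)"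
    by blast
  define \<Omega> where "\<Omega> = \<Union>(W ` (A \<inter> U))"
  have "open \<Omega>" unfolding \<Omega>_def using W by blast
  have A\<Omega>: "A \<inter> U \<subseteq> \<Omega>" unfolding \<Omega>_def using W by blast
  \<comment> \<open>Each neighbourhood carries its own null set; countably many neighbourhoods with
    the same union keep the total exceptional set null.\<close>
  obtain \<F> where F: "\<F> \<subseteq> W ` (A \<inter> U)" "countable \<F>" "\<Union>\<F> = \<Omega>"
    unfolding \<Omega>_def using Lindelof[of "W ` (A \<inter> U)"] W by blast
  have "AE y in lborel. \<forall>X\<in>\<F>. y \<in> G \<inter> X \<longrightarrow> T y"
    using F(1,2) W by (subst AE_ball_countable) auto
  then have a2: "AE y in lborel. y \<in> G \<inter> \<Omega> \<longrightarrow> T y"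
    by eventually_elim (use F(3) in blast)
  have "AE y in lborel. \<forall>\<sigma>\<in>\<rat>. y + \<sigma> *\<^sub>R e \<in> G \<inter> \<Omega> \<longrightarrow> T (y + \<sigma> *\<^sub>R e)"
    using AE_lborel_shift[OF a2] by (subst AE_ball_countable) (auto intro: countable_rat)
  moreover have "AE y in lborel. \<forall>\<sigma>\<in>\<rat>. (\<forall>t\<in>{0..1}. y + t *\<^sub>R (\<sigma> *\<^sub>R e) \<in> G) \<longrightarrow>
        ennreal (norm (v0 (y + \<sigma> *\<^sub>R e) - v0 y))
          \<le> ennreal (norm (\<sigma> *\<^sub>R e)) * (\<integral>\<^sup>+t. ennreal (h (y + t *\<^sub>R (\<sigma> *\<^sub>R e))) * indicator {0..1} t \<partial>lborel)"
  proof (subst AE_ball_countable[OF countable_rat], intro ballI)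
    fix \<sigma> :: real
    show "AE y in lborel. (\<forall>t\<in>{0..1}. y + t *\<^sub>R (\<sigma> *\<^sub>R e) \<in> G) \<longrightarrow>
        ennreal (norm (v0 (y + \<sigma> *\<^sub>R e) - v0 y))
          \<le> ennreal (norm (\<sigma> *\<^sub>R e)) * (\<integral>\<^sup>+t. ennreal (h (y + t *\<^sub>R (\<sigma> *\<^sub>R e))) * indicator {0..1} t \<partial>lborel)"
      using ug unfolding upper_gradient_def by blast
  qed
  ultimately have "AE y in lborel. y \<in> K \<longrightarrow> T y"
  proof eventually_elim
    case (elim y)
    show ?case
    proof
      assume y: "y \<in> K"
      then have yD: "y \<in> DD" "0 < \<tau> y" "\<tau> y < H" by (auto simp: K \<tau>_def)
      have P: "y + \<tau> y *\<^sub>R e \<in> \<Omega>" using PK[OF y] A\<Omega> by (auto simp: \<tau>_def)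
      then obtain \<delta> where \<delta>: "\<delta> > 0" "ball (y + \<tau> y *\<^sub>R e) \<delta> \<subseteq> \<Omega>" using \<open>open \<Omega>\<close> by (meson openE)
      \<comment> \<open>A rational \<open>\<sigma>\<close> slightly below the depth of
        \<open>y\<close>: the point \<open>y + \<sigma> e\<close> is still in \<open>G\<close> and
        within \<open>\<delta>\<close> of the graph point, hence in \<open>\<Omega>\<close>. The
        estimate from there to the graph is joined to the line integral from \<open>y\<close> to
        it.\<close>
      obtain \<sigma> where \<sigma>: "\<sigma> \<in> \<rat>" "max 0 (\<tau> y - \<delta>) < \<sigma>" "\<sigma> < \<tau> y"
        using Rats_dense_in_real[of "max 0 (\<tau> y - \<delta>)" "\<tau> y"] yD \<delta> by auto
      then have \<sigma>0: "0 < \<sigma>" by simp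
      have ts: "\<tau> (y + s *\<^sub>R e) = \<tau> y - s" for s
        using e by (simp add: \<tau>_def horizontal_add_scaleR inner_add_left dot_square_norm)
      have seg: "y + s *\<^sub>R e \<in> G" if "0 \<le> s" "s < \<tau> y" for s
      proof -
        have "y + s *\<^sub>R e \<in> K" using DD[OF yD(1)] ts[of s] that yD unfolding K \<tau>_def by auto
        then show ?thesis using KG by blast
      qed
      let ?y = "y + \<sigma> *\<^sub>R e"
      have "dist (y + \<tau> y *\<^sub>R e) ?y = norm ((\<tau> y - \<sigma>) *\<^sub>R e)" by (simp add: dist_norm algebra_simps)
      also have "\<dots> < \<delta>" using e \<sigma> by auto
      finally have "?y \<in> G \<inter> \<Omega>" using \<delta>(2) seg[of \<sigma>] \<sigma> \<sigma>0 by auto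
      then have "T ?y" using elim(1) \<sigma>(1) by blast
      moreover have Py: "?y + \<tau> ?y *\<^sub>R e = y + \<tau> y *\<^sub>R e" by (simp add: ts algebra_simps)
      ultimately have t1: "ennreal (norm (w (y + \<tau> y *\<^sub>R e) - v0 ?y)) \<le> (\<integral>\<^sup>+s. ennreal (h (y + (\<sigma> + s) *\<^sub>R e)) * indicator {0..<\<tau> y - \<sigma>} s \<partial>lborel)"
        unfolding T_def Py by (simp add: ts scaleR_add_left add.assoc)
      have "\<forall>t\<in>{0..1}. y + t *\<^sub>R (\<sigma> *\<^sub>R e) \<in> G"
      proof
        fix t :: real assume t: "t \<in> {0..1}"
        then have "t * \<sigma> \<le> 1 * \<sigma>" using \<sigma>0 by (intro mult_right_mono) auto
        then have "t * \<sigma> < \<tau> y" using \<sigma>(3) by linarith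
        then show "y + t *\<^sub>R (\<sigma> *\<^sub>R e) \<in> G" using seg[of "t * \<sigma>"] t \<sigma>0 by simp
      qed
      then have "ennreal (norm (v0 ?y - v0 y)) \<le> ennreal (norm (\<sigma> *\<^sub>R e)) * (\<integral>\<^sup>+t. ennreal (h (y + t *\<^sub>R (\<sigma> *\<^sub>R e))) * indicator {0..1} t \<partial>lborel)"
        using elim(2) \<sigma>(1) by blast
      then have t2: "ennreal (norm (v0 ?y - v0 y)) \<le> ennreal \<sigma> * (\<integral>\<^sup>+t. ennreal (h (y + (t * \<sigma>) *\<^sub>R e)) * indicator {0..1} t \<partial>lborel)"
        using e \<sigma>0 by simp
      have "ennreal (norm (w (y + \<tau> y *\<^sub>R e) - v0 y)) \<le> ennreal (norm (v0 ?y - v0 y) + norm (w (y + \<tau> y *\<^sub>R e) - v0 ?y))"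
        using norm_triangle_ineq[of "v0 ?y - v0 y" "w (y + \<tau> y *\<^sub>R e) - v0 ?y"] by (intro ennreal_leI) simp
      also have "\<dots> = ennreal (norm (v0 ?y - v0 y)) + ennreal (norm (w (y + \<tau> y *\<^sub>R e) - v0 ?y))"
        by (simp add: ennreal_plus)
      also have "\<dots> \<le> ennreal \<sigma> * (\<integral>\<^sup>+t. ennreal (h (y + (t * \<sigma>) *\<^sub>R e)) * indicator {0..1} t \<partial>lborel)
          + (\<integral>\<^sup>+s. ennreal (h (y + (\<sigma> + s) *\<^sub>R e)) * indicator {0..<\<tau> y - \<sigma>} s \<partial>lborel)"
        by (rule add_mono[OF t2 t1])
      also have "\<dots> = (\<integral>\<^sup>+s. ennreal (h (y + s *\<^sub>R e)) * indicator {0..<\<tau> y} s \<partial>lborel)"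
        by (rule nn_integral_concat_segments[of "\<lambda>s. ennreal (h (y + s *\<^sub>R e))", OF _ \<sigma>0 \<sigma>(3)]) measurable
      finally show "T y" unfolding T_def .
    qed
  qed
  then show ?thesis unfolding T_def \<tau>_def h_def .
qed

section \<open>The normal component of the constant\<close>

lemma powr_add3_le:
  fixes a b c p :: real
  assumes p: "1 \<le> p" and nn: "0 \<le> a" "0 \<le> b" "0 \<le> c"
  shows "(a + b + c) powr p \<le> 4 powr p * (a powr p + b powr p + c powr p)"
proof -
  have one: "1 \<le> (2::real) powr p" using p by (intro ge_one_powr_ge_zero) auto
  have "(a + (b + c)) powr p \<le> 2 powr p * (a powr p + (b + c) powr p)"
    by (rule powr_add_le) (use p nn in auto)
  also have "\<dots> \<le> 2 powr p * (2 powr p * a powr p + 2 powr p * (b powr p + c powr p))"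
    using mult_right_mono[OF one, of "a powr p"]
    by (intro mult_left_mono add_mono powr_add_le) (use p nn in auto)
  also have "\<dots> = (2 powr p * 2 powr p) * (a powr p + b powr p + c powr p)" by (simp add: algebra_simps)
  also have "(2::real) powr p * 2 powr p = 4 powr p" by (simp flip: powr_mult)
  finally show ?thesis by (simp add: add.assoc)
qed

text \<open>Collects what is assumed of a Borel representative. The field \<open>v\<close> and its
  trace \<open>w\<close> are bound existentially, since the estimates speak of \<open>v0\<close> and
  \<open>D0\<close> only.\<close>

definition vanishing_normal_trace ::
    "real \<Rightarrow> (real^'n) set \<Rightarrow> (real^'n) set \<Rightarrow> (real^'n \<Rightarrow> real^'n) \<Rightarrow> (real^'n \<Rightarrow> real^'n) \<Rightarrow>
     ('n \<Rightarrow> real^'n \<Rightarrow> real^'n) \<Rightarrow> bool" where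
  "vanishing_normal_trace p G A \<nu> v0 D0 \<longleftrightarrow>
     v0 \<in> borel_measurable borel \<and> (\<forall>i. weak_gradient G (\<lambda>x. v0 x $ i) (D0 i)) \<and>
     (\<exists>v w. has_trace p G A v w \<and>
        (AE x in restrict_space (hausdorff_measure (CARD('n) - 1)) A. w x \<bullet> \<nu> x = 0) \<and>
        (AE x in lborel. x \<in> G \<longrightarrow> v x = v0 x))"

text \<open>The pointwise estimate is raised to the power \<open>p\<close>, integrated over a collar
  \<open>K\<close> below \<open>x0\<close> and divided by the volume of \<open>K\<close>. The
  constant \<open>C\<close> depends on \<open>\<epsilon>\<close> through the size of
  \<open>K\<close>, but the coefficient \<open>4 powr p\<close> of the error term does not; this is
  what allows the error to be absorbed later.\<close>

lemma normal_component_bound: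
  fixes A G \<Gamma> Q U :: "(real^'n) set" and \<nu> :: "real^'n \<Rightarrow> real^'n"
  assumes p: "1 \<le> p" and N: "CARD('n) = Suc m" "1 \<le> m"
    and Hm: "\<And>X :: (real^'n) set. X \<in> sets borel \<Longrightarrow> emeasure (hausdorff_measure m) X = hausdorff_outer m X"
    and \<alpha>: "0 \<le> \<alpha>" and G: "open G" and A: "A = frontier G \<inter> Q" "open Q" and \<Gamma>: "closure \<Gamma> \<inter> Q = {}"
    and chart: "graph_chart G U e \<phi>" and x0: "x0 \<in> A" "x0 \<in> U"
    and \<nu>: "continuous_on A \<nu>" "\<And>x. x \<in> A \<Longrightarrow> norm (\<nu> x) \<le> 1" and \<epsilon>: "0 < \<epsilon>"
  shows "\<exists>C\<ge>0. \<forall>v0 D0 c. vanishing_normal_trace p G A \<nu> v0 D0 \<longrightarrow>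
      ennreal (\<bar>c \<bullet> \<nu> x0\<bar> powr p) \<le> ennreal C * (Lp_mass p G (\<lambda>x. v0 x - c)
         + Lp_mass p G (\<lambda>x. dist_weight \<alpha> \<Gamma> x * (\<Sum>i\<in>UNIV. norm (D0 i x))))
         + ennreal (4 powr p * (\<epsilon> * norm c) powr p)"
proof -
  have U: "open U" "norm e = 1" "frontier G \<inter> U = {y \<in> U. y \<bullet> e = \<phi> (horizontal e y)}"
    "G \<inter> U = {y \<in> U. y \<bullet> e < \<phi> (horizontal e y)}"
    using chart by (auto simp: graph_chart_def)
  obtain d where d: "d > 0" "\<And>x. x \<in> A \<Longrightarrow> dist x x0 < d \<Longrightarrow> dist (\<nu> x) (\<nu> x0) < \<epsilon>"
    using \<nu>(1) x0(1) \<epsilon> unfolding continuous_on_iff by metis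
  have "x0 \<in> Q" using x0 A by auto
  then obtain r0 where r0: "r0 > 0" "cball x0 r0 \<subseteq> Q" using A(2) by (meson open_contains_cball)
  \<comment> \<open>The closure of \<open>\<Gamma>\<close> does not meet \<open>Q\<close>, so near
    \<open>x0\<close> the weight is bounded below and can be inserted at the cost of a
    constant.\<close>
  obtain m0 where m0: "m0 > 0" "\<And>x. x \<in> cball x0 r0 \<Longrightarrow> m0 \<le> dist_weight \<alpha> \<Gamma> x"
    using dist_weight_lower_bound[OF \<alpha> compact_cball, of x0 r0 \<Gamma>] r0 \<Gamma> by blast
  define W where "W = ball x0 (min d r0)"
  have W: "open W" "x0 \<in> W" using d r0 by (auto simp: W_def)
  have x0f: "x0 \<in> frontier G" using x0 A by auto
  from graph_chart_cylinder[OF chart x0f x0(2) W] obtain \<rho> \<eta> where \<rho>: "0 < \<rho>" and \<eta>: "0 < \<eta>"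
    and cyl: "\<And>y. norm (horizontal e (y - x0)) \<le> \<rho> \<Longrightarrow> \<bar>y \<bullet> e - x0 \<bullet> e\<bar> < 8 * \<eta> \<Longrightarrow> y \<in> U \<inter> W"
    and \<phi>: "\<And>y. norm (horizontal e (y - x0)) \<le> \<rho> \<Longrightarrow> \<bar>\<phi> (horizontal e y) - x0 \<bullet> e\<bar> < \<eta>"
    and cont: "continuous_on {y. norm (horizontal e (y - x0)) \<le> \<rho>} (\<lambda>y. \<phi> (horizontal e y))"
    by metis
  define H where "H = 2 * \<eta>"
  define \<tau> where "\<tau> = (\<lambda>y. \<phi> (horizontal e y) - y \<bullet> e)"
  define P where "P = (\<lambda>y. y + \<tau> y *\<^sub>R e)"
  define DD where "DD = {y. norm (horizontal e (y - x0)) \<le> \<rho>}"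
  define F where "F = (\<lambda>y. indicator DD y *\<^sub>R \<phi> (horizontal e y))"
  define K where "K = {y \<in> DD. 0 < \<tau> y \<and> \<tau> y < H}"
  have ch: "continuous_on S (\<lambda>y. norm (horizontal e (y - x0)))" for S
    by (intro continuous_intros continuous_on_compose2[OF continuous_on_horizontal[of UNIV]]) auto
  have DDc: "closed DD" unfolding DD_def by (rule closed_Collect_le[OF ch continuous_on_const])
  then have [measurable]: "DD \<in> sets borel" by (rule borel_closed)
  have Fm[measurable]: "F \<in> borel_measurable borel"
    unfolding F_def by (rule borel_measurable_continuous_on_indicator) (use cont in \<open>auto simp: DD_def[symmetric]\<close>)
  have K_F: "K = {y \<in> DD. 0 < F y - y \<bullet> e \<and> F y - y \<bullet> e < H}" by (auto simp: K_def F_def \<tau>_def)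
  have Km[measurable]: "K \<in> sets borel" unfolding K_F by measurable
  have Kp: "y \<in> G \<and> y \<in> W \<and> \<bar>y \<bullet> e - x0 \<bullet> e\<bar> \<le> 3 * \<eta> \<and> P y \<in> A \<inter> U \<and> P y \<in> W" if "y \<in> K" for y
  proof -
    have n: "norm (horizontal e (y - x0)) \<le> \<rho>" and t: "0 < \<tau> y" "\<tau> y < H" using that by (auto simp: K_def DD_def)
    have h: "\<bar>y \<bullet> e - x0 \<bullet> e\<bar> < 3 * \<eta>" using \<phi>[OF n] t by (auto simp: \<tau>_def H_def)
    then have yU: "y \<in> U" "y \<in> W" using cyl[OF n] \<eta> by auto
    have "y \<in> G \<inter> U" unfolding U(4) using yU t by (simp add: \<tau>_def)
    have Pe: "P y \<bullet> e = \<phi> (horizontal e y)" using U(2) by (simp add: P_def \<tau>_def inner_add_left dot_square_norm)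
    have Ph: "horizontal e (P y) = horizontal e y" unfolding P_def by (rule horizontal_add_scaleR[OF U(2)])
    have "P y \<in> U \<inter> W"
    proof (rule cyl)
      show "norm (horizontal e (P y - x0)) \<le> \<rho>" using n by (simp add: horizontal_diff Ph)
      show "\<bar>P y \<bullet> e - x0 \<bullet> e\<bar> < 8 * \<eta>" unfolding Pe using \<phi>[OF n] \<eta> by auto
    qed
    moreover have "P y \<in> frontier G \<inter> U" unfolding U(3) using calculation Pe Ph by simp
    moreover have "W \<subseteq> Q" using r0 by (auto simp: W_def)
    ultimately show ?thesis using A yU h \<open>y \<in> G \<inter> U\<close> by auto
  qed
  have "K \<subseteq> ball x0 (min d r0)" using Kp by (auto simp: W_def)
  then have "emeasure lborel K < \<infinity>"
    by (intro emeasure_bounded_finite bounded_subset[OF bounded_ball])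
  then obtain V where V: "emeasure lborel K = ennreal V" "0 \<le> V" by (cases "emeasure lborel K") auto
  \<comment> \<open>\<open>x0\<close> is in the closure of \<open>G\<close>, so the part of
    \<open>G\<close> close to it is a nonempty open subset of \<open>K\<close>.\<close>
  have "V > 0"
  proof -
    define O1 where "O1 = {y. norm (horizontal e (y - x0)) < \<rho> \<and> \<bar>(y - x0) \<bullet> e\<bar> < \<eta>}"
    have "open O1" unfolding O1_def Collect_conj_eq
      by (intro open_Int open_Collect_less ch continuous_on_rabs continuous_on_const continuous_intros)
    moreover have "x0 \<in> O1" using \<rho> \<eta> by (simp add: O1_def horizontal_def)
    moreover have "x0 \<in> closure G" using x0f by (simp add: frontier_def)
    ultimately have "O1 \<inter> G \<noteq> {}" using open_Int_closure_eq_empty[of O1 G] by blast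
    moreover have sub: "O1 \<inter> G \<subseteq> K"
    proof
      fix y assume "y \<in> O1 \<inter> G"
      then have n: "norm (horizontal e (y - x0)) \<le> \<rho>" "\<bar>y \<bullet> e - x0 \<bullet> e\<bar> < \<eta>" "y \<in> G" by (auto simp: O1_def inner_diff_left)
      then have "y \<in> G \<inter> U" using cyl[OF n(1)] \<eta> by auto
      then have "0 < \<tau> y" unfolding U(4) by (simp add: \<tau>_def)
      moreover have "\<tau> y < H" using \<phi>[OF n(1)] n(2) by (auto simp: \<tau>_def H_def)
      ultimately show "y \<in> K" using n by (simp add: K_def DD_def)
    qed
    moreover have "open (O1 \<inter> G)" using \<open>open O1\<close> G by auto
    ultimately have "\<not> (emeasure lborel K = 0)"
    proof -
      obtain y where "y \<in> O1 \<inter> G" using \<open>O1 \<inter> G \<noteq> {}\<close> by auto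
      then obtain s where s: "s > 0" "ball y s \<subseteq> O1 \<inter> G" using \<open>open (O1 \<inter> G)\<close> by (meson openE)
      then have "emeasure lborel (ball y s) \<le> emeasure lborel K" using sub by (intro emeasure_mono) auto
      moreover have "emeasure lborel (ball y s) > 0" using content_ball_pos[OF s(1), of y] by (simp add: emeasure_ball s less_imp_le)
      ultimately show ?thesis by auto
    qed
    then show ?thesis using V by (cases "V = 0") auto
  qed
  define C where "C = 4 powr p * (H powr p * (1 / m0) powr p + 1) / V"
  have H0: "0 < H" using \<eta> by (simp add: H_def)
  have C0: "0 \<le> C" using \<open>V > 0\<close> by (simp add: C_def)
  have Am: "A \<in> sets borel" using A by (auto intro!: sets.Int borel_closed)
  have Pm: "P \<in> restrict_space borel K \<rightarrow>\<^sub>M borel"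
  proof -
    have "(\<lambda>y. y + (F y - y \<bullet> e) *\<^sub>R e) \<in> restrict_space borel K \<rightarrow>\<^sub>M borel"
      by (intro measurable_restrict_space1) measurable
    then show ?thesis
      by (rule measurable_cong[THEN iffD1, rotated]) (auto simp: space_restrict_space K_def F_def P_def \<tau>_def)
  qed
  show ?thesis
  proof (intro exI[of _ C] conjI allI impI C0)
    fix v0 :: "real^'n \<Rightarrow> real^'n" and D0 :: "'n \<Rightarrow> real^'n \<Rightarrow> real^'n" and c :: "real^'n"
    assume "vanishing_normal_trace p G A \<nu> v0 D0"
    then obtain v w where tr: "has_trace p G A v w"
      and wnu: "AE x in restrict_space (hausdorff_measure m) A. w x \<bullet> \<nu> x = 0"
      and v0[measurable]: "v0 \<in> borel_measurable borel" and wg: "\<forall>i. weak_gradient G (\<lambda>x. v0 x $ i) (D0 i)"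
      and eq: "AE x in lborel. x \<in> G \<longrightarrow> v x = v0 x"
      unfolding vanishing_normal_trace_def N(1) diff_Suc_1 by (elim exE conjE)
    define h where "h = (\<lambda>x. \<Sum>i\<in>UNIV. norm (D0 i x))"
    have [measurable]: "D0 i \<in> borel_measurable borel" for i using wg by (auto simp: weak_gradient_def)
    have hm[measurable]: "h \<in> borel_measurable borel" unfolding h_def by measurable
    have h0: "0 \<le> h x" for x unfolding h_def by (simp add: sum_nonneg)
    have T: "AE y in lborel. y \<in> K \<longrightarrow> ennreal (norm (w (P y) - v0 y)) \<le> (\<integral>\<^sup>+s. ennreal (h (y + s *\<^sub>R e)) * indicator {0..<\<tau> y} s \<partial>lborel)"
      unfolding P_def \<tau>_def h_def
    proof (rule trace_collar[OF p N Hm G A chart tr v0 wg[rule_format] eq])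
      show "K = {y \<in> DD. 0 < \<phi> (horizontal e y) - y \<bullet> e \<and> \<phi> (horizontal e y) - y \<bullet> e < H}" by (simp add: K_def \<tau>_def)
      show "y + s *\<^sub>R e \<in> DD" if "y \<in> DD" for y s
        using that by (simp add: DD_def horizontal_diff horizontal_add_scaleR[OF U(2)])
      show "K \<subseteq> G" using Kp by blast
      show "y + (\<phi> (horizontal e y) - y \<bullet> e) *\<^sub>R e \<in> A \<inter> U" if "y \<in> K" for y
        using Kp[OF that] by (simp add: P_def \<tau>_def)
    qed
    \<comment> \<open>The vertical projection pulls null sets of \<open>A\<close> back to null sets
      of \<open>K\<close>, by the volume estimate for cylinders over a set of Hausdorff measure
      0.\<close>
    have Nu: "AE y in lborel. y \<in> K \<longrightarrow> w (P y) \<bullet> \<nu> (P y) = 0"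
    proof -
      obtain M where M: "{x \<in> space (restrict_space (hausdorff_measure m) A). \<not> w x \<bullet> \<nu> x = 0} \<subseteq> M"
        "emeasure (restrict_space (hausdorff_measure m) A) M = 0" "M \<in> sets (restrict_space (hausdorff_measure m) A)"
        using wnu by (rule AE_E)
      have Mb: "M \<in> sets borel" "M \<subseteq> A" using M(3) Am by (auto simp: sets_restrict_space)
      have M0: "hausdorff_outer m M = 0"
        using M(2) Mb Am Hm[OF Mb(1)] by (subst (asm) emeasure_restrict_space) auto
      have "emeasure lborel (P -` M \<inter> K) \<le> ennreal ((2 * (3 * \<eta>) + 1) * unit_ball_vol (real (Suc m)) * 2 ^ Suc m * 2 ^ m / unit_ball_vol (real m)) * hausdorff_outer m M"
      proof (rule emeasure_cylinder_le_hausdorff_outer[OF U(2) _ N(2)])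
        show "DIM(real^'n) = Suc m" using N by simp
        show "0 \<le> 3 * \<eta>" using \<eta> by simp
        fix y assume y: "y \<in> P -` M \<inter> K"
        then show "\<exists>x\<in>M. horizontal e y = horizontal e x \<and> \<bar>y \<bullet> e - x0 \<bullet> e\<bar> \<le> 3 * \<eta>"
          using Kp[of y] by (intro bexI[of _ "P y"]) (auto simp: P_def horizontal_add_scaleR[OF U(2)])
      qed
      then have "emeasure lborel (P -` M \<inter> K) \<le> 0" by (simp add: M0)
      moreover have "P -` M \<inter> K \<in> sets lborel"
        using measurable_sets[OF Pm Mb(1)] by (simp add: space_restrict_space sets_restrict_space_iff)
      ultimately have "P -` M \<inter> K \<in> null_sets lborel" by (auto simp: null_sets_def)
      then have "AE y in lborel. y \<notin> P -` M \<inter> K" by (rule AE_not_in)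
      then show ?thesis
      proof eventually_elim
        case (elim y)
        show ?case
        proof
          assume "y \<in> K"
          then have "P y \<in> A" "P y \<notin> M" using Kp elim by auto
          moreover have "P y \<in> space (restrict_space (hausdorff_measure m) A)"
            using \<open>P y \<in> A\<close> by (simp add: space_restrict_space hausdorff_measure_def)
          ultimately show "w (P y) \<bullet> \<nu> (P y) = 0" using M(1) by blast
        qed
      qed
    qed
    define r where "r = \<bar>c \<bullet> \<nu> x0\<bar>"
    \<comment> \<open>Cutting \<open>h\<close> off to \<open>K\<close> lets the segments of varying
      length \<open>\<tau> y\<close> be replaced by segments of the fixed length \<open>H\<close>,
      as Jensen and Fubini require.\<close>
    define hK where "hK = (\<lambda>x. indicator K x * h x)"
    have hKm[measurable]: "hK \<in> borel_measurable borel" unfolding hK_def by measurable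
    have hK0: "0 \<le> hK x" for x using h0 by (simp add: hK_def)
    define Z where "Z = (\<lambda>y. \<integral>\<^sup>+t. ennreal (hK (y + (t * H) *\<^sub>R e) powr p) * indicator {0..1} t \<partial>lborel)"
    have Zm[measurable]: "Z \<in> borel_measurable borel" unfolding Z_def by measurable
    have pt: "AE y in lborel. ennreal (r powr p) * indicator K y \<le> ennreal (4 powr p) * (ennreal (H powr p) * Z y
         + ennreal (norm (v0 y - c) powr p) * indicator K y + ennreal ((\<epsilon> * norm c) powr p) * indicator K y)"
      using T Nu
    proof eventually_elim
      case (elim y)
      show ?case
      proof (cases "y \<in> K")
        case yK: True
        let ?n = "\<nu> (P y)"
        have wn: "w (P y) \<bullet> ?n = 0" using elim yK by blast
        have PA: "P y \<in> A" using Kp[OF yK] by auto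
        have n1: "norm ?n \<le> 1" by (rule \<nu>(2)[OF PA])
        have "P y \<in> W" using Kp[OF yK] by auto
        then have ne: "norm (\<nu> x0 - ?n) \<le> \<epsilon>" using d(2)[OF PA] by (auto simp: W_def dist_norm norm_minus_commute dist_commute)
        have "c \<bullet> \<nu> x0 = c \<bullet> (\<nu> x0 - ?n) + (c - v0 y) \<bullet> ?n + (v0 y - w (P y)) \<bullet> ?n"
          using wn by (simp add: inner_diff_left inner_diff_right)
        then have "r \<le> \<bar>c \<bullet> (\<nu> x0 - ?n)\<bar> + \<bar>(c - v0 y) \<bullet> ?n\<bar> + \<bar>(v0 y - w (P y)) \<bullet> ?n\<bar>" unfolding r_def by linarith
        also have "\<dots> \<le> norm c * \<epsilon> + norm (c - v0 y) * 1 + norm (v0 y - w (P y)) * 1"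
          by (intro add_mono order_trans[OF Cauchy_Schwarz_ineq2] mult_left_mono ne n1) auto
        finally have rle: "r \<le> \<epsilon> * norm c + norm (v0 y - c) + norm (w (P y) - v0 y)"
          by (simp add: mult.commute norm_minus_commute)
        \<comment> \<open>The positive part, because Jensen is applied to a nonnegative number;
          \<open>r\<close> is still at most \<open>r'\<close> plus the two subtracted terms.\<close>
        define r' where "r' = max 0 (r - (\<epsilon> * norm c + norm (v0 y - c)))"
        have "ennreal r' \<le> ennreal (norm (w (P y) - v0 y))" unfolding r'_def using rle by (intro ennreal_leI) auto
        also have "\<dots> \<le> (\<integral>\<^sup>+s. ennreal (h (y + s *\<^sub>R e)) * indicator {0..<\<tau> y} s \<partial>lborel)" using elim yK by blast
        also have "\<dots> \<le> (\<integral>\<^sup>+s. ennreal (hK (y + s *\<^sub>R e)) * indicator {0..H} s \<partial>lborel)"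
        proof (rule nn_integral_mono)
          fix s
          show "ennreal (h (y + s *\<^sub>R e)) * indicator {0..<\<tau> y} s \<le> ennreal (hK (y + s *\<^sub>R e)) * indicator {0..H} s"
          proof (cases "s \<in> {0..<\<tau> y}")
            case True
            have "\<tau> (y + s *\<^sub>R e) = \<tau> y - s"
              using U(2) by (simp add: \<tau>_def horizontal_add_scaleR inner_add_left dot_square_norm)
            then have "y + s *\<^sub>R e \<in> K" "s \<le> H" using yK True by (auto simp: K_def DD_def horizontal_diff horizontal_add_scaleR[OF U(2)])
            then show ?thesis using True by (simp add: hK_def)
          qed simp
        qed
        also have "\<dots> = ennreal H * (\<integral>\<^sup>+t. ennreal (hK (y + (t * H) *\<^sub>R e)) * indicator {0..1} t \<partial>lborel)"
          by (rule nn_integral_segment_scale[of "\<lambda>s. ennreal (hK (y + s *\<^sub>R e))", OF _ H0, symmetric]) measurable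
        finally have "ennreal (r' powr p) \<le> ennreal (H powr p) * Z y"
          unfolding Z_def by (intro jensen_unit_interval[OF p]) (use hK0 H0 in \<open>auto simp: r'_def\<close>)
        moreover have "r powr p \<le> 4 powr p * (r' powr p + norm (v0 y - c) powr p + (\<epsilon> * norm c) powr p)"
        proof -
          have "r powr p \<le> (r' + norm (v0 y - c) + \<epsilon> * norm c) powr p"
            using p by (intro powr_mono2) (auto simp: r_def r'_def)
          also have "\<dots> \<le> 4 powr p * (r' powr p + norm (v0 y - c) powr p + (\<epsilon> * norm c) powr p)"
            by (rule powr_add3_le[OF p]) (use \<epsilon> in \<open>auto simp: r'_def\<close>)
          finally show ?thesis .
        qed
        then have "ennreal (r powr p) \<le> ennreal (4 powr p * (r' powr p + norm (v0 y - c) powr p + (\<epsilon> * norm c) powr p))"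
          by (rule ennreal_leI)
        moreover have "\<dots> = ennreal (4 powr p) * (ennreal (r' powr p) + ennreal (norm (v0 y - c) powr p) + ennreal ((\<epsilon> * norm c) powr p))"
          by (simp add: ennreal_mult ennreal_plus)
        ultimately have "ennreal (r powr p) \<le> ennreal (4 powr p) * (ennreal (H powr p) * Z y + ennreal (norm (v0 y - c) powr p) + ennreal ((\<epsilon> * norm c) powr p))"
          by (smt (verit, del_insts) add_right_mono mult_left_mono order_trans zero_le)
        then show ?thesis using yK by simp
      qed simp
    qed
    have Zint: "(\<integral>\<^sup>+y. Z y \<partial>lborel) \<le> Lp_mass p K h"
    proof -
      have "(\<integral>\<^sup>+y. Z y \<partial>lborel) = (\<integral>\<^sup>+t. \<integral>\<^sup>+y. ennreal (hK (y + (t * H) *\<^sub>R e) powr p) * indicator {0..1} t \<partial>lborel \<partial>lborel)"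
        unfolding Z_def by (rule lborel_pair.Fubini'[symmetric]) measurable
      also have "\<dots> = (\<integral>\<^sup>+t. indicator {0..1::real} t * (\<integral>\<^sup>+y. ennreal (hK y powr p) \<partial>lborel) \<partial>lborel)"
      proof (rule nn_integral_cong)
        fix t :: real
        have "(\<integral>\<^sup>+y. ennreal (hK (y + (t * H) *\<^sub>R e) powr p) * indicator {0..1} t \<partial>lborel) = (\<integral>\<^sup>+y. ennreal (hK (y + (t * H) *\<^sub>R e) powr p) \<partial>lborel) * indicator {0..1} t"
          by (rule nn_integral_multc) measurable
        also have "(\<integral>\<^sup>+y. ennreal (hK (y + (t * H) *\<^sub>R e) powr p) \<partial>lborel) = (\<integral>\<^sup>+y. ennreal (hK y powr p) \<partial>lborel)"
          by (rule nn_integral_lborel_shift[of "\<lambda>y. ennreal (hK y powr p)"]) measurable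
        finally show "(\<integral>\<^sup>+y. ennreal (hK (y + (t * H) *\<^sub>R e) powr p) * indicator {0..1} t \<partial>lborel) = indicator {0..1} t * (\<integral>\<^sup>+y. ennreal (hK y powr p) \<partial>lborel)"
          by (simp add: mult.commute)
      qed
      also have "\<dots> = (\<integral>\<^sup>+y. ennreal (hK y powr p) \<partial>lborel)" by (simp add: nn_integral_multc)
      also have "\<dots> \<le> Lp_mass p K h"
        unfolding Lp_mass_def by (intro nn_integral_mono) (use h0 in \<open>auto simp: hK_def indicator_def\<close>)
      finally show ?thesis .
    qed
    have hle: "Lp_mass p K h \<le> ennreal ((1 / m0) powr p) * Lp_mass p G (\<lambda>x. dist_weight \<alpha> \<Gamma> x * h x)"
    proof (rule Lp_mass_cmult_bound)
      fix x assume "x \<in> K"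
      then have x: "x \<in> G" "m0 \<le> dist_weight \<alpha> \<Gamma> x" using Kp[of x] m0(2)[of x] by (auto simp: W_def)
      then have "m0 * h x \<le> dist_weight \<alpha> \<Gamma> x * h x" by (intro mult_right_mono h0)
      then show "x \<in> G \<and> norm (h x) \<le> 1 / m0 * norm (dist_weight \<alpha> \<Gamma> x * h x)"
        using x m0(1) h0[of x] dist_weight_nonneg[of \<alpha> \<Gamma> x] by (simp add: field_simps abs_mult)
    qed (use p m0 G in auto)
    define X1 where "X1 = Lp_mass p G (\<lambda>x. v0 x - c)"
    define X2 where "X2 = Lp_mass p G (\<lambda>x. dist_weight \<alpha> \<Gamma> x * h x)"
    have "ennreal (r powr p) * ennreal V = (\<integral>\<^sup>+y. ennreal (r powr p) * indicator K y \<partial>lborel)"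
      by (simp add: nn_integral_cmult V)
    also have "\<dots> \<le> (\<integral>\<^sup>+y. ennreal (4 powr p) * (ennreal (H powr p) * Z y
         + ennreal (norm (v0 y - c) powr p) * indicator K y + ennreal ((\<epsilon> * norm c) powr p) * indicator K y) \<partial>lborel)"
      by (rule nn_integral_mono_AE[OF pt])
    also have "\<dots> = ennreal (4 powr p) * (ennreal (H powr p) * (\<integral>\<^sup>+y. Z y \<partial>lborel) + Lp_mass p K (\<lambda>x. v0 x - c) + ennreal ((\<epsilon> * norm c) powr p) * ennreal V)"
      by (simp add: nn_integral_cmult nn_integral_add Lp_mass_def V)
    also have "\<dots> \<le> ennreal (4 powr p) * (ennreal (H powr p) * (ennreal ((1 / m0) powr p) * X2) + X1 + ennreal ((\<epsilon> * norm c) powr p) * ennreal V)"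
    proof (intro mult_left_mono add_right_mono add_mono)
      show "(\<integral>\<^sup>+y. Z y \<partial>lborel) \<le> ennreal ((1 / m0) powr p) * X2" using Zint hle unfolding X2_def by (rule order_trans)
      show "Lp_mass p K (\<lambda>x. v0 x - c) \<le> X1" unfolding X1_def by (rule Lp_mass_subset) (use Kp in blast)
    qed auto
    finally have main: "ennreal (r powr p) * ennreal V \<le> ennreal (4 powr p) * (ennreal (H powr p) * (ennreal ((1 / m0) powr p) * X2) + X1 + ennreal ((\<epsilon> * norm c) powr p) * ennreal V)" .
    define q where "q = H powr p * (1 / m0) powr p"
    have q0: "0 \<le> q" by (simp add: q_def)
    have "ennreal (H powr p) * (ennreal ((1 / m0) powr p) * X2) + X1 \<le> ennreal (q + 1) * (X1 + X2)"
    proof -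
      have "ennreal (H powr p) * (ennreal ((1 / m0) powr p) * X2) + X1 = ennreal q * X2 + X1"
        by (simp add: q_def ennreal_mult mult.assoc)
      also have "\<dots> \<le> (ennreal q * X2 + X1) + (ennreal q * X1 + X2)" by simp
      also have "\<dots> = ennreal (q + 1) * (X1 + X2)"
        using q0 by (simp add: ennreal_plus distrib_left distrib_right ac_simps)
      finally show ?thesis .
    qed
    then have "ennreal (r powr p) * ennreal V \<le> ennreal (4 powr p) * (ennreal (q + 1) * (X1 + X2) + ennreal ((\<epsilon> * norm c) powr p) * ennreal V)"
      by (intro order_trans[OF main] mult_left_mono add_right_mono) auto
    then have "ennreal (1 / V) * (ennreal (r powr p) * ennreal V) \<le> ennreal (1 / V) * (ennreal (4 powr p) * (ennreal (q + 1) * (X1 + X2) + ennreal ((\<epsilon> * norm c) powr p) * ennreal V))"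
      by (rule mult_left_mono) simp
    moreover have VV: "ennreal (1 / V) * ennreal V = 1" using \<open>V > 0\<close> by (simp add: ennreal_mult[symmetric])
    moreover have "ennreal (1 / V) * (ennreal (r powr p) * ennreal V) = ennreal (r powr p) * (ennreal (1 / V) * ennreal V)"
      by (simp only: ac_simps)
    moreover have "ennreal (1 / V) * (ennreal (4 powr p) * (ennreal (q + 1) * (X1 + X2) + ennreal ((\<epsilon> * norm c) powr p) * ennreal V))
      = (ennreal (1 / V) * ennreal (4 powr p) * ennreal (q + 1)) * (X1 + X2) + (ennreal (4 powr p) * ennreal ((\<epsilon> * norm c) powr p)) * (ennreal (1 / V) * ennreal V)"
      by (simp only: distrib_left ac_simps)
    moreover have "ennreal (1 / V) * ennreal (4 powr p) * ennreal (q + 1) = ennreal C"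
    proof -
      have C: "C = (1 / V * 4 powr p) * (q + 1)" by (simp add: C_def q_def)
      have nn: "0 \<le> 1 / V" "0 \<le> 1 / V * 4 powr p" "0 \<le> q + 1" "(0::real) \<le> 4 powr p" using \<open>V > 0\<close> q0 by auto
      show ?thesis unfolding C by (simp only: ennreal_mult[OF nn(2,3)] ennreal_mult[OF nn(1,4)])
    qed
    moreover have "ennreal (4 powr p) * ennreal ((\<epsilon> * norm c) powr p) = ennreal (4 powr p * (\<epsilon> * norm c) powr p)"
      by (simp add: ennreal_mult)
    ultimately show "ennreal (\<bar>c \<bullet> \<nu> x0\<bar> powr p) \<le> ennreal C * (Lp_mass p G (\<lambda>x. v0 x - c)
         + Lp_mass p G (\<lambda>x. dist_weight \<alpha> \<Gamma> x * (\<Sum>i\<in>UNIV. norm (D0 i x))))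
         + ennreal (4 powr p * (\<epsilon> * norm c) powr p)"
      unfolding r_def X1_def X2_def h_def by simp
  qed
qed

section \<open>The weighted inequality\<close>

lemma powr_sum_le:
  fixes a :: "'b \<Rightarrow> real" and p :: real
  assumes B: "finite B" and p: "1 \<le> p" and a: "\<And>b. b \<in> B \<Longrightarrow> 0 \<le> a b"
  shows "(\<Sum>b\<in>B. a b) powr p \<le> real (card B) powr p * (\<Sum>b\<in>B. a b powr p)"
proof (cases "B = {}")
  case False
  obtain b0 where b0: "b0 \<in> B" "a b0 = Max (a ` B)"
    using Max_in[of "a ` B"] B False by fastforce
  have "(\<Sum>b\<in>B. a b) \<le> real (card B) * a b0"
    using sum_bounded_above[of B a "a b0"] B b0 by simp
  then have "(\<Sum>b\<in>B. a b) powr p \<le> (real (card B) * a b0) powr p"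
    using p a by (intro powr_mono2) (auto intro: sum_nonneg)
  also have "\<dots> = real (card B) powr p * a b0 powr p" by (simp add: powr_mult)
  also have "a b0 powr p \<le> (\<Sum>b\<in>B. a b powr p)"
    using member_le_sum[of b0 B "\<lambda>b. a b powr p"] B b0 by simp
  finally show ?thesis by (simp add: mult_left_mono)
qed simp

text \<open>The map sending \<open>c\<close> to the sum of \<open>(c \<bullet> b) b\<close> is
  injective on the span: a zero \<open>c\<close> has
  \<open>\<Sum>b\<in>B. (c \<bullet> b)^2 = 0\<close>, so it is orthogonal to the span that contains
  it. An injective linear map on a finite-dimensional space is bounded below.\<close>

lemma span_inner_coercive:
  fixes B :: "'a::euclidean_space set"
  assumes B: "finite B" and nB: "\<And>b. b \<in> B \<Longrightarrow> norm b \<le> 1"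
  shows "\<exists>\<kappa>>0. \<forall>c\<in>span B. \<kappa> * norm c \<le> (\<Sum>b\<in>B. \<bar>c \<bullet> b\<bar>)"
proof -
  define f where "f = (\<lambda>c. \<Sum>b\<in>B. (c \<bullet> b) *\<^sub>R b)"
  have lin: "bounded_linear f"
    unfolding f_def by (intro bounded_linear_sum bounded_linear_scaleR_const bounded_linear_inner_left)
  have inj: "\<forall>c\<in>span B. f c = 0 \<longrightarrow> c = 0"
  proof (intro ballI impI)
    fix c assume c: "c \<in> span B" "f c = 0"
    have "(\<Sum>b\<in>B. (c \<bullet> b)\<^sup>2) = f c \<bullet> c"
      unfolding f_def inner_sum_left power2_eq_square
      by (intro sum.cong refl) (simp add: inner_commute)
    then have "\<forall>b\<in>B. c \<bullet> b = 0" using c B by (simp add: sum_nonneg_eq_0_iff)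
    then have "orthogonal c c"
      using orthogonal_to_span[OF c(1), of c] by (simp add: orthogonal_def)
    then show "c = 0" by (simp add: orthogonal_def)
  qed
  obtain \<kappa> where \<kappa>: "\<kappa> > 0" "\<forall>c\<in>span B. \<kappa> * norm c \<le> norm (f c)"
    using injective_imp_isometric[OF closed_subspace[OF subspace_span] subspace_span lin inj] by (auto simp: mult.commute)
  have "norm (f c) \<le> (\<Sum>b\<in>B. \<bar>c \<bullet> b\<bar>)" for c
    unfolding f_def by (rule order_trans[OF norm_sum]) (auto intro!: sum_mono mult_left_le nB)
  then show ?thesis using \<kappa> by (meson order_trans)
qed

section \<open>Norms in terms of Borel representatives\<close>

lemma Lp_mass_eq_lebesgue_on:
  fixes f f0 :: "'a::euclidean_space \<Rightarrow> real"
  assumes [measurable]: "f0 \<in> borel_measurable borel" "G \<in> sets borel"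
    and eq: "AE x in lborel. x \<in> G \<longrightarrow> f x = f0 x"
  shows "Lp_mass p G f0 = (\<integral>\<^sup>+x. ennreal (\<bar>f x\<bar> powr p) \<partial>lebesgue_on G)"
    and "(\<integral>x. \<bar>f x\<bar> powr p \<partial>lebesgue_on G) = enn2real (Lp_mass p G f0)"
proof -
  have Gl: "G \<inter> space lebesgue \<in> sets lebesgue" by simp
  have AE1: "AE x in lebesgue. indicator G x * \<bar>f0 x\<bar> powr p = indicator G x * \<bar>f x\<bar> powr p"
    unfolding AE_completion_iff using eq by eventually_elim (auto simp: indicator_def)
  have "Lp_mass p G f0 = (\<integral>\<^sup>+x. ennreal (norm (f0 x) powr p) * indicator G x \<partial>lebesgue)"
    unfolding Lp_mass_def by (rule nn_integral_completion[symmetric])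
  also have "\<dots> = (\<integral>\<^sup>+x. ennreal (\<bar>f x\<bar> powr p) * indicator G x \<partial>lebesgue)"
    by (rule nn_integral_cong_AE) (use AE1 in eventually_elim, auto simp: indicator_def)
  also have "\<dots> = (\<integral>\<^sup>+x. ennreal (\<bar>f x\<bar> powr p) \<partial>lebesgue_on G)"
    by (rule nn_integral_restrict_space[OF Gl, symmetric])
  finally show "Lp_mass p G f0 = (\<integral>\<^sup>+x. ennreal (\<bar>f x\<bar> powr p) \<partial>lebesgue_on G)" .
  have m1: "(\<lambda>x. indicator G x * \<bar>f0 x\<bar> powr p) \<in> borel_measurable lborel" by measurable
  then have m2: "(\<lambda>x. indicator G x * \<bar>f0 x\<bar> powr p) \<in> borel_measurable lebesgue" by (rule measurable_completion)
  have m3: "(\<lambda>x. indicator G x * \<bar>f x\<bar> powr p) \<in> borel_measurable lebesgue"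
    by (rule borel_measurable_AE[OF m2 AE1])
  have "(\<integral>x. \<bar>f x\<bar> powr p \<partial>lebesgue_on G) = (\<integral>x. indicator G x *\<^sub>R (\<bar>f x\<bar> powr p) \<partial>lebesgue)"
    by (rule integral_restrict_space[OF Gl])
  also have "\<dots> = (\<integral>x. indicator G x * \<bar>f0 x\<bar> powr p \<partial>lebesgue)"
    unfolding real_scaleR_def
  proof (rule integral_cong_AE[OF m3 m2])
    show "AE x in lebesgue. indicator G x * \<bar>f x\<bar> powr p = indicator G x * \<bar>f0 x\<bar> powr p"
      using AE1 by eventually_elim (rule sym)
  qed
  also have "\<dots> = (\<integral>x. indicator G x * \<bar>f0 x\<bar> powr p \<partial>lborel)"
    by (rule integral_completion[OF m1])
  also have "\<dots> = enn2real (\<integral>\<^sup>+x. ennreal (indicator G x * \<bar>f0 x\<bar> powr p) \<partial>lborel)"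
    by (rule integral_eq_nn_integral[OF m1]) simp
  also have "(\<integral>\<^sup>+x. ennreal (indicator G x * \<bar>f0 x\<bar> powr p) \<partial>lborel) = Lp_mass p G f0"
    unfolding Lp_mass_def by (intro nn_integral_cong) (auto simp: indicator_def)
  finally show "(\<integral>x. \<bar>f x\<bar> powr p \<partial>lebesgue_on G) = enn2real (Lp_mass p G f0)" .
qed

lemma Lp_mass_finite_of_Lp:
  fixes f f0 :: "'a::euclidean_space \<Rightarrow> real"
  assumes "f0 \<in> borel_measurable borel" "G \<in> sets borel"
    and "AE x in lborel. x \<in> G \<longrightarrow> f x = f0 x" and L: "Lp p (lebesgue_on G) f"
  shows "Lp_mass p G f0 < \<infinity>"
  unfolding Lp_mass_eq_lebesgue_on(1)[OF assms(1-3)]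
  using L by (auto simp: Lp_def integrable_iff_bounded)

lemma Lp_norm_powr_eq:
  fixes f f0 :: "'a::euclidean_space \<Rightarrow> real"
  assumes p: "1 \<le> p" and "f0 \<in> borel_measurable borel" "G \<in> sets borel"
    and "AE x in lborel. x \<in> G \<longrightarrow> f x = f0 x"
  shows "Lp_norm p (lebesgue_on G) f powr p = enn2real (Lp_mass p G f0)"
  unfolding Lp_norm_def Lp_mass_eq_lebesgue_on(2)[OF assms(2-4)]
  using p by (simp add: powr_powr)

lemma Lp_mass_sum_le:
  fixes f :: "'b \<Rightarrow> 'a::euclidean_space \<Rightarrow> real" and g :: "'a \<Rightarrow> 'c::real_normed_vector"
  assumes p: "1 \<le> p" and I: "finite I" and [measurable]: "\<And>i. i \<in> I \<Longrightarrow> f i \<in> borel_measurable borel" "G \<in> sets borel"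
    and le: "\<And>x. x \<in> G \<Longrightarrow> norm (g x) \<le> (\<Sum>i\<in>I. \<bar>f i x\<bar>)"
  shows "Lp_mass p G g \<le> ennreal (real (card I) powr p) * (\<Sum>i\<in>I. Lp_mass p G (f i))"
proof -
  have "Lp_mass p G g \<le> (\<integral>\<^sup>+x. ennreal (real (card I) powr p) * (\<Sum>i\<in>I. ennreal (norm (f i x) powr p) * indicator G x) \<partial>lborel)"
    unfolding Lp_mass_def
  proof (rule nn_integral_mono)
    fix x
    show "ennreal (norm (g x) powr p) * indicator G x \<le> ennreal (real (card I) powr p) * (\<Sum>i\<in>I. ennreal (norm (f i x) powr p) * indicator G x)"
    proof (cases "x \<in> G")
      case True
      have "norm (g x) powr p \<le> (\<Sum>i\<in>I. \<bar>f i x\<bar>) powr p" using le[OF True] p by (intro powr_mono2) auto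
      also have "\<dots> \<le> real (card I) powr p * (\<Sum>i\<in>I. \<bar>f i x\<bar> powr p)" by (rule powr_sum_le[OF I p]) simp
      finally have "ennreal (norm (g x) powr p) \<le> ennreal (real (card I) powr p * (\<Sum>i\<in>I. \<bar>f i x\<bar> powr p))" by (rule ennreal_leI)
      then show ?thesis using True by (simp add: ennreal_mult sum_nonneg sum_ennreal)
    qed simp
  qed
  also have "\<dots> = ennreal (real (card I) powr p) * (\<Sum>i\<in>I. Lp_mass p G (f i))"
    unfolding Lp_mass_def by (subst nn_integral_cmult, measurable) (subst nn_integral_sum, auto)
  finally show ?thesis .
qed

lemma exterior_unit_normal_norm_le:
  "exterior_unit_normal G x n \<Longrightarrow> norm n \<le> 1"
  unfolding exterior_unit_normal_def by (auto simp: divide_simps)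

text \<open>The order of the choices matters: first the finite set \<open>B\<close> of independent
  normals and the coercivity constant \<open>\<Lambda>\<close>, then \<open>\<epsilon>\<close>, and
  only then the constants \<open>Cb\<close>, which depend on \<open>\<epsilon>\<close>. The Poincare
  estimate turns the mass of \<open>v0 - c\<close> into a gradient term, both directly and inside
  the bound for \<open>c\<close>.\<close>

lemma weighted_poincare_borel:
  fixes A G \<Gamma> :: "(real^'n) set" and \<nu> :: "real^'n \<Rightarrow> real^'n"
  assumes p: "1 \<le> p" and N: "CARD('n) = Suc m" "1 \<le> m"
    and Hm: "\<And>X :: (real^'n) set. X \<in> sets borel \<Longrightarrow> emeasure (hausdorff_measure m) X = hausdorff_outer m X"
    and \<alpha>: "0 \<le> \<alpha>" "\<alpha> \<le> 1" and G: "bounded_domain G" "boundary_C0 \<alpha> G"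
    and A: "A = frontier G \<inter> Q" "open Q" and \<Gamma>: "\<Gamma> \<subseteq> frontier G" "\<Gamma> \<inter> A = {}"
    and \<nu>: "continuous_on A \<nu>" "\<And>x. x \<in> A \<Longrightarrow> norm (\<nu> x) \<le> 1"
  shows "\<exists>C\<ge>0. \<forall>v0 D0. vanishing_normal_trace p G A \<nu> v0 D0 \<longrightarrow> (AE x in lborel. x \<in> G \<longrightarrow> v0 x \<in> span (\<nu> ` A)) \<longrightarrow>
      Lp_mass p G v0 < \<infinity> \<longrightarrow>
      Lp_mass p G v0 \<le> ennreal C * Lp_mass p G (\<lambda>x. dist_weight \<alpha> \<Gamma> x * (\<Sum>i\<in>UNIV. norm (D0 i x)))"
proof -
  have Gd: "G \<noteq> {}" "open G" "connected G" "bounded G" using G(1) by (auto simp: bounded_domain_def)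
  have [measurable]: "G \<in> sets borel" using Gd by simp
  have clG: "closure \<Gamma> \<subseteq> frontier G" using \<Gamma>(1) by (simp add: closure_minimal)
  have clQ: "closure \<Gamma> \<inter> Q = {}"
  proof -
    have "Q \<inter> \<Gamma> = {}" using \<Gamma> A(1) by blast
    then show ?thesis using open_Int_closure_eq_empty[OF A(2), of \<Gamma>] by blast
  qed
  have chart: "\<exists>U e \<phi>. x \<in> U \<and> graph_chart G U e \<phi> \<and> hoelder_on \<alpha> (horizontal e ` U) \<phi>" if "x \<in> frontier G" for x
    using G(2) that by (simp add: boundary_C0_def)
  have wpos: "\<exists>m>0. \<forall>x\<in>K. m \<le> dist_weight \<alpha> \<Gamma> x" if "compact K" "K \<subseteq> G" for K
  proof (rule dist_weight_lower_bound[OF \<alpha>(1) that(1)])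
    have "G \<inter> frontier G = {}" using Gd(2) by (auto simp: frontier_def interior_open)
    then show "K \<inter> closure \<Gamma> = {}" using that(2) clG by blast
  qed
  have collar: "\<exists>W. open W \<and> x \<in> W \<and> collar_neighborhood G (dist_weight \<alpha> \<Gamma>) W" if x: "x \<in> frontier G" for x
  proof -
    obtain U e \<phi> where "x \<in> U" "graph_chart G U e \<phi>" "hoelder_on \<alpha> (horizontal e ` U) \<phi>" using chart[OF x] by blast
    then show ?thesis using collar_neighborhood_of_chart[OF \<alpha> Gd(2) \<Gamma>(1) x] by blast
  qed
  have "\<exists>C\<ge>0. \<forall>(u :: real^'n \<Rightarrow> real^'n) h P. upper_gradient G u h \<longrightarrow> Lp_mass p G u < \<infinity> \<longrightarrow>
    (AE x in lborel. x \<in> G \<longrightarrow> P x) \<longrightarrow>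
    (\<exists>y\<in>G. P y \<and> Lp_mass p G (\<lambda>x. u x - u y) \<le> ennreal C * Lp_mass p G (\<lambda>x. dist_weight \<alpha> \<Gamma> x * h x))"
    by (rule improved_poincare[OF p Gd(2-4,1) borel_measurable_dist_weight]) (rule wpos collar; assumption)+
  then obtain C1 where C1: "0 \<le> C1" and C1': "\<forall>(u :: real^'n \<Rightarrow> real^'n) h P. upper_gradient G u h \<longrightarrow> Lp_mass p G u < \<infinity> \<longrightarrow>
    (AE x in lborel. x \<in> G \<longrightarrow> P x) \<longrightarrow>
    (\<exists>y\<in>G. P y \<and> Lp_mass p G (\<lambda>x. u x - u y) \<le> ennreal C1 * Lp_mass p G (\<lambda>x. dist_weight \<alpha> \<Gamma> x * h x))"
    by (elim exE conjE)
  obtain B where B: "B \<subseteq> \<nu> ` A" "independent B" "\<nu> ` A \<subseteq> span B"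
    using maximal_independent_subset[of "\<nu> ` A"] by metis
  have finB: "finite B" using B(2) by (rule independent_imp_finite)
  have nB: "norm b \<le> 1" if "b \<in> B" for b using B(1) \<nu>(2) that by auto
  have span: "span (\<nu> ` A) \<subseteq> span B" using B(3) by (rule span_minimal[OF _ subspace_span])
  obtain \<kappa> where \<kappa>: "\<kappa> > 0" "\<And>c. c \<in> span B \<Longrightarrow> \<kappa> * norm c \<le> (\<Sum>b\<in>B. \<bar>c \<bullet> b\<bar>)"
    using span_inner_coercive[OF finB nB] by blast
  define \<Lambda> where "\<Lambda> = (1 / \<kappa>) powr p * real (card B) powr p"
  have \<Lambda>0: "0 \<le> \<Lambda>" by (simp add: \<Lambda>_def)
  have \<Lambda>: "norm c powr p \<le> \<Lambda> * (\<Sum>b\<in>B. \<bar>c \<bullet> b\<bar> powr p)" if c: "c \<in> span B" for c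
  proof -
    have "norm c \<le> 1 / \<kappa> * (\<Sum>b\<in>B. \<bar>c \<bullet> b\<bar>)" using \<kappa>(2)[OF c] \<kappa>(1) by (simp add: field_simps)
    then have "norm c powr p \<le> (1 / \<kappa> * (\<Sum>b\<in>B. \<bar>c \<bullet> b\<bar>)) powr p" using p by (intro powr_mono2) auto
    also have "\<dots> = (1 / \<kappa>) powr p * (\<Sum>b\<in>B. \<bar>c \<bullet> b\<bar>) powr p" by (simp only: powr_mult)
    also have "\<dots> \<le> (1 / \<kappa>) powr p * (real (card B) powr p * (\<Sum>b\<in>B. \<bar>c \<bullet> b\<bar> powr p))"
      by (intro mult_left_mono powr_sum_le[OF finB p]) auto
    finally show ?thesis by (simp add: \<Lambda>_def mult.assoc)
  qed
  \<comment> \<open>On the right-hand side \<open>norm c powr p\<close> will have the coefficient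
    \<open>\<Lambda> * card B * 4 powr p * \<epsilon> powr p\<close>. With
    \<open>\<epsilon> powr p = 1 / q\<close> it is at most \<open>1/2\<close>; the summand 1 keeps
    \<open>q\<close> positive also when \<open>B\<close> is empty.\<close>
  define q where "q = 2 * (\<Lambda> * real (card B) * 4 powr p + 1)"
  have q: "q > 0" using \<Lambda>0 by (simp add: q_def add_nonneg_pos)
  define \<epsilon> where "\<epsilon> = (1 / q) powr (1 / p)"
  have \<epsilon>: "\<epsilon> > 0" "\<epsilon> powr p = 1 / q" using q p by (auto simp: \<epsilon>_def powr_powr)
  have "\<forall>b\<in>B. \<exists>C\<ge>0. \<forall>v0 D0 c. vanishing_normal_trace p G A \<nu> v0 D0 \<longrightarrow>
      ennreal (\<bar>c \<bullet> b\<bar> powr p) \<le> ennreal C * (Lp_mass p G (\<lambda>x. v0 x - c)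
         + Lp_mass p G (\<lambda>x. dist_weight \<alpha> \<Gamma> x * (\<Sum>i\<in>UNIV. norm (D0 i x))))
         + ennreal (4 powr p * (\<epsilon> * norm c) powr p)"
  proof
    fix b assume "b \<in> B"
    then obtain x0 where x0: "x0 \<in> A" "b = \<nu> x0" using B(1) by auto
    then obtain U e \<phi> where U: "x0 \<in> U" "graph_chart G U e \<phi>" using chart[of x0] A(1) by blast
    show "\<exists>C\<ge>0. \<forall>v0 D0 c. vanishing_normal_trace p G A \<nu> v0 D0 \<longrightarrow>
      ennreal (\<bar>c \<bullet> b\<bar> powr p) \<le> ennreal C * (Lp_mass p G (\<lambda>x. v0 x - c)
         + Lp_mass p G (\<lambda>x. dist_weight \<alpha> \<Gamma> x * (\<Sum>i\<in>UNIV. norm (D0 i x))))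
         + ennreal (4 powr p * (\<epsilon> * norm c) powr p)"
      unfolding x0(2)
      by (rule normal_component_bound[OF p N Hm \<alpha>(1) Gd(2) A clQ U(2) x0(1) U(1) \<nu> \<epsilon>(1)])
  qed
  from bchoice[OF this] obtain Cb where Cb: "\<forall>b\<in>B. 0 \<le> Cb b \<and> (\<forall>v0 D0 c. vanishing_normal_trace p G A \<nu> v0 D0 \<longrightarrow>
      ennreal (\<bar>c \<bullet> b\<bar> powr p) \<le> ennreal (Cb b) * (Lp_mass p G (\<lambda>x. v0 x - c)
         + Lp_mass p G (\<lambda>x. dist_weight \<alpha> \<Gamma> x * (\<Sum>i\<in>UNIV. norm (D0 i x))))
         + ennreal (4 powr p * (\<epsilon> * norm c) powr p))" by (elim exE)
  define S where "S = (\<Sum>b\<in>B. Cb b)"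
  have S0: "0 \<le> S" unfolding S_def using Cb by (intro sum_nonneg) auto
  obtain VG where VG: "emeasure lborel G = ennreal VG" "0 \<le> VG"
    using emeasure_bounded_finite[OF Gd(4)] by (cases "emeasure lborel G") auto
  define C where "C = 2 powr p * (C1 + 2 * \<Lambda> * S * (C1 + 1) * VG)"
  show ?thesis
  proof (intro exI[of _ C] conjI allI impI)
    show "0 \<le> C" using C1 \<Lambda>0 S0 VG by (simp add: C_def)
    fix v0 :: "real^'n \<Rightarrow> real^'n" and D0 :: "'n \<Rightarrow> real^'n \<Rightarrow> real^'n"
    assume vt: "vanishing_normal_trace p G A \<nu> v0 D0" and sp: "AE x in lborel. x \<in> G \<longrightarrow> v0 x \<in> span (\<nu> ` A)"
      and fin: "Lp_mass p G v0 < \<infinity>"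
    have v0[measurable]: "v0 \<in> borel_measurable borel" and wg: "\<forall>i. weak_gradient G (\<lambda>x. v0 x $ i) (D0 i)"
      using vt by (auto simp: vanishing_normal_trace_def)
    define X2 where "X2 = Lp_mass p G (\<lambda>x. dist_weight \<alpha> \<Gamma> x * (\<Sum>i\<in>UNIV. norm (D0 i x)))"
    have "upper_gradient G v0 (\<lambda>x. \<Sum>i\<in>UNIV. norm (D0 i x))"
      by (rule upper_gradient_of_weak_gradient[OF Gd(2) v0 wg[rule_format]])
    from C1'[rule_format, OF this fin sp] obtain y where y: "v0 y \<in> span (\<nu> ` A)"
      "Lp_mass p G (\<lambda>x. v0 x - v0 y) \<le> ennreal C1 * X2" unfolding X2_def by blast
    define c where "c = v0 y"
    define X1 where "X1 = Lp_mass p G (\<lambda>x. v0 x - c)"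
    have X1: "X1 \<le> ennreal C1 * X2" using y(2) by (simp add: X1_def c_def)
    have c: "c \<in> span B" using y(1) span by (auto simp: c_def)
    have cb: "ennreal (\<bar>c \<bullet> b\<bar> powr p) \<le> ennreal (Cb b) * (X1 + X2) + ennreal (4 powr p * (\<epsilon> * norm c) powr p)" if "b \<in> B" for b
      using Cb that vt unfolding X1_def X2_def by blast
    have "ennreal (norm c powr p) \<le> ennreal (\<Lambda> * (\<Sum>b\<in>B. \<bar>c \<bullet> b\<bar> powr p))" by (rule ennreal_leI[OF \<Lambda>[OF c]])
    also have "\<dots> = ennreal \<Lambda> * (\<Sum>b\<in>B. ennreal (\<bar>c \<bullet> b\<bar> powr p))"
      using \<Lambda>0 by (simp add: ennreal_mult sum_nonneg sum_ennreal)
    also have "\<dots> \<le> ennreal \<Lambda> * (\<Sum>b\<in>B. ennreal (Cb b) * (X1 + X2) + ennreal (4 powr p * (\<epsilon> * norm c) powr p))"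
      by (intro mult_left_mono sum_mono cb) auto
    also have "(\<Sum>b\<in>B. ennreal (Cb b) * (X1 + X2) + ennreal (4 powr p * (\<epsilon> * norm c) powr p)) = ennreal S * (X1 + X2) + ennreal (real (card B) * (4 powr p * (\<epsilon> * norm c) powr p))"
    proof -
      have "(\<Sum>b\<in>B. ennreal (Cb b)) = ennreal S" unfolding S_def using Cb by (intro sum_ennreal) auto
      then show ?thesis
        by (simp add: sum.distrib sum_distrib_right[symmetric] ennreal_mult ennreal_of_nat_eq_real_of_nat)
    qed
    also have "ennreal \<Lambda> * (ennreal S * (X1 + X2) + ennreal (real (card B) * (4 powr p * (\<epsilon> * norm c) powr p)))
        \<le> ennreal (\<Lambda> * S) * (X1 + X2) + ennreal (1/2 * norm c powr p)"
    proof -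
      have "\<Lambda> * (real (card B) * (4 powr p * (\<epsilon> * norm c) powr p)) = (\<Lambda> * real (card B) * 4 powr p) / q * norm c powr p"
        using \<epsilon> by (simp add: powr_mult)
      also have "\<dots> \<le> 1/2 * norm c powr p"
        using q \<Lambda>0 by (intro mult_right_mono) (auto simp: q_def field_simps)
      finally have "ennreal \<Lambda> * ennreal (real (card B) * (4 powr p * (\<epsilon> * norm c) powr p)) \<le> ennreal (1/2 * norm c powr p)"
        using \<Lambda>0 by (subst ennreal_mult[symmetric]) (auto intro: ennreal_leI)
      moreover have "ennreal \<Lambda> * (ennreal S * (X1 + X2)) = ennreal (\<Lambda> * S) * (X1 + X2)"
        using \<Lambda>0 S0 by (simp add: ennreal_mult mult.assoc)
      ultimately show ?thesis unfolding distrib_left[of "ennreal \<Lambda>"] by (simp add: add_mono)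
    qed
    finally have full: "ennreal (norm c powr p) \<le> ennreal (\<Lambda> * S) * (X1 + X2) + ennreal (1/2 * norm c powr p)" .
    \<comment> \<open>Half of \<open>norm c powr p\<close>, a finite quantity, is cancelled on both
      sides.\<close>
    have half: "ennreal (1/2 * norm c powr p) \<le> ennreal (\<Lambda> * S) * (X1 + X2)"
    proof -
      have "ennreal (norm c powr p) = ennreal (1/2 * norm c powr p) + ennreal (1/2 * norm c powr p)"
        by (subst ennreal_plus[symmetric]) auto
      then have "ennreal (1/2 * norm c powr p) + ennreal (1/2 * norm c powr p) \<le> ennreal (1/2 * norm c powr p) + ennreal (\<Lambda> * S) * (X1 + X2)"
        using full by (simp only: add.commute)
      then show ?thesis using ennreal_add_left_cancel_le by (metis ennreal_neq_top infinity_ennreal_def)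
    qed
    have X12: "X1 + X2 \<le> ennreal (C1 + 1) * X2"
      using X1 C1 by (simp add: ennreal_plus distrib_right)
    have cle: "ennreal (norm c powr p) \<le> ennreal (2 * \<Lambda> * S * (C1 + 1)) * X2"
    proof -
      have "ennreal (norm c powr p) = ennreal 2 * ennreal (1/2 * norm c powr p)"
        by (subst ennreal_mult[symmetric]) auto
      also have "\<dots> \<le> ennreal 2 * (ennreal (\<Lambda> * S) * (ennreal (C1 + 1) * X2))"
        by (intro mult_left_mono order_trans[OF half] X12) auto
      also have "\<dots> = (ennreal 2 * ennreal (\<Lambda> * S) * ennreal (C1 + 1)) * X2" by (simp only: mult.assoc)
      also have "ennreal 2 * ennreal (\<Lambda> * S) * ennreal (C1 + 1) = ennreal (2 * \<Lambda> * S * (C1 + 1))"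
      proof -
        have nn: "(0::real) \<le> 2" "0 \<le> \<Lambda> * S" "0 \<le> 2 * (\<Lambda> * S)" "0 \<le> C1 + 1" using \<Lambda>0 S0 C1 by auto
        show ?thesis by (simp only: ennreal_mult[OF nn(3,4), symmetric] ennreal_mult[OF nn(1,2), symmetric] mult.assoc)
      qed
      finally show ?thesis .
    qed
    have "Lp_mass p G v0 \<le> ennreal (2 powr p) * (X1 + Lp_mass p G (\<lambda>_. c))"
      unfolding X1_def
    proof (rule Lp_mass_add_le[OF p])
      show "norm (v0 x) \<le> norm (v0 x - c) + norm c" for x using norm_triangle_sub[of "v0 x" c] by simp
    qed measurable
    also have "Lp_mass p G (\<lambda>_. c) = ennreal (norm c powr p) * ennreal VG" by (simp add: Lp_mass_const VG)
    also have "ennreal (2 powr p) * (X1 + ennreal (norm c powr p) * ennreal VG)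
       \<le> ennreal (2 powr p) * (ennreal C1 * X2 + (ennreal (2 * \<Lambda> * S * (C1 + 1)) * X2) * ennreal VG)"
      by (intro mult_left_mono add_mono X1 mult_right_mono cle) auto
    also have "\<dots> = ennreal C * X2"
    proof -
      define k where "k = 2 * \<Lambda> * S * (C1 + 1)"
      have nn: "0 \<le> k" "0 \<le> k * VG" "0 \<le> C1 + k * VG" "(0::real) \<le> 2 powr p" using \<Lambda>0 S0 C1 VG by (auto simp: k_def)
      have "ennreal C = ennreal (2 powr p) * (ennreal C1 + ennreal k * ennreal VG)"
        unfolding C_def k_def[symmetric]
        by (simp only: ennreal_mult[OF nn(4,3)] ennreal_plus[OF C1 nn(2)] ennreal_mult[OF nn(1) VG(2)])
      then show ?thesis unfolding k_def[symmetric] by (simp only: distrib_left distrib_right ac_simps)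
    qed
    finally show "Lp_mass p G v0 \<le> ennreal C * Lp_mass p G (\<lambda>x. dist_weight \<alpha> \<Gamma> x * (\<Sum>i\<in>UNIV. norm (D0 i x)))"
      unfolding X2_def .
  qed
qed

theorem theorem3p7:
  fixes G A \<Gamma>\<^sub>0 :: "(real^'n) set"
    and \<nu> :: "real^'n \<Rightarrow> real^'n"
    and p \<alpha> :: real
  assumes "CARD('n) \<ge> 2"
    and "1 \<le> p"
    and "0 \<le> \<alpha>" and "\<alpha> \<le> 1"
    and "bounded_domain G"
    and "boundary_C0 \<alpha> G"
    and "A \<subseteq> frontier G"
    and "openin (top_of_set (frontier G)) A"
    and "emeasure (hausdorff_measure (CARD('n) - 1)) A > 0"
    and "\<And>x. x \<in> A \<Longrightarrow> exterior_unit_normal G x (\<nu> x)"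
    and "continuous_on A \<nu>"
    and "\<Gamma>\<^sub>0 \<subseteq> frontier G - closure A"
  shows "\<exists>\<eta>>0. \<forall>v D w.
           v \<in> weighted_sobolev p \<alpha> \<Gamma>\<^sub>0 G \<longrightarrow>
           weak_jacobian G v D \<longrightarrow>
           (AE x in lebesgue_on G. v x \<in> span (\<nu> ` A)) \<longrightarrow>
           has_trace p G A v w \<longrightarrow>
           (AE x in restrict_space (hausdorff_measure (CARD('n) - 1)) A. w x \<bullet> \<nu> x = 0) \<longrightarrow>
           Lp_norm_vec p (lebesgue_on G) v
             \<le> inverse \<eta> * Lp_norm_mat p (lebesgue_on G) (\<lambda>x. dist_weight \<alpha> \<Gamma>\<^sub>0 x *\<^sub>R D x)"
proof -
  note p = \<open>1 \<le> p\<close>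
  have G: "open G" using \<open>bounded_domain G\<close> by (simp add: bounded_domain_def)
  have Gb: "G \<in> sets borel" using G by simp
  obtain Q where Q: "A = frontier G \<inter> Q" "open Q"
    using \<open>openin (top_of_set (frontier G)) A\<close> unfolding openin_open by blast
  define m where "m = CARD('n) - 1"
  have N: "CARD('n) = Suc m" "1 \<le> m" using \<open>CARD('n) \<ge> 2\<close> by (auto simp: m_def)
  have Hm: "emeasure (hausdorff_measure m) X = hausdorff_outer m X" if "X \<in> sets borel" for X :: "(real^'n) set"
    by (rule emeasure_hausdorff_measure[OF _ that]) (use assms(9) in \<open>simp add: m_def\<close>)
  let ?w = "dist_weight \<alpha> \<Gamma>\<^sub>0"
  have \<Gamma>: "\<Gamma>\<^sub>0 \<subseteq> frontier G" "\<Gamma>\<^sub>0 \<inter> A = {}" using assms(12) closure_subset[of A] by auto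
  have \<nu>1: "norm (\<nu> x) \<le> 1" if "x \<in> A" for x
    using exterior_unit_normal_norm_le assms(10)[OF that] by blast
  have "\<exists>C\<ge>0. \<forall>v0 D0. vanishing_normal_trace p G A \<nu> v0 D0 \<longrightarrow> (AE x in lborel. x \<in> G \<longrightarrow> v0 x \<in> span (\<nu> ` A)) \<longrightarrow>
      Lp_mass p G v0 < \<infinity> \<longrightarrow>
      Lp_mass p G v0 \<le> ennreal C * Lp_mass p G (\<lambda>x. ?w x * (\<Sum>i\<in>UNIV. norm (D0 i x)))"
    by (rule weighted_poincare_borel[OF p N _ assms(3-6) Q \<Gamma> assms(11)]) (rule Hm \<nu>1; assumption)+
  then obtain C where C0: "0 \<le> C" and C: "\<forall>v0 D0. vanishing_normal_trace p G A \<nu> v0 D0 \<longrightarrow> (AE x in lborel. x \<in> G \<longrightarrow> v0 x \<in> span (\<nu> ` A)) \<longrightarrow>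
      Lp_mass p G v0 < \<infinity> \<longrightarrow>
      Lp_mass p G v0 \<le> ennreal C * Lp_mass p G (\<lambda>x. ?w x * (\<Sum>i\<in>UNIV. norm (D0 i x)))"
    by (elim exE conjE)
  define n2 where "n2 = real (card (UNIV :: ('n \<times> 'n) set))"
  \<comment> \<open>\<open>n2 powr p\<close> pays for splitting the row norms into matrix entries,
    \<open>CARD('n)\<close> for bounding each component of \<open>v\<close> by the full norm. As
    \<open>L\<close> may be 0, the constant is built from \<open>L + 1\<close>, which keeps its
    inverse positive.\<close>
  define L where "L = real CARD('n) * (C * n2 powr p)"
  have L0: "0 \<le> L" using C0 by (simp add: L_def)
  show ?thesis
  proof (intro exI[of _ "inverse ((L + 1) powr (1 / p))"] conjI allI impI)
    show "0 < inverse ((L + 1) powr (1 / p))" using L0 by simp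
    fix v D w
    assume v: "v \<in> weighted_sobolev p \<alpha> \<Gamma>\<^sub>0 G" and D: "weak_jacobian G v D"
      and sp: "AE x in lebesgue_on G. v x \<in> span (\<nu> ` A)" and tr: "has_trace p G A v w"
      and wnu: "AE x in restrict_space (hausdorff_measure (CARD('n) - 1)) A. w x \<bullet> \<nu> x = 0"
    obtain v0 D0 where v0[measurable]: "v0 \<in> borel_measurable borel" and D0[measurable]: "\<And>i. D0 i \<in> borel_measurable borel"
      and eq: "AE x in lborel. x \<in> G \<longrightarrow> v x = v0 x \<and> (\<forall>i. D x $ i = D0 i x)"
      and wg: "\<And>i. weak_gradient G (\<lambda>x. v0 x $ i) (D0 i)"
      by (rule weak_jacobian_ex_borel[OF G D]) (rule that)
    \<comment> \<open>The Jacobian from membership in the weighted space may differ from the given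
      \<open>D\<close>. By uniqueness both agree with \<open>D0\<close> almost everywhere, so the
      weighted integrability passes to \<open>D0\<close>.\<close>
    from v obtain D' where vLp: "\<forall>i. Lp p (lebesgue_on G) (\<lambda>x. v x $ i)" and D': "weak_jacobian G v D'"
      and DLp: "\<forall>i j. Lp p (lebesgue_on G) (\<lambda>x. ?w x * D' x $ i $ j)"
      unfolding weighted_sobolev_def by blast
    obtain v1 D1 where v1: "AE x in lborel. x \<in> G \<longrightarrow> v x = v1 x \<and> (\<forall>i. D' x $ i = D1 i x)"
      and wg1: "\<And>i. weak_gradient G (\<lambda>x. v1 x $ i) (D1 i)"
      by (rule weak_jacobian_ex_borel[OF G D']) (rule that)
    have "AE x in lborel. x \<in> G \<inter> G \<longrightarrow> D1 i x = D0 i x" for i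
    proof (rule weak_gradient_unique[OF wg1 wg G G])
      show "AE x in lborel. x \<in> G \<inter> G \<longrightarrow> v1 x $ i = v0 x $ i"
        using v1 eq by eventually_elim auto
    qed
    then have "AE x in lborel. \<forall>i\<in>UNIV. x \<in> G \<inter> G \<longrightarrow> D1 i x = D0 i x"
      by (subst AE_ball_countable) auto
    with v1 have eqD: "AE x in lborel. x \<in> G \<longrightarrow> ?w x * D' x $ i $ j = ?w x * D0 i x $ j" for i j
      by eventually_elim auto
    have eqv: "AE x in lborel. x \<in> G \<longrightarrow> v x = v0 x" using eq by eventually_elim auto
    have eqvi: "AE x in lborel. x \<in> G \<longrightarrow> v x $ i = v0 x $ i" for i using eqv by eventually_elim auto
    have eqDs: "AE x in lborel. x \<in> G \<longrightarrow> (?w x *\<^sub>R D x) $ i $ j = ?w x * D0 i x $ j" for i j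
      using eq by eventually_elim auto
    have wD[measurable]: "(\<lambda>x. ?w x * D0 i x $ j) \<in> borel_measurable borel" for i j by measurable
    have vi[measurable]: "(\<lambda>x. v0 x $ i) \<in> borel_measurable borel" for i by measurable
    have finv: "Lp_mass p G (\<lambda>x. v0 x $ i) < \<infinity>" for i
      by (rule Lp_mass_finite_of_Lp[OF vi Gb eqvi]) (use vLp in blast)
    have finD: "Lp_mass p G (\<lambda>x. ?w x * D0 i x $ j) < \<infinity>" for i j
      by (rule Lp_mass_finite_of_Lp[OF wD Gb eqD]) (use DLp in blast)
    define a where "a = (\<lambda>i. enn2real (Lp_mass p G (\<lambda>x. v0 x $ i)))"
    define b where "b = (\<lambda>i j. enn2real (Lp_mass p G (\<lambda>x. ?w x * D0 i x $ j)))"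
    have a: "Lp_mass p G (\<lambda>x. v0 x $ i) = ennreal (a i)" for i using finv[of i] by (simp add: a_def)
    have b: "Lp_mass p G (\<lambda>x. ?w x * D0 i x $ j) = ennreal (b i j)" for i j using finD[of i j] by (simp add: b_def)
    have a0: "0 \<le> a i" and b0: "0 \<le> b i j" for i j by (simp_all add: a_def b_def)
    have fin: "Lp_mass p G v0 < \<infinity>"
    proof -
      have "Lp_mass p G v0 \<le> ennreal (real CARD('n) powr p) * (\<Sum>i\<in>UNIV. Lp_mass p G (\<lambda>x. v0 x $ i))"
        by (rule Lp_mass_sum_le[OF p _ vi Gb]) (simp_all add: norm_le_l1_cart)
      also have "\<dots> < \<infinity>" by (simp add: a sum_ennreal a0 ennreal_mult_less_top)
      finally show ?thesis .
    qed
    have "AE x in lborel. x \<in> G \<longrightarrow> v x \<in> span (\<nu> ` A)"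
      using sp Gb by (subst (asm) AE_restrict_space_iff) (auto simp: AE_completion_iff)
    then have sp0: "AE x in lborel. x \<in> G \<longrightarrow> v0 x \<in> span (\<nu> ` A)"
      using eqv by eventually_elim auto
    have P: "Lp_mass p G v0 \<le> ennreal C * Lp_mass p G (\<lambda>x. ?w x * (\<Sum>i\<in>UNIV. norm (D0 i x)))"
    proof -
      have "vanishing_normal_trace p G A \<nu> v0 D0"
        unfolding vanishing_normal_trace_def using v0 wg tr wnu eqv by blast
      then show ?thesis using C sp0 fin by blast
    qed
    have Bsum: "(\<Sum>q\<in>UNIV. b (fst q) (snd q)) = (\<Sum>i\<in>UNIV. \<Sum>j\<in>UNIV. b i j)"
      by (simp add: sum.cartesian_product split_def UNIV_Times_UNIV[symmetric] del: UNIV_Times_UNIV)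
    have "Lp_mass p G (\<lambda>x. ?w x * (\<Sum>i\<in>UNIV. norm (D0 i x)))
       \<le> ennreal (n2 powr p) * (\<Sum>q\<in>(UNIV :: ('n \<times> 'n) set). Lp_mass p G (\<lambda>x. ?w x * D0 (fst q) x $ snd q))"
      unfolding n2_def
    proof (rule Lp_mass_sum_le[OF p _ wD Gb])
      fix x
      have "(\<Sum>i\<in>UNIV. norm (D0 i x)) \<le> (\<Sum>i\<in>UNIV. \<Sum>j\<in>UNIV. \<bar>D0 i x $ j\<bar>)"
        by (intro sum_mono norm_le_l1_cart)
      then have "?w x * (\<Sum>i\<in>UNIV. norm (D0 i x)) \<le> ?w x * (\<Sum>i\<in>UNIV. \<Sum>j\<in>UNIV. \<bar>D0 i x $ j\<bar>)"
        by (intro mult_left_mono dist_weight_nonneg)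
      also have "\<dots> = (\<Sum>q\<in>UNIV. \<bar>?w x * D0 (fst q) x $ snd q\<bar>)"
        using dist_weight_nonneg[of \<alpha> \<Gamma>\<^sub>0 x]
        by (simp add: sum_distrib_left abs_mult sum.cartesian_product split_def UNIV_Times_UNIV[symmetric] del: UNIV_Times_UNIV)
      finally show "norm (?w x * (\<Sum>i\<in>UNIV. norm (D0 i x))) \<le> (\<Sum>q\<in>UNIV. \<bar>?w x * D0 (fst q) x $ snd q\<bar>)"
        using dist_weight_nonneg[of \<alpha> \<Gamma>\<^sub>0 x] by (simp add: abs_mult sum_nonneg)
    qed simp
    also have "(\<Sum>q\<in>(UNIV :: ('n \<times> 'n) set). Lp_mass p G (\<lambda>x. ?w x * D0 (fst q) x $ snd q)) = ennreal (\<Sum>i\<in>UNIV. \<Sum>j\<in>UNIV. b i j)"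
      unfolding b Bsum[symmetric] by (rule sum_ennreal) (simp add: b0)
    finally have "Lp_mass p G v0 \<le> ennreal C * (ennreal (n2 powr p) * ennreal (\<Sum>i\<in>UNIV. \<Sum>j\<in>UNIV. b i j))"
      by (intro order_trans[OF P] mult_left_mono) auto
    also have "\<dots> = ennreal (C * n2 powr p * (\<Sum>i\<in>UNIV. \<Sum>j\<in>UNIV. b i j))"
      using C0 by (simp add: ennreal_mult sum_nonneg b0 mult.assoc)
    finally have le: "Lp_mass p G v0 \<le> ennreal (C * n2 powr p * (\<Sum>i\<in>UNIV. \<Sum>j\<in>UNIV. b i j))" .
    have bb0: "0 \<le> (\<Sum>i\<in>UNIV. \<Sum>j\<in>UNIV. b i j)" by (intro sum_nonneg b0)
    have "a i \<le> C * n2 powr p * (\<Sum>i\<in>UNIV. \<Sum>j\<in>UNIV. b i j)" for i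
    proof -
      have "ennreal (a i) \<le> Lp_mass p G v0"
        unfolding a[symmetric] using p by (intro Lp_mass_mono) (auto simp: component_le_norm_cart)
      then have "ennreal (a i) \<le> ennreal (C * n2 powr p * (\<Sum>i\<in>UNIV. \<Sum>j\<in>UNIV. b i j))" using le by (rule order_trans)
      then show ?thesis using C0 bb0 by (subst (asm) ennreal_le_iff) auto
    qed
    then have "(\<Sum>i\<in>UNIV. a i) \<le> L * (\<Sum>i\<in>UNIV. \<Sum>j\<in>UNIV. b i j)"
      using sum_bounded_above[of "UNIV :: 'n set" a "C * n2 powr p * (\<Sum>i\<in>UNIV. \<Sum>j\<in>UNIV. b i j)"] by (simp add: L_def mult.assoc)
    also have "\<dots> \<le> (L + 1) * (\<Sum>i\<in>UNIV. \<Sum>j\<in>UNIV. b i j)" using bb0 by (intro mult_right_mono) auto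
    finally have "(\<Sum>i\<in>UNIV. a i) powr (1 / p) \<le> ((L + 1) * (\<Sum>i\<in>UNIV. \<Sum>j\<in>UNIV. b i j)) powr (1 / p)"
      using p a0 by (intro powr_mono2) (auto intro: sum_nonneg)
    also have "\<dots> = (L + 1) powr (1 / p) * (\<Sum>i\<in>UNIV. \<Sum>j\<in>UNIV. b i j) powr (1 / p)" by (simp add: powr_mult)
    finally have "(\<Sum>i\<in>UNIV. a i) powr (1 / p) \<le> (L + 1) powr (1 / p) * (\<Sum>i\<in>UNIV. \<Sum>j\<in>UNIV. b i j) powr (1 / p)" .
    moreover have "Lp_norm_vec p (lebesgue_on G) v = (\<Sum>i\<in>UNIV. a i) powr (1 / p)"
      unfolding Lp_norm_vec_def a_def by (simp only: Lp_norm_powr_eq[OF p vi Gb eqvi])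
    moreover have "Lp_norm_mat p (lebesgue_on G) (\<lambda>x. ?w x *\<^sub>R D x) = (\<Sum>i\<in>UNIV. \<Sum>j\<in>UNIV. b i j) powr (1 / p)"
      unfolding Lp_norm_mat_def b_def by (simp only: Lp_norm_powr_eq[OF p wD Gb eqDs])
    ultimately show "Lp_norm_vec p (lebesgue_on G) v \<le>
        inverse (inverse ((L + 1) powr (1 / p))) * Lp_norm_mat p (lebesgue_on G) (\<lambda>x. ?w x *\<^sub>R D x)"
      by simp
  qed
qed

end
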